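(* For every second-order equational presentation $\mathcal{E}$, the category $\mathbf{Mod}(\mathcal{E})$ of $\mathcal{E}$-models and the category $\mathbb{M}\mathrm{od}(M_{\mathcal{E}})$ of set-theoretic second-order functorial models of the second-order algebraic theory $M_{\mathcal{E}}:\mathbb{M}\to\mathbb{M}(\mathcal{E})$ of $\mathcal{E}$ are equivalent.
   Context: Signatures and terms. A second-order signature $\Sigma=(\Omega,|-|)$ is a set $\Omega$ of operators with an arity function $|-|:\Omega\to\mathbb{N}^*$ (finite sequences); write $\omega:(n_1,\dots,n_k)$ if $|\omega|=(n_1,\dots,n_k)$. A context $\Theta\triangleright\Gamma$ consists of a list $\Theta=\mathsf{m}_1:[m_1],\dots,\mathsf{m}_k:[m_k]$ of distinct metavariables with meta-arities $m_i\in\mathbb{N}$ and a list $\Gamma=x_1,\dots,x_n$ of distinct variables. Terms are generated by: $\Theta\triangleright\Gamma\vdash x$ for $x\in\Gamma$; for $(\mathsf{m}:[m])\in\Theta$, if $\Theta\triangleright\Gamma\vdash t_i$ ($1\le i\le m$) then $\Theta\triangleright\Gamma\vdash\mathsf{m}[t_1,\dots,t_m]$; for $\omega:(n_1,\dots,n_k)$, if $\Theta\triangleright\Gamma,\vec{x}_i\vdash t_i$ with $\vec{x}_i=x^{(i)}_1,\dots,x^{(i)}_{n_i}$ ($1\le i\le k$) then $\Theta\triangleright\Gamma\vdash\omega((\vec{x}_1)t_1,\dots,(\vec{x}_k)t_k)$, with $\vec{x}_i$ bound in $t_i$; terms are taken up to $\alpha$-equivalence. Terms containing no operators are elementary. Substitution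 $t\{x_i:=t_i\}$ is capture-avoiding simultaneous substitution. Metasubstitution maps $\mathsf{m}_1:[m_1],\dots,\mathsf{m}_k:[m_k]\triangleright\Gamma\vdash t$ and $\Theta\triangleright\Gamma,\vec{x}_i\vdash t_i$ ($|\vec{x}_i|=m_i$) to $\Theta\triangleright\Gamma\vdash t\{\mathsf{m}_i:=(\vec{x}_i)t_i\}_{1\le i\le k}$; it fixes variables, commutes with operators (avoiding capture), and sends $\mathsf{m}_l[s_1,\dots,s_{m_l}]$ to $t_l\{x^{(l)}_j:=s'_j\}_j$, where $s'_j$ is the metasubstituted $s_j$. Equational presentations. An equation $\Theta\triangleright\Gamma\vdash s\equiv t$ is a pair of terms in the same context. A second-order equational presentation $\mathcal{E}=(\Sigma,E)$ is a signature $\Sigma$ with a set $E$ of equations (axioms). Derivability (Second-Order Equational Logic) is generated by the axioms; reflexivity, symmetry, transitivity; and extended metasubstitution: from $\mathsf{m}_1:[m_1],\dots,\mathsf{m}_k:[m_k]\triangleright\Gamma\vdash s\equiv t$ and $\Theta\triangleright\Delta,\vec{x}_i\vdash s_i\equiv t_i$ ($1\le i\le k$) infer $\Theta\triangleright\Gamma,\Delta\vdash s\{\mathsf{m}_i:=(\vec{x}_i)s_i\}_i\equiv t\{\mathsf{m}_i:=(\vec{x}_i)t_i\}_i$. Theory of a presentation. The classifying category $\mathbb{M}(\mathcal{E})$ has objects the sequences $(m_1,\dots,m_k)\in\mathbb{N}^*$, and morphisms $(m_1,\dots,m_k)\to(n_1,\dots,n_l)$ the tuples $\langle[\mathsf{m}_1:[m_1],\dots,\mathsf{m}_k:[m_k]\triangleright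 x_1,\dots,x_{n_i}\vdash t_i]_{\mathcal{E}}\rangle_{1\le i\le l}$ of equivalence classes of terms over $\Sigma$ modulo derivable equality in $\mathcal{E}$ (names in contexts are immaterial). The identity is $\langle[\mathsf{m}_i[x_1,\dots,x_{m_i}]]\rangle_i$, and the composite of $\langle[s_p]\rangle_p$ followed by $\langle[t_q]\rangle_q$ is $\langle[t_q\{\mathsf{m}_p:=(x_1,\dots,x_{m_p})s_p\}_p]\rangle_q$. Finite products are given by concatenation of sequences, with projections $\langle[\mathsf{m}_i[x_1,\dots,x_{m_i}]]\rangle$. $\mathbb{M}$ is the category defined in the same way from the empty signature and no axioms (its morphisms are tuples of elementary terms), and $M_{\mathcal{E}}:\mathbb{M}\to\mathbb{M}(\mathcal{E})$ is the identity-on-objects functor $\langle t_i\rangle_i\mapsto\langle[t_i]_{\mathcal{E}}\rangle_i$. Functorial models. A set-theoretic functorial model of $M_{\mathcal{E}}$ is a cartesian (finite-product-preserving, up to canonical isomorphism) functor $\mathbb{M}(\mathcal{E})\to\mathbf{Set}$. $\mathbb{M}\mathrm{od}(M_{\mathcal{E}})$ is the category of these functors and natural transformations. Models. Let $\mathbb{F}$ be the category with objects $n\in\mathbb{N}$ and morphisms $m\to n$ the functions $\{1,\dots,m\}\to\{1,\dots,n\}$, and let $\mathrm{y}:\mathbb{F}^{\mathrm{op}}\to\mathbf{Set}^{\mathbb{F}}$ be the Yoneda embedding; thus $X^{\mathrm{y}n}(k)\cong X(k+n)$. The substitution monoidal structure on $\mathbf{Set}^{\mathbb{F}}$ has unit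 $\mathrm{y}1$ and tensor $X\bullet Y=\int^{k\in\mathbb{F}}X(k)\times Y^k$. A signature $\Sigma$ induces the endofunctor $\mathcal{F}_\Sigma X=\coprod_{\omega:(n_1,\dots,n_k)\in\Omega}\prod_{1\le i\le k}X^{\mathrm{y}n_i}$ on $\mathbf{Set}^{\mathbb{F}}$. For a point $\eta:\mathrm{y}1\to Y$, the pointed strength $\varpi_{X,\eta}:\mathcal{F}_\Sigma(X)\bullet Y\to\mathcal{F}_\Sigma(X\bullet Y)$ is obtained from the canonical isomorphisms expressing that $(-)\bullet Y$ commutes with coproducts and finite products together with the maps $X^{\mathrm{y}n}\bullet Y\to(X\bullet Y)^{\mathrm{y}n}$ which at stage $m$ send the class of $(a,b)\in X(k+n)\times Y(m)^k$ to the class in $(X\bullet Y)(m+n)$ of $a\in X(k+n)$ and the $(k+n)$-tuple of elements of $Y(m+n)$ consisting of the images of $b_1,\dots,b_k$ under the inclusion $m\hookrightarrow m+n$ followed by $\eta_{m+n}(m+1),\dots,\eta_{m+n}(m+n)$. A $\Sigma$-model is an object $A$ of $\mathbf{Set}^{\mathbb{F}}$ with an algebra structure $\alpha:\mathcal{F}_\Sigma A\to A$ (with components $[\![\omega]\!]_A:\prod_iA^{\mathrm{y}n_i}\to A$) and a monoid structure $\nu:\mathrm{y}1\to A$, $\varsigma:A\bullet A\to A$ for the substitution monoidal structure, such that $\varsigma\circ(\alpha\bullet A)=\alpha\circ\mathcal{F}_\Sigma(\varsigma)\circ\varpi_{A,\nu}$. Morphisms are maps that are both $\mathcal{F}_\Sigma$-algebra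 and monoid homomorphisms; this gives the category $\mathbf{Mod}(\Sigma)$. Let $\nu_n:\mathrm{y}n\cong(\mathrm{y}1)^n\to A^n$ be $\nu^n$, and let $\varsigma_n:A^{\mathrm{y}n}\times A^n\to A$ be the map which at stage $k$ sends $(a,b)\in A(k+n)\times A(k)^n$ to the image under $\varsigma$ of the class of $a$ with the tuple $(\nu(1),\dots,\nu(k),b_1,\dots,b_n)\in A(k)^{k+n}$. A term $\Theta\triangleright\Gamma\vdash t$ with $\Theta=\mathsf{m}_1:[m_1],\dots,\mathsf{m}_k:[m_k]$ and $\Gamma=x_1,\dots,x_n$ is interpreted in a $\Sigma$-model $A$ as a morphism $[\![t]\!]_A:\prod_{1\le i\le k}A^{\mathrm{y}m_i}\times\mathrm{y}n\to A$ by induction: $[\![x_i]\!]_A=\pi_i\circ\nu_n\circ\pi_2$; $[\![\mathsf{m}_i[t_1,\dots,t_{m_i}]]\!]_A=\varsigma_{m_i}\circ\langle\pi_i\pi_1,\langle[\![t_j]\!]_A\rangle_j\rangle$; $[\![\omega((\vec{y}_1)t_1,\dots,(\vec{y}_l)t_l)]\!]_A=[\![\omega]\!]_A\circ\langle f_j\rangle_j$ for $\omega:(n_1,\dots,n_l)$, where $f_j$ is the exponential transpose of $\prod_iA^{\mathrm{y}m_i}\times\mathrm{y}n\times\mathrm{y}n_j\cong\prod_iA^{\mathrm{y}m_i}\times\mathrm{y}(n+n_j)\xrightarrow{[\![t_j]\!]_A}A$. $A$ satisfies $\Theta\triangleright\Gamma\vdash s\equiv t$ if $[\![s]\!]_A=[\![t]\!]_A$.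 $\mathbf{Mod}(\mathcal{E})$ is the full subcategory of $\mathbf{Mod}(\Sigma)$ on the models satisfying all axioms in $E$. *)

theory Defs
  imports Main "HOL-Library.FuncSet"
begin

section \<open>Categories, functors, equivalences\<close>

text \<open>
  Hom-sets need not be disjoint, so composition and the action of a functor on morphisms take
  the source and target objects as arguments: \<open>comp C a b c g f\<close> is \<open>g \<circ> f\<close> for
  \<open>f : a \<rightarrow> b\<close> and \<open>g : b \<rightarrow> c\<close>.  Functors and natural transformations are required to be
  \<open>undefined\<close> off their domains, so that HOL equality is the intended equality.
\<close>

record ('x, 'f) cat =
  obj :: "'x set"
  hom :: "'x \<Rightarrow> 'x \<Rightarrow> 'f set"
  ident :: "'x \<Rightarrow> 'f"
  comp :: "'x \<Rightarrow> 'x \<Rightarrow> 'x \<Rightarrow> 'f \<Rightarrow> 'f \<Rightarrow> 'f"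

definition category :: "('x, 'f) cat \<Rightarrow> bool" where
  "category C \<longleftrightarrow>
     (\<forall>a b f. f \<in> hom C a b \<longrightarrow> a \<in> obj C \<and> b \<in> obj C) \<and>
     (\<forall>a\<in>obj C. ident C a \<in> hom C a a) \<and>
     (\<forall>a b c f g. f \<in> hom C a b \<longrightarrow> g \<in> hom C b c \<longrightarrow> comp C a b c g f \<in> hom C a c) \<and>
     (\<forall>a b f. f \<in> hom C a b \<longrightarrow> comp C a a b f (ident C a) = f \<and> comp C a b b (ident C b) f = f) \<and>
     (\<forall>a b c d f g h. f \<in> hom C a b \<longrightarrow> g \<in> hom C b c \<longrightarrow> h \<in> hom C c d \<longrightarrow>
        comp C a c d h (comp C a b c g f) = comp C a b d (comp C b c d h g) f)"

definition full_subcat :: "('x, 'f) cat \<Rightarrow> ('x \<Rightarrow> bool) \<Rightarrow> ('x, 'f) cat" where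
  "full_subcat C P =
     \<lparr>obj = {a \<in> obj C. P a},
      hom = (\<lambda>a b. if P a \<and> P b then hom C a b else {}),
      ident = ident C, comp = comp C\<rparr>"

record ('x, 'f, 'y, 'g) ftr =
  fob :: "'x \<Rightarrow> 'y"
  far :: "'x \<Rightarrow> 'x \<Rightarrow> 'f \<Rightarrow> 'g"

definition is_functor :: "('x, 'f) cat \<Rightarrow> ('y, 'g) cat \<Rightarrow> ('x, 'f, 'y, 'g) ftr \<Rightarrow> bool" where
  "is_functor C D F \<longleftrightarrow>
     fob F \<in> obj C \<rightarrow>\<^sub>E obj D \<and>
     (\<forall>a b. far F a b \<in> hom C a b \<rightarrow>\<^sub>E hom D (fob F a) (fob F b)) \<and>
     (\<forall>a\<in>obj C. far F a a (ident C a) = ident D (fob F a)) \<and>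
     (\<forall>a b c f g. f \<in> hom C a b \<longrightarrow> g \<in> hom C b c \<longrightarrow>
        far F a c (comp C a b c g f) = comp D (fob F a) (fob F b) (fob F c) (far F b c g) (far F a b f))"

definition id_ftr :: "('x, 'f) cat \<Rightarrow> ('x, 'f, 'x, 'f) ftr" where
  "id_ftr C = \<lparr>fob = (\<lambda>a\<in>obj C. a), far = (\<lambda>a b. \<lambda>f\<in>hom C a b. f)\<rparr>"

definition comp_ftr :: "('x, 'f) cat \<Rightarrow> ('y, 'g, 'z, 'h) ftr \<Rightarrow> ('x, 'f, 'y, 'g) ftr \<Rightarrow> ('x, 'f, 'z, 'h) ftr" where
  "comp_ftr C G F =
     \<lparr>fob = (\<lambda>a\<in>obj C. fob G (fob F a)),
      far = (\<lambda>a b. \<lambda>f\<in>hom C a b. far G (fob F a) (fob F b) (far F a b f))\<rparr>"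

definition nat_trans ::
  "('x, 'f) cat \<Rightarrow> ('y, 'g) cat \<Rightarrow> ('x, 'f, 'y, 'g) ftr \<Rightarrow> ('x, 'f, 'y, 'g) ftr \<Rightarrow> ('x \<Rightarrow> 'g) \<Rightarrow> bool" where
  "nat_trans C D F G \<tau> \<longleftrightarrow>
     \<tau> \<in> (\<Pi>\<^sub>E a\<in>obj C. hom D (fob F a) (fob G a)) \<and>
     (\<forall>a b f. f \<in> hom C a b \<longrightarrow>
        comp D (fob F a) (fob F b) (fob G b) (\<tau> b) (far F a b f) =
        comp D (fob F a) (fob G a) (fob G b) (far G a b f) (\<tau> a))"

definition is_iso :: "('x, 'f) cat \<Rightarrow> 'x \<Rightarrow> 'x \<Rightarrow> 'f \<Rightarrow> bool" where
  "is_iso C a b f \<longleftrightarrow> f \<in> hom C a b \<and>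
     (\<exists>g\<in>hom C b a. comp C a b a g f = ident C a \<and> comp C b a b f g = ident C b)"

definition nat_iso ::
  "('x, 'f) cat \<Rightarrow> ('y, 'g) cat \<Rightarrow> ('x, 'f, 'y, 'g) ftr \<Rightarrow> ('x, 'f, 'y, 'g) ftr \<Rightarrow> ('x \<Rightarrow> 'g) \<Rightarrow> bool" where
  "nat_iso C D F G \<tau> \<longleftrightarrow> nat_trans C D F G \<tau> \<and> (\<forall>a\<in>obj C. is_iso D (fob F a) (fob G a) (\<tau> a))"

definition equivalent_categories :: "('x, 'f) cat \<Rightarrow> ('y, 'g) cat \<Rightarrow> bool" where
  "equivalent_categories C D \<longleftrightarrow> category C \<and> category D \<and>
     (\<exists>F G \<eta> \<epsilon>. is_functor C D F \<and> is_functor D C G \<and>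
        nat_iso C C (id_ftr C) (comp_ftr C G F) \<eta> \<and>
        nat_iso D D (comp_ftr D F G) (id_ftr D) \<epsilon>)"

definition fun_cat :: "('x, 'f) cat \<Rightarrow> ('y, 'g) cat \<Rightarrow> (('x, 'f, 'y, 'g) ftr, 'x \<Rightarrow> 'g) cat" where
  "fun_cat C D =
     \<lparr>obj = {F. is_functor C D F},
      hom = (\<lambda>F G. {\<tau>. is_functor C D F \<and> is_functor C D G \<and> nat_trans C D F G \<tau>}),
      ident = (\<lambda>F. \<lambda>a\<in>obj C. ident D (fob F a)),
      comp = (\<lambda>F G H \<tau> \<sigma>. \<lambda>a\<in>obj C. comp D (fob F a) (fob G a) (fob H a) (\<tau> a) (\<sigma> a))\<rparr>"

definition is_product :: "('x, 'f) cat \<Rightarrow> 'x list \<Rightarrow> 'x \<Rightarrow> 'f list \<Rightarrow> bool" where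
  "is_product C as p \<pi>s \<longleftrightarrow>
     set as \<subseteq> obj C \<and> p \<in> obj C \<and> list_all2 (\<lambda>a \<pi>. \<pi> \<in> hom C p a) as \<pi>s \<and>
     (\<forall>z\<in>obj C. \<forall>fs. list_all2 (\<lambda>a f. f \<in> hom C z a) as fs \<longrightarrow>
        (\<exists>!u. u \<in> hom C z p \<and> map2 (\<lambda>a \<pi>. comp C z p a \<pi> u) as \<pi>s = fs))"

definition cartesian_functor :: "('x, 'f) cat \<Rightarrow> ('y, 'g) cat \<Rightarrow> ('x, 'f, 'y, 'g) ftr \<Rightarrow> bool" where
  "cartesian_functor C D F \<longleftrightarrow> is_functor C D F \<and>
     (\<forall>as p \<pi>s. is_product C as p \<pi>s \<longrightarrow>
        is_product D (map (fob F) as) (fob F p) (map2 (\<lambda>a \<pi>. far F p a \<pi>) as \<pi>s))"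

text \<open>
  \<open>Set\<close>, relative to a type \<open>'u\<close> playing the role of the universe.  It has all finite products
  if \<open>'u\<close> is infinite, but not if \<open>'u\<close> is finite with at least two elements.
\<close>

definition SET :: "('u set, 'u \<Rightarrow> 'u) cat" where
  "SET = \<lparr>obj = UNIV, hom = (\<lambda>A B. A \<rightarrow>\<^sub>E B), ident = (\<lambda>A. \<lambda>x\<in>A. x),
          comp = (\<lambda>A B C g f. compose A g f)\<rparr>"

text \<open>The category \<open>\<bbbF>\<close>; the set \<open>{1,\<dots>,n}\<close> is replaced by \<open>{0,\<dots>,n-1}\<close> throughout.\<close>

definition FF :: "(nat, nat \<Rightarrow> nat) cat" where
  "FF = \<lparr>obj = UNIV, hom = (\<lambda>m n. {..<m} \<rightarrow>\<^sub>E {..<n}), ident = (\<lambda>n. \<lambda>i\<in>{..<n}. i),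
         comp = (\<lambda>l m n g f. compose {..<l} g f)\<rparr>"

section \<open>Signatures, terms, equational presentations\<close>

text \<open>
  Well-scoped nameless terms.  In a context with \<open>n\<close> variables these are \<open>Var 0, \<dots>, Var (n-1)\<close>,
  and the context \<open>\<Gamma>,y\<^sub>1,\<dots>,y\<^sub>p\<close> is the number \<open>n + p\<close>, so that a binder of \<open>p\<close> variables
  in a term in context \<open>n\<close> binds \<open>Var n, \<dots>, Var (n+p-1)\<close> (de Bruijn levels).  Hence syntactic
  equality is \<open>\<alpha>\<close>-equivalence, but all operations depend on the length of the context.
  An abstraction \<open>(y\<^sub>1,\<dots>,y\<^sub>p)t\<close> is the pair \<open>(p, t)\<close>.
  A metavariable context is the list of its meta-arities.
\<close>

datatype 'o trm =
    Var nat
  | MVar nat "'o trm list"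
  | Op 'o "(nat \<times> 'o trm) list"

record 'o pres =
  ops :: "'o set"
  arity :: "'o \<Rightarrow> nat list"
  eqns :: "(nat list \<times> nat \<times> 'o trm \<times> 'o trm) set"

text \<open>\<open>wf_trm E \<Theta> n t\<close> stands for \<open>\<Theta> \<triangleright> x\<^sub>1,\<dots>,x\<^sub>n \<turnstile> t\<close>.\<close>

inductive wf_trm :: "'o pres \<Rightarrow> nat list \<Rightarrow> nat \<Rightarrow> 'o trm \<Rightarrow> bool" for E \<Theta> where
  wf_Var: "i < n \<Longrightarrow> wf_trm E \<Theta> n (Var i)"
| wf_MVar: "j < length \<Theta> \<Longrightarrow> length ts = \<Theta> ! j \<Longrightarrow> (\<And>t. t \<in> set ts \<Longrightarrow> wf_trm E \<Theta> n t)
    \<Longrightarrow> wf_trm E \<Theta> n (MVar j ts)"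
| wf_Op: "w \<in> ops E \<Longrightarrow> map fst as = arity E w \<Longrightarrow> (\<And>p t. (p, t) \<in> set as \<Longrightarrow> wf_trm E \<Theta> (n + p) t)
    \<Longrightarrow> wf_trm E \<Theta> n (Op w as)"

definition presentation :: "'o pres \<Rightarrow> bool" where
  "presentation E \<longleftrightarrow> (\<forall>(\<Theta>, n, s, t) \<in> eqns E. wf_trm E \<Theta> n s \<and> wf_trm E \<Theta> n t)"

text \<open>
  For \<open>f : m \<rightarrow> n\<close>, \<open>fplus m n f p\<close> is \<open>f + p : m + p \<rightarrow> n + p\<close>.
\<close>

definition fplus :: "nat \<Rightarrow> nat \<Rightarrow> (nat \<Rightarrow> nat) \<Rightarrow> nat \<Rightarrow> nat \<Rightarrow> nat" where
  "fplus m n f p = (\<lambda>i\<in>{..<m + p}. if i < m then f i else n + (i - m))"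

text \<open>
  \<open>ren m n f t\<close> renames a term \<open>t\<close> in context \<open>m\<close> along \<open>f : m \<rightarrow> n\<close>; \<open>sub n \<sigma> t\<close> substitutes the
  terms \<open>\<sigma>\<close>, in context \<open>n\<close>, for the variables of a term in context \<open>length \<sigma>\<close>.
\<close>

fun ren :: "nat \<Rightarrow> nat \<Rightarrow> (nat \<Rightarrow> nat) \<Rightarrow> 'o trm \<Rightarrow> 'o trm" where
  "ren m n f (Var i) = Var (f i)"
| "ren m n f (MVar j ts) = MVar j (map (ren m n f) ts)"
| "ren m n f (Op w as) = Op w (map (\<lambda>(p, t). (p, ren (m + p) (n + p) (fplus m n f p) t)) as)"

fun sub :: "nat \<Rightarrow> 'o trm list \<Rightarrow> 'o trm \<Rightarrow> 'o trm" where
  "sub n \<sigma> (Var i) = \<sigma> ! i"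
| "sub n \<sigma> (MVar j ts) = MVar j (map (sub n \<sigma>) ts)"
| "sub n \<sigma> (Op w as) =
     Op w (map (\<lambda>(p, t). (p, sub (n + p) (map (ren n (n + p) id) \<sigma> @ map Var [n..<n + p]) t)) as)"

text \<open>
  Metasubstitution \<open>t{\<m>\<^sub>j := (y\<^sub>1,\<dots>,y\<^bsub>m\<^sub>j\<^esub>)t\<^sub>j}\<close> in a fixed variable context \<open>n\<close>: \<open>t\<close> is in
  context \<open>n\<close>, and \<open>\<theta> ! j = (m\<^sub>j, t\<^sub>j)\<close> with \<open>t\<^sub>j\<close> in context \<open>n + m\<^sub>j\<close>.  Under a binder of \<open>p\<close>
  variables the \<open>t\<^sub>j\<close> are weakened from \<open>n + m\<^sub>j\<close> to \<open>n + p + m\<^sub>j\<close>.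
\<close>

fun msub :: "nat \<Rightarrow> (nat \<times> 'o trm) list \<Rightarrow> 'o trm \<Rightarrow> 'o trm" where
  "msub n \<theta> (Var i) = Var i"
| "msub n \<theta> (MVar j ts) = sub n (map Var [0..<n] @ map (msub n \<theta>) ts) (snd (\<theta> ! j))"
| "msub n \<theta> (Op w as) =
     Op w (map (\<lambda>(p, t). (p, msub (n + p)
       (map (\<lambda>(m, s). (m, ren (n + m) (n + p + m) (\<lambda>i. if i < n then i else i + p) s)) \<theta>) t)) as)"

text \<open>
  Metasubstitution of \<open>\<Delta>,y\<^sub>1,\<dots>,y\<^bsub>m\<^sub>j\<^esub> \<turnstile> s\<^sub>j\<close> in \<open>\<Gamma> \<turnstile> t\<close>, where \<open>\<Gamma>\<close> and \<open>\<Delta>\<close> have lengths \<open>n\<close>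
  and \<open>d\<close>: everything is first weakened to \<open>\<Gamma>,\<Delta>\<close>.
\<close>

definition emsub :: "nat \<Rightarrow> nat \<Rightarrow> (nat \<times> 'o trm) list \<Rightarrow> 'o trm \<Rightarrow> 'o trm" where
  "emsub n d \<theta> t =
     msub (n + d) (map (\<lambda>(m, s). (m, ren (d + m) (n + d + m) (\<lambda>i. n + i) s)) \<theta>) (ren n (n + d) id t)"

inductive derivable :: "'o pres \<Rightarrow> nat list \<Rightarrow> nat \<Rightarrow> 'o trm \<Rightarrow> 'o trm \<Rightarrow> bool" for E where
  d_eqn: "(\<Theta>, n, s, t) \<in> eqns E \<Longrightarrow> derivable E \<Theta> n s t"
| d_refl: "wf_trm E \<Theta> n t \<Longrightarrow> derivable E \<Theta> n t t"
| d_sym: "derivable E \<Theta> n s t \<Longrightarrow> derivable E \<Theta> n t s"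
| d_trans: "derivable E \<Theta> n s t \<Longrightarrow> derivable E \<Theta> n t u \<Longrightarrow> derivable E \<Theta> n s u"
| d_msub: "derivable E ms n s t \<Longrightarrow> length ss = length ms \<Longrightarrow> length ts = length ms
    \<Longrightarrow> (\<And>i. i < length ms \<Longrightarrow> derivable E \<Theta> (d + ms ! i) (ss ! i) (ts ! i))
    \<Longrightarrow> derivable E \<Theta> (n + d) (emsub n d (zip ms ss) s) (emsub n d (zip ms ts) t)"

section \<open>The algebraic theory of a presentation and its functorial models\<close>

definition trms :: "'o pres \<Rightarrow> nat list \<Rightarrow> nat \<Rightarrow> 'o trm set" where
  "trms E \<Theta> n = {t. wf_trm E \<Theta> n t}"

definition deq :: "'o pres \<Rightarrow> nat list \<Rightarrow> nat \<Rightarrow> ('o trm \<times> 'o trm) set" where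
  "deq E \<Theta> n = {(s, t). derivable E \<Theta> n s t}"

definition tcls :: "'o pres \<Rightarrow> nat list \<Rightarrow> nat \<Rightarrow> 'o trm \<Rightarrow> 'o trm set" where
  "tcls E \<Theta> n t = deq E \<Theta> n `` {t}"

definition rep :: "'o trm set \<Rightarrow> 'o trm" where
  "rep c = (SOME t. t \<in> c)"

definition MM :: "'o pres \<Rightarrow> (nat list, 'o trm set list) cat" where
  "MM E =
     \<lparr>obj = UNIV,
      hom = (\<lambda>ms ns. {cs. list_all2 (\<lambda>n c. c \<in> trms E ms n // deq E ms n) ns cs}),
      ident = (\<lambda>ms. map (\<lambda>i. tcls E ms (ms ! i) (MVar i (map Var [0..<ms ! i]))) [0..<length ms]),
      comp = (\<lambda>ls ms ns ts ss.
        map2 (\<lambda>n t. tcls E ls n (emsub n 0 (zip ms (map rep ss)) (rep t))) ns ts)\<rparr>"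

definition empty_pres :: "'o pres" where
  "empty_pres = \<lparr>ops = {}, arity = (\<lambda>_. []), eqns = {}\<rparr>"

text \<open>The theory \<open>M\<^sub>E : \<bbbM> \<rightarrow> \<bbbM>(E)\<close>, together with its target category.\<close>

record 'o theory2 =
  th_cat :: "(nat list, 'o trm set list) cat"
  th_ftr :: "(nat list, 'o trm set list, nat list, 'o trm set list) ftr"

definition theory_of :: "'o pres \<Rightarrow> 'o theory2" where
  "theory_of E =
     \<lparr>th_cat = MM E,
      th_ftr = \<lparr>fob = (\<lambda>ms. ms),
        far = (\<lambda>ms ns. \<lambda>cs\<in>hom (MM empty_pres) ms ns. map2 (\<lambda>n c. deq E ms n `` c) ns cs)\<rparr>\<rparr>"

definition functorial_models ::
  "'o theory2 \<Rightarrow> ((nat list, 'o trm set list, 'u set, 'u \<Rightarrow> 'u) ftr, nat list \<Rightarrow> 'u \<Rightarrow> 'u) cat" where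
  "functorial_models M = full_subcat (fun_cat (th_cat M) SET) (cartesian_functor (th_cat M) SET)"

section \<open>Presheaves and the substitution tensor\<close>

text \<open>
  Objects of \<open>Set\<^bsup>\<bbbF>\<^esup>\<close>.  Auxiliary presheaves such as \<open>X \<bullet> Y\<close> have elements of other types than
  those of \<open>X\<close> and \<open>Y\<close>, whence a notion of morphism between presheaves over different types.
\<close>

type_synonym 'a psh = "(nat, nat \<Rightarrow> nat, 'a set, 'a \<Rightarrow> 'a) ftr"

definition psh_hom :: "'a psh \<Rightarrow> 'b psh \<Rightarrow> (nat \<Rightarrow> 'a \<Rightarrow> 'b) \<Rightarrow> bool" where
  "psh_hom X Y \<phi> \<longleftrightarrow>
     (\<forall>k. \<phi> k \<in> fob X k \<rightarrow>\<^sub>E fob Y k) \<and>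
     (\<forall>k l f. f \<in> hom FF k l \<longrightarrow> (\<forall>x\<in>fob X k. \<phi> l (far X k l f x) = far Y k l f (\<phi> k x)))"

definition mk_psh :: "(nat \<Rightarrow> 'a set) \<Rightarrow> (nat \<Rightarrow> nat \<Rightarrow> (nat \<Rightarrow> nat) \<Rightarrow> 'a \<Rightarrow> 'a) \<Rightarrow> 'a psh" where
  "mk_psh S a = \<lparr>fob = S, far = (\<lambda>k l. \<lambda>f\<in>hom FF k l. \<lambda>x\<in>S k. a k l f x)\<rparr>"

definition yon :: "nat \<Rightarrow> (nat \<Rightarrow> nat) psh" where
  "yon n = mk_psh (hom FF n) (\<lambda>k l f \<rho>. comp FF n k l f \<rho>)"

definition pprod :: "'a psh \<Rightarrow> 'b psh \<Rightarrow> ('a \<times> 'b) psh" where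
  "pprod X Y = mk_psh (\<lambda>k. fob X k \<times> fob Y k) (\<lambda>k l f (x, y). (far X k l f x, far Y k l f y))"

text \<open>The exponential \<open>X\<^bsup>yp\<^esup>\<close>, in the form \<open>X\<^bsup>yp\<^esup>(k) = X(k + p)\<close>, and \<open>\<Prod>\<^sub>i X\<^bsup>yn\<^sub>i\<^esup>\<close>.\<close>

definition pexp :: "'a psh \<Rightarrow> nat \<Rightarrow> 'a psh" where
  "pexp X p = mk_psh (\<lambda>k. fob X (k + p)) (\<lambda>k l f. far X (k + p) (l + p) (fplus k l f p))"

definition prodexp :: "'a psh \<Rightarrow> nat list \<Rightarrow> 'a list psh" where
  "prodexp X ns = mk_psh (\<lambda>k. {as. list_all2 (\<lambda>p a. a \<in> fob (pexp X p) k) ns as})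
     (\<lambda>k l f as. map2 (\<lambda>p. far (pexp X p) k l f) ns as)"

definition incl :: "nat \<Rightarrow> nat \<Rightarrow> nat \<Rightarrow> nat" where
  "incl k p = (\<lambda>i\<in>{..<k}. i)"

definition incr :: "nat \<Rightarrow> nat \<Rightarrow> nat \<Rightarrow> nat" where
  "incr k p = (\<lambda>j\<in>{..<p}. k + j)"

text \<open>The transpose \<open>P \<rightarrow> X\<^bsup>yp\<^esup>\<close> of \<open>g : P \<times> yp \<rightarrow> X\<close> under the above description of \<open>X\<^bsup>yp\<^esup>\<close>.\<close>

definition transpose_psh ::
  "'a psh \<Rightarrow> nat \<Rightarrow> (nat \<Rightarrow> 'a \<times> (nat \<Rightarrow> nat) \<Rightarrow> 'b) \<Rightarrow> nat \<Rightarrow> 'a \<Rightarrow> 'b" where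
  "transpose_psh P p g k z = g (k + p) (far P k (k + p) (incl k p) z, incr k p)"

text \<open>
  The coend \<open>(X \<bullet> Y)(n) = \<integral>\<^bsup>k\<^esup> X(k) \<times> Y(n)\<^sup>k\<close>: the quotient of the set of triples
  \<open>(k, a, b)\<close> with \<open>a \<in> X(k)\<close> and \<open>b\<close> a \<open>k\<close>-tuple over \<open>Y(n)\<close> by the equivalence relation
  generated by \<open>(l, X(f)(a), b) \<sim> (k, a, b \<circ> f)\<close> for \<open>f : k \<rightarrow> l\<close>.
\<close>

definition tens_raw :: "'a psh \<Rightarrow> 'b psh \<Rightarrow> nat \<Rightarrow> (nat \<times> 'a \<times> 'b list) set" where
  "tens_raw X Y n = {(k, a, b). a \<in> fob X k \<and> length b = k \<and> set b \<subseteq> fob Y n}"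

inductive_set tens_rel :: "'a psh \<Rightarrow> 'b psh \<Rightarrow> nat \<Rightarrow> ((nat \<times> 'a \<times> 'b list) \<times> (nat \<times> 'a \<times> 'b list)) set"
  for X Y n where
  tr_step: "f \<in> hom FF k l \<Longrightarrow> a \<in> fob X k \<Longrightarrow> length b = l \<Longrightarrow> set b \<subseteq> fob Y n
    \<Longrightarrow> ((l, far X k l f a, b), (k, a, map (\<lambda>i. b ! f i) [0..<k])) \<in> tens_rel X Y n"
| tr_refl: "u \<in> tens_raw X Y n \<Longrightarrow> (u, u) \<in> tens_rel X Y n"
| tr_sym: "(u, v) \<in> tens_rel X Y n \<Longrightarrow> (v, u) \<in> tens_rel X Y n"
| tr_trans: "(u, v) \<in> tens_rel X Y n \<Longrightarrow> (v, w) \<in> tens_rel X Y n \<Longrightarrow> (u, w) \<in> tens_rel X Y n"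

type_synonym ('a, 'b) tens = "(nat \<times> 'a \<times> 'b list) set"

definition tcl :: "'a psh \<Rightarrow> 'b psh \<Rightarrow> nat \<Rightarrow> nat \<times> 'a \<times> 'b list \<Rightarrow> ('a, 'b) tens" where
  "tcl X Y n u = tens_rel X Y n `` {u}"

text \<open>
  \<open>lift \<phi>\<close> is the map on equivalence classes induced by a map \<open>\<phi>\<close> on representatives that is
  constant on classes (and a junk value otherwise).
\<close>

definition lift :: "(nat \<Rightarrow> 'a \<Rightarrow> 'b list \<Rightarrow> 'c) \<Rightarrow> ('a, 'b) tens \<Rightarrow> 'c" where
  "lift \<phi> c = the_elem ((\<lambda>(k, a, b). \<phi> k a b) ` c)"

definition tens :: "'a psh \<Rightarrow> 'b psh \<Rightarrow> ('a, 'b) tens psh" where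
  "tens X Y = mk_psh (\<lambda>n. tens_raw X Y n // tens_rel X Y n)
     (\<lambda>m n f. lift (\<lambda>k a b. tcl X Y n (k, a, map (far Y m n f) b)))"

text \<open>\<open>\<phi> \<bullet> \<psi> : X \<bullet> Y \<rightarrow> X' \<bullet> Y'\<close>; the arguments \<open>X'\<close> and \<open>Y'\<close> are the codomains.\<close>

definition tens_map ::
  "'c psh \<Rightarrow> 'd psh \<Rightarrow> (nat \<Rightarrow> 'a \<Rightarrow> 'c) \<Rightarrow> (nat \<Rightarrow> 'b \<Rightarrow> 'd) \<Rightarrow> nat \<Rightarrow> ('a, 'b) tens \<Rightarrow> ('c, 'd) tens" where
  "tens_map X' Y' \<phi> \<psi> n = lift (\<lambda>k a b. tcl X' Y' n (k, \<phi> k a, map (\<psi> n) b))"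

text \<open>
  The unitors \<open>y1 \<bullet> Y \<cong> Y\<close>, \<open>X \<bullet> y1 \<cong> X\<close> and the associator
  \<open>(X \<bullet> Y) \<bullet> Z \<cong> X \<bullet> (Y \<bullet> Z)\<close>.
\<close>

definition lunit :: "nat \<Rightarrow> (nat \<Rightarrow> nat, 'b) tens \<Rightarrow> 'b" where
  "lunit n = lift (\<lambda>k i b. b ! i 0)"

definition runit :: "'a psh \<Rightarrow> nat \<Rightarrow> ('a, nat \<Rightarrow> nat) tens \<Rightarrow> 'a" where
  "runit X n = lift (\<lambda>k a b. far X k n (\<lambda>i\<in>{..<k}. (b ! i) 0) a)"

definition assoc ::
  "'a psh \<Rightarrow> 'b psh \<Rightarrow> 'c psh \<Rightarrow> nat \<Rightarrow> (('a, 'b) tens, 'c) tens \<Rightarrow> ('a, ('b, 'c) tens) tens" where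
  "assoc X Y Z n = lift (\<lambda>l u c.
     lift (\<lambda>k a b. tcl X (tens Y Z) n (k, a, map (\<lambda>b'. tcl Y Z n (l, b', c)) b)) u)"

section \<open>Models\<close>

definition sigF :: "'o pres \<Rightarrow> 'a psh \<Rightarrow> ('o \<times> 'a list) psh" where
  "sigF E X = mk_psh (\<lambda>k. SIGMA w:ops E. fob (prodexp X (arity E w)) k)
     (\<lambda>k l f (w, as). (w, far (prodexp X (arity E w)) k l f as))"

definition sigF_map :: "'o pres \<Rightarrow> (nat \<Rightarrow> 'a \<Rightarrow> 'b) \<Rightarrow> nat \<Rightarrow> 'o \<times> 'a list \<Rightarrow> 'o \<times> 'b list" where
  "sigF_map E \<phi> k = (\<lambda>(w, as). (w, map2 (\<lambda>p. \<phi> (k + p)) (arity E w) as))"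

text \<open>The element of \<open>y1(k) = \<bbbF>(1,k)\<close> given by \<open>i < k\<close>.\<close>

definition pt :: "nat \<Rightarrow> nat \<Rightarrow> nat" where
  "pt i = (\<lambda>_\<in>{..<1}. i)"

text \<open>\<open>X\<^bsup>yp\<^esup> \<bullet> Y \<rightarrow> (X \<bullet> Y)\<^bsup>yp\<^esup>\<close>, and the pointed strength \<open>\<F>\<^sub>\<Sigma>(X) \<bullet> Y \<rightarrow> \<F>\<^sub>\<Sigma>(X \<bullet> Y)\<close>.\<close>

definition exp_str ::
  "'a psh \<Rightarrow> 'b psh \<Rightarrow> (nat \<Rightarrow> (nat \<Rightarrow> nat) \<Rightarrow> 'b) \<Rightarrow> nat \<Rightarrow> nat \<Rightarrow> ('a, 'b) tens \<Rightarrow> ('a, 'b) tens" where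
  "exp_str X Y \<eta> p m = lift (\<lambda>k a b. tcl X Y (m + p)
     (k + p, a, map (far Y m (m + p) (incl m p)) b @ map (\<lambda>j. \<eta> (m + p) (pt (m + j))) [0..<p]))"

definition strength ::
  "'o pres \<Rightarrow> 'a psh \<Rightarrow> 'b psh \<Rightarrow> (nat \<Rightarrow> (nat \<Rightarrow> nat) \<Rightarrow> 'b) \<Rightarrow> nat \<Rightarrow>
   ('o \<times> 'a list, 'b) tens \<Rightarrow> 'o \<times> ('a, 'b) tens list" where
  "strength E X Y \<eta> m = lift (\<lambda>k (w, as) b.
     (w, map2 (\<lambda>p a. exp_str X Y \<eta> p m (tcl (pexp X p) Y m (k, a, b))) (arity E w) as))"

record ('o, 'u) smodel =
  car :: "'u psh"
  alg :: "nat \<Rightarrow> 'o \<times> 'u list \<Rightarrow> 'u"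
  unit :: "nat \<Rightarrow> (nat \<Rightarrow> nat) \<Rightarrow> 'u"
  mult :: "nat \<Rightarrow> ('u, 'u) tens \<Rightarrow> 'u"

definition monoid :: "'u psh \<Rightarrow> (nat \<Rightarrow> (nat \<Rightarrow> nat) \<Rightarrow> 'u) \<Rightarrow> (nat \<Rightarrow> ('u, 'u) tens \<Rightarrow> 'u) \<Rightarrow> bool" where
  "monoid A \<nu> \<mu> \<longleftrightarrow>
     psh_hom (yon 1) A \<nu> \<and> psh_hom (tens A A) A \<mu> \<and>
     (\<forall>n. \<forall>c\<in>fob (tens (yon 1) A) n. \<mu> n (tens_map A A \<nu> (\<lambda>_ x. x) n c) = lunit n c) \<and>
     (\<forall>n. \<forall>c\<in>fob (tens A (yon 1)) n. \<mu> n (tens_map A A (\<lambda>_ x. x) \<nu> n c) = runit A n c) \<and>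
     (\<forall>n. \<forall>c\<in>fob (tens (tens A A) A) n.
        \<mu> n (tens_map A A \<mu> (\<lambda>_ x. x) n c) =
        \<mu> n (tens_map A A (\<lambda>_ x. x) \<mu> n (assoc A A A n c)))"

definition sig_model :: "'o pres \<Rightarrow> ('o, 'u) smodel \<Rightarrow> bool" where
  "sig_model E A \<longleftrightarrow>
     is_functor FF SET (car A) \<and>
     psh_hom (sigF E (car A)) (car A) (alg A) \<and>
     monoid (car A) (unit A) (mult A) \<and>
     (\<forall>n. \<forall>c\<in>fob (tens (sigF E (car A)) (car A)) n.
        mult A n (tens_map (car A) (car A) (alg A) (\<lambda>_ x. x) n c) =
        alg A n (sigF_map E (mult A) n (strength E (car A) (car A) (unit A) n c)))"

definition model_hom :: "'o pres \<Rightarrow> ('o, 'u) smodel \<Rightarrow> ('o, 'u) smodel \<Rightarrow> (nat \<Rightarrow> 'u \<Rightarrow> 'u) \<Rightarrow> bool" where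
  "model_hom E A B h \<longleftrightarrow>
     psh_hom (car A) (car B) h \<and>
     (\<forall>n. \<forall>u\<in>fob (sigF E (car A)) n. h n (alg A n u) = alg B n (sigF_map E h n u)) \<and>
     (\<forall>n. \<forall>i\<in>fob (yon 1) n. h n (unit A n i) = unit B n i) \<and>
     (\<forall>n. \<forall>c\<in>fob (tens (car A) (car A)) n.
        h n (mult A n c) = mult B n (tens_map (car B) (car B) h h n c))"

definition sig_models :: "'o pres \<Rightarrow> (('o, 'u) smodel, nat \<Rightarrow> 'u \<Rightarrow> 'u) cat" where
  "sig_models E =
     \<lparr>obj = {A. sig_model E A},
      hom = (\<lambda>A B. {h. sig_model E A \<and> sig_model E B \<and> model_hom E A B h}),
      ident = (\<lambda>A n. \<lambda>x\<in>fob (car A) n. x),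
      comp = (\<lambda>A B C h g n. compose (fob (car A) n) (h n) (g n))\<rparr>"

text \<open>\<open>\<nu>\<^sub>n : yn \<cong> (y1)\<^sup>n \<rightarrow> A\<^sup>n\<close> and \<open>\<mu>\<^sub>n : A\<^bsup>yn\<^esup> \<times> A\<^sup>n \<rightarrow> A\<close>.\<close>

definition unit_n :: "('o, 'u) smodel \<Rightarrow> nat \<Rightarrow> nat \<Rightarrow> (nat \<Rightarrow> nat) \<Rightarrow> 'u list" where
  "unit_n A n k \<rho> = map (\<lambda>i. unit A k (pt (\<rho> i))) [0..<n]"

definition mult_n :: "('o, 'u) smodel \<Rightarrow> nat \<Rightarrow> nat \<Rightarrow> 'u \<times> 'u list \<Rightarrow> 'u" where
  "mult_n A n k = (\<lambda>(a, b). mult A k (tcl (car A) (car A) k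
     (k + n, a, map (\<lambda>i. unit A k (pt i)) [0..<k] @ b)))"

text \<open>The domain \<open>\<Prod>\<^sub>i A\<^bsup>ym\<^sub>i\<^esup> \<times> yn\<close> of the interpretation, and the isomorphism
  \<open>yn \<times> yp \<cong> y(n + p)\<close>.\<close>

definition ctx :: "('o, 'u) smodel \<Rightarrow> nat list \<Rightarrow> nat \<Rightarrow> ('u list \<times> (nat \<Rightarrow> nat)) psh" where
  "ctx A \<Theta> n = pprod (prodexp (car A) \<Theta>) (yon n)"

definition copair :: "nat \<Rightarrow> nat \<Rightarrow> (nat \<Rightarrow> nat) \<Rightarrow> (nat \<Rightarrow> nat) \<Rightarrow> nat \<Rightarrow> nat" where
  "copair n p \<rho> \<sigma> = (\<lambda>i\<in>{..<n + p}. if i < n then \<rho> i else \<sigma> (i - n))"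

fun interp ::
  "('o, 'u) smodel \<Rightarrow> nat list \<Rightarrow> nat \<Rightarrow> 'o trm \<Rightarrow> nat \<Rightarrow> 'u list \<times> (nat \<Rightarrow> nat) \<Rightarrow> 'u" where
  "interp A \<Theta> n (Var i) = (\<lambda>k z. unit_n A n k (snd z) ! i)"
| "interp A \<Theta> n (MVar j ts) =
     (\<lambda>k z. mult_n A (\<Theta> ! j) k (fst z ! j, map (\<lambda>t. interp A \<Theta> n t k z) ts))"
| "interp A \<Theta> n (Op w as) =
     (\<lambda>k z. alg A k (w, map (\<lambda>(p, t). transpose_psh (ctx A \<Theta> n) p
        (\<lambda>l ((\<theta>, \<rho>), \<sigma>). interp A \<Theta> (n + p) t l (\<theta>, copair n p \<rho> \<sigma>)) k z) as))"

definition satisfies :: "('o, 'u) smodel \<Rightarrow> nat list \<times> nat \<times> 'o trm \<times> 'o trm \<Rightarrow> bool" where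
  "satisfies A = (\<lambda>(\<Theta>, n, s, t).
     \<forall>k. \<forall>z\<in>fob (ctx A \<Theta> n) k. interp A \<Theta> n s k z = interp A \<Theta> n t k z)"

definition models :: "'o pres \<Rightarrow> (('o, 'u) smodel, nat \<Rightarrow> 'u \<Rightarrow> 'u) cat" where
  "models E = full_subcat (sig_models E) (\<lambda>A. \<forall>e\<in>eqns E. satisfies A e)"

end

theory Submission
  imports Defs
begin

text \<open>
  Both kinds of models are descriptions of one kind of structure: sets \<open>S n\<close> of elements in
  context \<open>n\<close>, with variables, simultaneous substitution, and operators compatible with substitution.
  Such a structure is called an abstract clone below (\<open>op_clone\<close>).  It involves no coends and no
  presheaves: renamings are substitutions of variables.

  A \<open>\<Sigma>\<close>-model is an abstract clone.  The multiplication \<open>A \<bullet> A \<rightarrow> A\<close> is a function on representatives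
  that respects the coend relation, and the monoid laws and the compatibility with the strength become
  the clone laws (\<open>sigma_model.op_clone\<close>, \<open>sig_model_clone_model\<close>, \<open>model_hom_iff\<close>).  In a clone, terms are
  evaluated in arbitrary environments, of which the interpretation of terms in a model is a special case
  (\<open>interp_eq_ev\<close>).  Evaluation commutes with substitution and metasubstitution (\<open>s_ev\<close>, \<open>ev_sub\<close>,
  \<open>ev_msub\<close>); this gives soundness of second-order equational logic.

  An \<open>E\<close>-model \<open>A\<close> therefore yields a functor on the classifying category, which sends \<open>(m\<^sub>1,\<dots>,m\<^sub>k)\<close> to
  \<open>\<Prod>\<^sub>i A(m\<^sub>i)\<close> and a tuple of terms to the tuple of operations that it defines.  It is cartesian because
  concatenation is the product on both sides.  This construction is the comparison functor \<open>Phi\<close>.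
  It is faithful because \<open>A(n)\<close> is the value at \<open>(n)\<close>.  It is full because a natural transformation is
  determined by its components at the objects \<open>(n)\<close>, by naturality with respect to projections, and because
  variables, substitution and operators are themselves expressed by terms (\<open>clone_homI\<close>, \<open>Phi_ar_surj\<close>).

  It is essentially surjective: let \<open>F\<close> be a cartesian functor.  The sets \<open>F(n)\<close> carry the operations given by the terms
  that express the structure of a clone.  Since \<open>F\<close> preserves products, finitely many elements are always
  values of terms at one common element of some \<open>F \<Theta>\<close>, and on such values the operations are the
  syntactic ones (\<open>F_sub_el\<close>, \<open>F_op_el\<close>).  So the clone laws follow from the laws of substitution for
  terms, evaluation of terms is metasubstitution (\<open>ev_eq_el_msub\<close>), and the axioms hold since derivably
  equal terms are equal morphisms (\<open>F_valid\<close>).  The functor obtained from this model is isomorphic to \<open>F\<close>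
  by the bijections \<open>F(m\<^sub>1,\<dots>,m\<^sub>k) \<cong> \<Prod>\<^sub>i F(m\<^sub>i)\<close>.

  The universe is infinite, so tuples of its elements can be coded by elements (\<open>exists_tuple_coding\<close>),
  and the products \<open>\<Prod>\<^sub>i A(m\<^sub>i)\<close> exist in \<open>SET\<close>.
\<close>

section \<open>Renaming and substitution\<close>

text \<open>
  With de Bruijn levels the variables of a context keep their numbers under a binder, but the bound
  variables are numbered by the length of the context.  Every law therefore holds only for well-scoped terms, and the proofs
  are by rule induction on \<open>wf_trm\<close>, generalised over the target context: the case of
  a binder of \<open>p\<close> variables is the induction hypothesis in context \<open>m + p\<close>, for the
  lifted renaming \<open>fplus\<close> or the lifted substitution \<open>lift_sub\<close>.
\<close>

lemma map_fst_snd_cong: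
  assumes "\<And>p t. (p, t) \<in> set as \<Longrightarrow> f p t = g p t"
  shows "map (\<lambda>(p, t). (p, f p t)) as = map (\<lambda>(p, t). (p, g p t)) as"
  using assms by auto

lemma wf_Op_map:
  assumes "w \<in> ops E" "map fst as = arity E w"
    "\<And>p t. (p, t) \<in> set as \<Longrightarrow> wf_trm E \<Theta> (n + p) (f p t)"
  shows "wf_trm E \<Theta> n (Op w (map (\<lambda>(p, t). (p, f p t)) as))"
proof (rule wf_Op)
  show "map fst (map (\<lambda>(p, t). (p, f p t)) as) = arity E w"
    unfolding assms(2)[symmetric] by auto
qed (use assms in auto)

lemma ren_cong:
  assumes "wf_trm E \<Theta> m t" "\<And>i. i < m \<Longrightarrow> f i = g i"
  shows "ren m n f t = ren m n g t"
  using assms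
proof (induction arbitrary: n f g rule: wf_trm.induct)
  case (wf_Op w as m)
  show ?case unfolding ren.simps trm.inject
    by (intro conjI refl map_fst_snd_cong wf_Op.IH)
       (auto simp: fplus_def wf_Op.prems)
next
  case (wf_MVar j ts m)
  show ?case unfolding ren.simps trm.inject
    by (intro conjI refl map_cong wf_MVar.IH wf_MVar.prems)
qed simp

lemma wf_ren:
  assumes "wf_trm E \<Theta> m t" "\<And>i. i < m \<Longrightarrow> f i < n"
  shows "wf_trm E \<Theta> n (ren m n f t)"
  using assms
proof (induction arbitrary: n f rule: wf_trm.induct)
  case (wf_Op w as m)
  have "wf_trm E \<Theta> (n + p) (ren (m + p) (n + p) (fplus m n f p) t)" if "(p, t) \<in> set as" for p t
    by (rule wf_Op.IH[OF that]) (auto simp: fplus_def wf_Op.prems intro: trans_less_add1)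
  then show ?case using wf_Op.hyps by (simp add: wf_Op_map)
next
  case (wf_MVar j ts m)
  show ?case unfolding ren.simps by (rule wf_trm.wf_MVar) (use wf_MVar in auto)
qed (auto intro: wf_trm.intros)

lemma ren_ren:
  assumes "wf_trm E \<Theta> m t" "\<And>i. i < m \<Longrightarrow> f i < n"
  shows "ren n k g (ren m n f t) = ren m k (\<lambda>i. g (f i)) t"
  using assms
proof (induction arbitrary: n f k g rule: wf_trm.induct)
  case (wf_Op w as m)
  have "ren (n + p) (k + p) (fplus n k g p) (ren (m + p) (n + p) (fplus m n f p) t) =
      ren (m + p) (k + p) (fplus m k (\<lambda>i. g (f i)) p) t" if pt: "(p, t) \<in> set as" for p t
  proof -
    have "ren (n + p) (k + p) (fplus n k g p) (ren (m + p) (n + p) (fplus m n f p) t) =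
       ren (m + p) (k + p) (\<lambda>i. fplus n k g p (fplus m n f p i)) t"
      by (rule wf_Op.IH[OF pt]) (auto simp: fplus_def wf_Op.prems intro: trans_less_add1)
    also have "\<dots> = ren (m + p) (k + p) (fplus m k (\<lambda>i. g (f i)) p) t"
      by (rule ren_cong[OF wf_Op.hyps(3)[OF pt]])
         (auto simp: fplus_def wf_Op.prems trans_less_add1)
    finally show ?thesis .
  qed
  then show ?case by auto
qed auto

definition lift_sub :: "nat \<Rightarrow> nat \<Rightarrow> 'o trm list \<Rightarrow> 'o trm list" where
  "lift_sub n p \<sigma> = map (ren n (n + p) id) \<sigma> @ map Var [n..<n + p]"

lemma length_lift_sub [simp]: "length (lift_sub n p \<sigma>) = length \<sigma> + p"
  by (simp add: lift_sub_def)

lemma nth_lift_sub: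
  "i < length \<sigma> + p \<Longrightarrow>
    lift_sub n p \<sigma> ! i = (if i < length \<sigma> then ren n (n + p) id (\<sigma> ! i) else Var (n + (i - length \<sigma>)))"
  by (auto simp: lift_sub_def nth_append)

lemma sub_Op: "sub n \<sigma> (Op w as) = Op w (map (\<lambda>(p, t). (p, sub (n + p) (lift_sub n p \<sigma>) t)) as)"
  by (simp add: lift_sub_def)

lemma sub_ren:
  assumes "wf_trm E \<Theta> m t" "\<And>i. i < m \<Longrightarrow> f i < n" "length \<sigma> = n"
  shows "sub k \<sigma> (ren m n f t) = sub k (map (\<lambda>i. \<sigma> ! f i) [0..<m]) t"
  using assms
proof (induction arbitrary: n f k \<sigma> rule: wf_trm.induct)
  case (wf_Op w as m)
  have "sub (k + p) (lift_sub k p \<sigma>) (ren (m + p) (n + p) (fplus m n f p) t) =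
      sub (k + p) (lift_sub k p (map (\<lambda>i. \<sigma> ! f i) [0..<m])) t" if pt: "(p, t) \<in> set as" for p t
  proof -
    have "sub (k + p) (lift_sub k p \<sigma>) (ren (m + p) (n + p) (fplus m n f p) t) =
       sub (k + p) (map (\<lambda>i. lift_sub k p \<sigma> ! fplus m n f p i) [0..<m + p]) t"
      by (rule wf_Op.IH[OF pt]) (auto simp: fplus_def wf_Op.prems intro: trans_less_add1)
    also have "map (\<lambda>i. lift_sub k p \<sigma> ! fplus m n f p i) [0..<m + p] =
        lift_sub k p (map (\<lambda>i. \<sigma> ! f i) [0..<m])"
      by (rule nth_equalityI) (auto simp: fplus_def nth_lift_sub wf_Op.prems trans_less_add1)
    finally show ?thesis .
  qed
  then show ?case unfolding ren.simps sub_Op by auto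
qed auto

lemma wf_lift_sub:
  assumes "\<And>s. s \<in> set \<sigma> \<Longrightarrow> wf_trm E \<Theta> n s" "s \<in> set (lift_sub n p \<sigma>)"
  shows "wf_trm E \<Theta> (n + p) s"
  using assms by (auto simp: lift_sub_def intro!: wf_ren wf_trm.intros)

lemma wf_sub:
  assumes "wf_trm E \<Theta> m t" "length \<sigma> = m" "\<And>s. s \<in> set \<sigma> \<Longrightarrow> wf_trm E \<Theta> n s"
  shows "wf_trm E \<Theta> n (sub n \<sigma> t)"
  using assms
proof (induction arbitrary: n \<sigma> rule: wf_trm.induct)
  case (wf_Op w as m)
  have "wf_trm E \<Theta> (n + p) (sub (n + p) (lift_sub n p \<sigma>) t)" if "(p, t) \<in> set as" for p t
    by (rule wf_Op.IH[OF that]) (auto simp: wf_Op.prems intro: wf_lift_sub[of \<sigma>])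
  then show ?case unfolding sub_Op using wf_Op.hyps by (simp add: wf_Op_map)
next
  case (wf_MVar j ts m)
  show ?case unfolding sub.simps by (rule wf_trm.wf_MVar) (use wf_MVar in auto)
qed auto

lemma ren_sub:
  assumes "wf_trm E \<Theta> m t" "length \<sigma> = m" "\<And>s. s \<in> set \<sigma> \<Longrightarrow> wf_trm E \<Theta> n s" "\<And>i. i < n \<Longrightarrow> g i < k"
  shows "ren n k g (sub n \<sigma> t) = sub k (map (ren n k g) \<sigma>) t"
  using assms
proof (induction arbitrary: n \<sigma> k g rule: wf_trm.induct)
  case (wf_Op w as m)
  have "ren (n + p) (k + p) (fplus n k g p) (sub (n + p) (lift_sub n p \<sigma>) t) =
      sub (k + p) (lift_sub k p (map (ren n k g) \<sigma>)) t" if pt: "(p, t) \<in> set as" for p t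
  proof -
    have "ren (n + p) (k + p) (fplus n k g p) (sub (n + p) (lift_sub n p \<sigma>) t) =
       sub (k + p) (map (ren (n + p) (k + p) (fplus n k g p)) (lift_sub n p \<sigma>)) t"
      by (rule wf_Op.IH[OF pt])
         (auto simp: fplus_def wf_Op.prems intro: trans_less_add1 wf_lift_sub[of \<sigma>])
    also have "map (ren (n + p) (k + p) (fplus n k g p)) (lift_sub n p \<sigma>) =
        lift_sub k p (map (ren n k g) \<sigma>)"
    proof (rule nth_equalityI)
      fix i assume i: "i < length (map (ren (n + p) (k + p) (fplus n k g p)) (lift_sub n p \<sigma>))"
      show "map (ren (n + p) (k + p) (fplus n k g p)) (lift_sub n p \<sigma>) ! i =
            lift_sub k p (map (ren n k g) \<sigma>) ! i"
      proof (cases "i < length \<sigma>")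
        case True
        then have w: "wf_trm E \<Theta> n (\<sigma> ! i)" using wf_Op.prems by auto
        have "ren (n + p) (k + p) (fplus n k g p) (ren n (n + p) id (\<sigma> ! i)) =
              ren n (k + p) (\<lambda>i. fplus n k g p (id i)) (\<sigma> ! i)"
          by (rule ren_ren[OF w]) auto
        also have "\<dots> = ren n (k + p) (\<lambda>i. id (g i)) (\<sigma> ! i)"
          by (rule ren_cong[OF w]) (auto simp: fplus_def)
        also have "\<dots> = ren k (k + p) id (ren n k g (\<sigma> ! i))"
          by (rule ren_ren[OF w, symmetric]) (use wf_Op.prems in auto)
        finally show ?thesis using i True by (simp add: nth_lift_sub)
      qed (use i in \<open>auto simp: nth_lift_sub fplus_def\<close>)
    qed simp
    finally show ?thesis .
  qed
  then show ?case unfolding ren.simps sub_Op by auto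
qed auto

text \<open>
  Lifting is compatible with composition of substitutions.  On the old terms, both sides become
  substitutions of weakened terms by \<open>sub_ren\<close> and \<open>ren_sub\<close>; for this reason these two laws
  precede the associativity law \<open>sub_sub\<close>.
\<close>

lemma sub_lift_sub:
  assumes s: "\<And>s. s \<in> set \<sigma> \<Longrightarrow> wf_trm E \<Theta> n s"
    and \<tau>: "length \<tau> = n" "\<And>s. s \<in> set \<tau> \<Longrightarrow> wf_trm E \<Theta> k s"
  shows "map (sub (k + p) (lift_sub k p \<tau>)) (lift_sub n p \<sigma>) = lift_sub k p (map (sub k \<tau>) \<sigma>)"
proof (rule nth_equalityI)
  fix i assume i: "i < length (map (sub (k + p) (lift_sub k p \<tau>)) (lift_sub n p \<sigma>))"
  show "map (sub (k + p) (lift_sub k p \<tau>)) (lift_sub n p \<sigma>) ! i = lift_sub k p (map (sub k \<tau>) \<sigma>) ! i"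
  proof (cases "i < length \<sigma>")
    case True
    then have w: "wf_trm E \<Theta> n (\<sigma> ! i)" using s by auto
    have "sub (k + p) (lift_sub k p \<tau>) (ren n (n + p) id (\<sigma> ! i)) =
          sub (k + p) (map (\<lambda>i. lift_sub k p \<tau> ! id i) [0..<n]) (\<sigma> ! i)"
      by (rule sub_ren[OF w]) (auto simp: \<tau>)
    also have "map (\<lambda>i. lift_sub k p \<tau> ! id i) [0..<n] = map (ren k (k + p) id) \<tau>"
      by (rule nth_equalityI) (auto simp: \<tau> nth_lift_sub)
    also have "sub (k + p) (map (ren k (k + p) id) \<tau>) (\<sigma> ! i) = ren k (k + p) id (sub k \<tau> (\<sigma> ! i))"
      by (rule ren_sub[OF w, symmetric]) (auto simp: \<tau>)
    finally show ?thesis using i True by (simp add: nth_lift_sub id_def)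
  qed (use i in \<open>auto simp: nth_lift_sub \<tau>\<close>)
qed simp

lemma sub_sub:
  assumes "wf_trm E \<Theta> m t" "length \<sigma> = m" "\<And>s. s \<in> set \<sigma> \<Longrightarrow> wf_trm E \<Theta> n s"
    "length \<tau> = n" "\<And>s. s \<in> set \<tau> \<Longrightarrow> wf_trm E \<Theta> k s"
  shows "sub k \<tau> (sub n \<sigma> t) = sub k (map (sub k \<tau>) \<sigma>) t"
  using assms
proof (induction arbitrary: n \<sigma> k \<tau> rule: wf_trm.induct)
  case (wf_Op w as m)
  have "sub (k + p) (lift_sub k p \<tau>) (sub (n + p) (lift_sub n p \<sigma>) t) =
      sub (k + p) (lift_sub k p (map (sub k \<tau>) \<sigma>)) t" if pt: "(p, t) \<in> set as" for p t
  proof -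
    have "lift_sub k p (map (sub k \<tau>) \<sigma>) = map (sub (k + p) (lift_sub k p \<tau>)) (lift_sub n p \<sigma>)"
      by (rule sub_lift_sub[symmetric]) (use wf_Op.prems in auto)
    then show ?thesis
      by (simp del: map_map, intro wf_Op.IH[OF pt])
         (auto simp: wf_Op.prems intro: wf_lift_sub[of \<sigma>] wf_lift_sub[of \<tau>])
  qed
  then show ?case unfolding sub_Op by auto
qed auto

lemma lift_sub_Var: "lift_sub n p (map Var [0..<n]) = map Var [0..<n + p]"
  by (rule nth_equalityI) (auto simp: nth_lift_sub)

lemma sub_Var:
  assumes "wf_trm E \<Theta> n t"
  shows "sub n (map Var [0..<n]) t = t"
  using assms
proof (induction rule: wf_trm.induct)
  case (wf_Op w as n)
  then have "map (\<lambda>(p, t). (p, sub (n + p) (map Var [0..<n + p]) t)) as = map (\<lambda>x. x) as"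
    by (intro map_cong refl) (auto split: prod.splits)
  then show ?case unfolding sub_Op lift_sub_Var by simp
qed (auto intro: map_idI)

text \<open>
  The counterpart in syntax of the fact that renaming in an abstract clone is, by definition,
  substitution of variables.
\<close>

lemma ren_eq_sub:
  assumes "wf_trm E \<Theta> m t" "\<And>i. i < m \<Longrightarrow> f i < n"
  shows "ren m n f t = sub n (map (\<lambda>i. Var (f i)) [0..<m]) t"
proof -
  have "ren m n f t = sub n (map Var [0..<n]) (ren m n f t)"
    using sub_Var[OF wf_ren[OF assms]] by simp
  also have "\<dots> = sub n (map (\<lambda>i. map Var [0..<n] ! f i) [0..<m]) t"
    by (rule sub_ren[OF assms]) auto
  also have "map (\<lambda>i. map Var [0..<n] ! f i) [0..<m] = map (\<lambda>i. Var (f i)) [0..<m]"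
    using assms(2) by auto
  finally show ?thesis .
qed

lemma ren_id:
  assumes "wf_trm E \<Theta> n t" "\<And>i. i < n \<Longrightarrow> f i = i"
  shows "ren n n f t = t"
proof -
  have "ren n n f t = ren n n (\<lambda>i. i) t" by (rule ren_cong[OF assms])
  also have "\<dots> = t" using ren_eq_sub[OF assms(1), of "\<lambda>i. i" n] sub_Var[OF assms(1)] by simp
  finally show ?thesis .
qed

section \<open>Metasubstitution\<close>

lemma wf_msub:
  assumes "wf_trm E ms n t" "length \<theta> = length ms"
    "\<And>j. j < length ms \<Longrightarrow> fst (\<theta> ! j) = ms ! j \<and> wf_trm E \<Theta> (n + ms ! j) (snd (\<theta> ! j))"
  shows "wf_trm E \<Theta> n (msub n \<theta> t)"
  using assms
proof (induction arbitrary: \<theta> rule: wf_trm.induct)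
  case (wf_MVar j ts n)
  show ?case unfolding msub.simps
    by (rule wf_sub[where m = "n + ms ! j"]) (use wf_MVar in \<open>auto intro: wf_trm.intros\<close>)
next
  case (wf_Op w as n)
  have "wf_trm E \<Theta> (n + p) (msub (n + p)
     (map (\<lambda>(m, s). (m, ren (n + m) (n + p + m) (\<lambda>i. if i < n then i else i + p) s)) \<theta>) t)"
    if "(p, t) \<in> set as" for p t
    by (rule wf_Op.IH[OF that]) (use wf_Op.prems in \<open>auto simp: case_prod_beta intro!: wf_ren\<close>)
  then show ?case using wf_Op.hyps by (simp add: wf_Op_map)
qed (auto intro: wf_trm.intros)

lemma wf_emsub:
  assumes "wf_trm E ms n t" "length ss = length ms"
    "\<And>j. j < length ms \<Longrightarrow> wf_trm E \<Theta> (d + ms ! j) (ss ! j)"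
  shows "wf_trm E \<Theta> (n + d) (emsub n d (zip ms ss) t)"
  unfolding emsub_def
  by (rule wf_msub[OF wf_ren[OF assms(1)]]) (use assms(2,3) in \<open>auto intro!: wf_ren\<close>)

text \<open>
  Metasubstitution of terms without further variables, \<open>m\<^sub>1,\<dots>,m\<^sub>k \<triangleright> x\<^sub>1,\<dots>,x\<^sub>n \<turnstile> t\<close> and
  \<open>\<Theta> \<triangleright> y\<^sub>1,\<dots>,y\<^bsub>m\<^sub>j\<^esub> \<turnstile> s\<^sub>j\<close>, is the composition of the classifying category.  As the \<open>s\<^sub>j\<close> contain
  no variables of the ambient context, they need not be weakened under binders, which makes
  the following recursion much simpler to reason about than \<open>msub\<close>.
\<close>

fun csub :: "nat \<Rightarrow> 'o trm list \<Rightarrow> 'o trm \<Rightarrow> 'o trm" where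
  "csub n ss (Var i) = Var i"
| "csub n ss (MVar j ts) = sub n (map (csub n ss) ts) (ss ! j)"
| "csub n ss (Op w as) = Op w (map (\<lambda>(p, t). (p, csub (n + p) ss t)) as)"

definition wfs :: "'o pres \<Rightarrow> nat list \<Rightarrow> nat list \<Rightarrow> 'o trm list \<Rightarrow> bool" where
  "wfs E \<Theta> ns ts \<longleftrightarrow> list_all2 (wf_trm E \<Theta>) ns ts"

lemma wfs_length: "wfs E \<Theta> ns ts \<Longrightarrow> length ts = length ns"
  by (auto simp: wfs_def list_all2_lengthD)

lemma wfs_nth: "wfs E \<Theta> ns ts \<Longrightarrow> j < length ns \<Longrightarrow> wf_trm E \<Theta> (ns ! j) (ts ! j)"
  by (auto simp: wfs_def list_all2_conv_all_nth)

lemma wfsI: "length ts = length ns \<Longrightarrow> (\<And>j. j < length ns \<Longrightarrow> wf_trm E \<Theta> (ns ! j) (ts ! j)) \<Longrightarrow> wfs E \<Theta> ns ts"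
  by (auto simp: wfs_def list_all2_conv_all_nth)

definition weaken_all :: "nat \<Rightarrow> nat list \<Rightarrow> 'o trm list \<Rightarrow> (nat \<times> 'o trm) list" where
  "weaken_all n ms ss = map (\<lambda>(m, s). (m, ren m (n + m) (\<lambda>i. n + i) s)) (zip ms ss)"

text \<open>
  If the substituted terms come from the context without variables, then weakening them first to
  \<open>n\<close> and then, under a binder, to \<open>n + p\<close> amounts to weakening them to \<open>n + p\<close> at once; so \<open>msub\<close>
  reproduces the form \<open>weaken_all\<close> of its argument and follows the recursion of \<open>csub\<close>.
\<close>

lemma msub_weaken_all:
  assumes "wf_trm E ms n t" "wfs E \<Theta> ms ss"
  shows "msub n (weaken_all n ms ss) t = csub n ss t \<and> wf_trm E \<Theta> n (csub n ss t)"
  using assms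
proof (induction rule: wf_trm.induct)
  case (wf_MVar j ts n)
  note l = wfs_length[OF wf_MVar.prems]
  have w: "wf_trm E \<Theta> (ms ! j) (ss ! j)" using wf_MVar wfs_nth by blast
  have ts: "map (msub n (weaken_all n ms ss)) ts = map (csub n ss) ts"
    using wf_MVar by auto
  have "snd (weaken_all n ms ss ! j) = ren (ms ! j) (n + ms ! j) (\<lambda>i. n + i) (ss ! j)"
    using wf_MVar.hyps l by (simp add: weaken_all_def)
  then have "msub n (weaken_all n ms ss) (MVar j ts) =
      sub n (map Var [0..<n] @ map (csub n ss) ts) (ren (ms ! j) (n + ms ! j) (\<lambda>i. n + i) (ss ! j))"
    unfolding msub.simps ts by simp
  also have "\<dots> = sub n (map (\<lambda>i. (map Var [0..<n] @ map (csub n ss) ts) ! (n + i)) [0..<ms ! j]) (ss ! j)"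
    by (rule sub_ren[OF w]) (use wf_MVar in auto)
  also have "map (\<lambda>i. (map Var [0..<n] @ map (csub n ss) ts) ! (n + i)) [0..<ms ! j] = map (csub n ss) ts"
    by (rule nth_equalityI) (use wf_MVar in \<open>auto simp: nth_append\<close>)
  finally show ?case using wf_MVar w by (auto intro!: wf_sub[OF w])
next
  case (wf_Op w as n)
  note l = wfs_length[OF wf_Op.prems]
  have e: "map (\<lambda>(m, s). (m, ren (n + m) (n + p + m) (\<lambda>i. if i < n then i else i + p) s)) (weaken_all n ms ss) =
      weaken_all (n + p) ms ss" for p
  proof (rule nth_equalityI)
    fix i assume i: "i < length (map (\<lambda>(m, s). (m, ren (n + m) (n + p + m) (\<lambda>i. if i < n then i else i + p) s))
        (weaken_all n ms ss))"
    then have i': "i < length ms" by (simp add: weaken_all_def)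
    have w: "wf_trm E \<Theta> (ms ! i) (ss ! i)" using i' wf_Op.prems wfs_nth by blast
    have "ren (n + ms ! i) (n + p + ms ! i) (\<lambda>i. if i < n then i else i + p)
         (ren (ms ! i) (n + ms ! i) (\<lambda>i. n + i) (ss ! i)) =
         ren (ms ! i) (n + p + ms ! i) (\<lambda>j. (\<lambda>i. if i < n then i else i + p) (n + j)) (ss ! i)"
      by (rule ren_ren[OF w]) auto
    also have "\<dots> = ren (ms ! i) (n + p + ms ! i) (\<lambda>i. n + p + i) (ss ! i)"
      by (rule ren_cong[OF w]) auto
    finally show "map (\<lambda>(m, s). (m, ren (n + m) (n + p + m) (\<lambda>i. if i < n then i else i + p) s))
        (weaken_all n ms ss) ! i = weaken_all (n + p) ms ss ! i"
      using i' l by (simp add: weaken_all_def)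
  qed (simp add: weaken_all_def)
  show ?case unfolding msub.simps csub.simps e
    using wf_Op.IH[OF _ wf_Op.prems] wf_Op.hyps by (auto intro!: wf_Op_map)
qed (auto intro: wf_trm.intros)

lemma emsub_eq_csub:
  assumes "wf_trm E ms n t" "wfs E \<Theta> ms ss"
  shows "emsub n 0 (zip ms ss) t = csub n ss t"
  using msub_weaken_all[OF assms] ren_id[OF assms(1), of id]
  by (simp add: emsub_def weaken_all_def)

lemma wf_csub: "wf_trm E ms n t \<Longrightarrow> wfs E \<Theta> ms ss \<Longrightarrow> wf_trm E \<Theta> n (csub n ss t)"
  using msub_weaken_all by blast

lemma csub_ren:
  assumes "wf_trm E ms m t" "wfs E \<Theta> ms ss" "\<And>i. i < m \<Longrightarrow> f i < n"
  shows "csub n ss (ren m n f t) = ren m n f (csub m ss t)"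
  using assms
proof (induction arbitrary: n f rule: wf_trm.induct)
  case (wf_MVar j ts m)
  have w: "wf_trm E \<Theta> (ms ! j) (ss ! j)" using wf_MVar wfs_nth by blast
  have "ren m n f (sub m (map (csub m ss) ts) (ss ! j)) =
      sub n (map (ren m n f) (map (csub m ss) ts)) (ss ! j)"
    by (rule ren_sub[OF w]) (use wf_MVar in \<open>auto intro: wf_csub[OF _ wf_MVar.prems(1)]\<close>)
  moreover have "map (csub n ss) (map (ren m n f) ts) = map (ren m n f) (map (csub m ss) ts)"
    using wf_MVar by auto
  ultimately show ?case by (simp del: map_map)
next
  case (wf_Op w as m)
  have "csub (n + p) ss (ren (m + p) (n + p) (fplus m n f p) t) =
      ren (m + p) (n + p) (fplus m n f p) (csub (m + p) ss t)" if "(p, t) \<in> set as" for p t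
    by (rule wf_Op.IH[OF that]) (use wf_Op.prems in \<open>auto simp: fplus_def intro: trans_less_add1\<close>)
  then show ?case by auto
qed auto

lemma csub_sub:
  assumes "wf_trm E ms m t" "wfs E \<Theta> ms ss" "length \<sigma> = m" "\<And>s. s \<in> set \<sigma> \<Longrightarrow> wf_trm E ms n s"
  shows "csub n ss (sub n \<sigma> t) = sub n (map (csub n ss) \<sigma>) (csub m ss t)"
  using assms
proof (induction arbitrary: n \<sigma> rule: wf_trm.induct)
  case (wf_MVar j ts m)
  have w: "wf_trm E \<Theta> (ms ! j) (ss ! j)" using wf_MVar wfs_nth by blast
  have "sub n (map (csub n ss) \<sigma>) (sub m (map (csub m ss) ts) (ss ! j)) =
      sub n (map (sub n (map (csub n ss) \<sigma>)) (map (csub m ss) ts)) (ss ! j)"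
    by (rule sub_sub[OF w]) (use wf_MVar in \<open>auto intro: wf_csub[OF _ wf_MVar.prems(1)]\<close>)
  moreover have "map (csub n ss) (map (sub n \<sigma>) ts) = map (sub n (map (csub n ss) \<sigma>)) (map (csub m ss) ts)"
    using wf_MVar by auto
  ultimately show ?case by (simp del: map_map)
next
  case (wf_Op w as m)
  have l: "lift_sub n p (map (csub n ss) \<sigma>) = map (csub (n + p) ss) (lift_sub n p \<sigma>)" for p
    using csub_ren[OF wf_Op.prems(3) wf_Op.prems(1), of _ id "n + p"] by (auto simp: lift_sub_def)
  have "csub (n + p) ss (sub (n + p) (lift_sub n p \<sigma>) t) =
      sub (n + p) (lift_sub n p (map (csub n ss) \<sigma>)) (csub (m + p) ss t)" if "(p, t) \<in> set as" for p t
    unfolding l by (rule wf_Op.IH[OF that]) (use wf_Op.prems in \<open>auto intro: wf_lift_sub[of \<sigma>]\<close>)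
  then show ?case unfolding sub_Op csub.simps by auto
qed auto

text \<open>
  Associativity of composition in the classifying category.  At a metavariable it is the
  compatibility of metasubstitution with substitution.
\<close>

lemma csub_csub:
  assumes "wf_trm E ms n t" "wfs E ls ms ss" "wfs E \<Theta> ls rs"
  shows "csub n rs (csub n ss t) = csub n (map2 (\<lambda>m. csub m rs) ms ss) t"
  using assms
proof (induction rule: wf_trm.induct)
  case (wf_MVar j ts n)
  note l = wfs_length[OF wf_MVar.prems(1)]
  have w: "wf_trm E ls (ms ! j) (ss ! j)" using wf_MVar wfs_nth by blast
  have "csub n rs (sub n (map (csub n ss) ts) (ss ! j)) =
      sub n (map (csub n rs) (map (csub n ss) ts)) (csub (ms ! j) rs (ss ! j))"
    by (rule csub_sub[OF w]) (use wf_MVar in \<open>auto intro: wf_csub[OF _ wf_MVar.prems(1)]\<close>)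
  moreover have "map (csub n rs) (map (csub n ss) ts) = map (csub n (map2 (\<lambda>m. csub m rs) ms ss)) ts"
    using wf_MVar by auto
  ultimately show ?case using wf_MVar.hyps(1) l by (simp del: map_map)
qed auto

text \<open>
  The components \<open>m\<^sub>j[x\<^sub>1,\<dots>,x\<^bsub>m\<^sub>j\<^esub>]\<close> of the identity of \<open>\<Theta>\<close>, which are also the
  projections of \<open>\<Theta>\<close> to its entries.
\<close>

definition gen :: "nat list \<Rightarrow> nat \<Rightarrow> 'o trm" where
  "gen \<Theta> j = MVar j (map Var [0..<\<Theta> ! j])"

lemma wf_gen: "j < length \<Theta> \<Longrightarrow> wf_trm E \<Theta> (\<Theta> ! j) (gen \<Theta> j)"
  by (auto simp: gen_def intro!: wf_trm.intros)

lemma wfs_gen: "wfs E \<Theta> \<Theta> (map (gen \<Theta>) [0..<length \<Theta>])"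
  by (rule wfsI) (auto intro: wf_gen)

lemma csub_MVar_Vars:
  assumes "wfs E \<Theta> ms ss" "j < length ms" "n = ms ! j"
  shows "csub n ss (MVar j (map Var [0..<n])) = ss ! j"
proof -
  have "map (csub n ss) (map Var [0..<n]) = map Var [0..<n]" by simp
  then show ?thesis using sub_Var[OF wfs_nth[OF assms(1,2)]] assms(3) by (simp del: map_map)
qed

lemma csub_gen: "wfs E \<Theta> ms ss \<Longrightarrow> j < length ms \<Longrightarrow> csub (ms ! j) ss (gen ms j) = ss ! j"
  unfolding gen_def by (rule csub_MVar_Vars) auto

lemma csub_gens:
  assumes "wf_trm E \<Theta> n t"
  shows "csub n (map (gen \<Theta>) [0..<length \<Theta>]) t = t"
  using assms
proof (induction rule: wf_trm.induct)
  case (wf_MVar j ts n)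
  then have "map (csub n (map (gen \<Theta>) [0..<length \<Theta>])) ts = ts" by (auto intro: map_idI)
  moreover have "map (\<lambda>i. ts ! i) [0..<\<Theta> ! j] = ts"
    using wf_MVar by (auto intro: nth_equalityI)
  ultimately show ?case using wf_MVar by (auto simp: gen_def comp_def intro!: nth_equalityI)
next
  case (wf_Op w as n)
  then have "map (\<lambda>(p, t). (p, csub (n + p) (map (gen \<Theta>) [0..<length \<Theta>]) t)) as = map (\<lambda>x. x) as"
    by (intro map_cong refl) (auto split: prod.splits)
  then show ?case by simp
qed auto

section \<open>Categories\<close>

lemma categoryD:
  assumes "category C"
  shows category_obj: "f \<in> hom C a b \<Longrightarrow> a \<in> obj C \<and> b \<in> obj C"
    and category_ident: "a \<in> obj C \<Longrightarrow> ident C a \<in> hom C a a"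
    and category_comp: "f \<in> hom C a b \<Longrightarrow> g \<in> hom C b c \<Longrightarrow> comp C a b c g f \<in> hom C a c"
    and category_ident_right: "f \<in> hom C a b \<Longrightarrow> comp C a a b f (ident C a) = f"
    and category_ident_left: "f \<in> hom C a b \<Longrightarrow> comp C a b b (ident C b) f = f"
    and category_assoc: "f \<in> hom C a b \<Longrightarrow> g \<in> hom C b c \<Longrightarrow> h \<in> hom C c d \<Longrightarrow>
        comp C a c d h (comp C a b c g f) = comp C a b d (comp C b c d h g) f"
  using assms unfolding category_def by blast+

lemma functorD:
  assumes "is_functor C D F"
  shows functor_obj: "a \<in> obj C \<Longrightarrow> fob F a \<in> obj D"
    and functor_hom: "f \<in> hom C a b \<Longrightarrow> far F a b f \<in> hom D (fob F a) (fob F b)"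
    and functor_ident: "a \<in> obj C \<Longrightarrow> far F a a (ident C a) = ident D (fob F a)"
    and functor_comp: "f \<in> hom C a b \<Longrightarrow> g \<in> hom C b c \<Longrightarrow>
        far F a c (comp C a b c g f) = comp D (fob F a) (fob F b) (fob F c) (far F b c g) (far F a b f)"
proof -
  have "fob F \<in> obj C \<rightarrow>\<^sub>E obj D" "\<And>a b. far F a b \<in> hom C a b \<rightarrow>\<^sub>E hom D (fob F a) (fob F b)"
    using assms unfolding is_functor_def by blast+
  then show "a \<in> obj C \<Longrightarrow> fob F a \<in> obj D"
    "f \<in> hom C a b \<Longrightarrow> far F a b f \<in> hom D (fob F a) (fob F b)" by (blast intro: PiE_mem)+
qed (use assms in \<open>unfold is_functor_def, blast+\<close>)

text \<open>
  The inverse functor chooses for each \<open>d\<close> an object \<open>G0 d\<close> and an isomorphism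
  \<open>e d : F (G0 d) \<rightarrow> d\<close>, conjugates an arrow \<open>d \<rightarrow> d'\<close> with these isomorphisms, and pulls the result
  back along the bijection on hom-sets.  All equations in \<open>C\<close> are verified after applying the faithful
  functor \<open>F\<close>, and then after composing with the isomorphism \<open>e d\<close>.
\<close>

lemma fully_faithful_essentially_surjective_equivalence:
  assumes C: "category C" and D: "category D" and F: "is_functor C D F"
    and ff: "\<And>a b. a \<in> obj C \<Longrightarrow> b \<in> obj C \<Longrightarrow>
      bij_betw (far F a b) (hom C a b) (hom D (fob F a) (fob F b))"
    and es: "\<And>d. d \<in> obj D \<Longrightarrow> \<exists>a\<in>obj C. \<exists>f. is_iso D (fob F a) d f"
  shows "equivalent_categories C D"
proof -
  define lf where "lf a b = inv_into (hom C a b) (far F a b)" for a b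
  have lf_hom: "lf a b g \<in> hom C a b" if "a \<in> obj C" "b \<in> obj C" "g \<in> hom D (fob F a) (fob F b)" for a b g
    unfolding lf_def using ff[OF that(1,2)] that(3) by (metis bij_betw_imp_surj_on inv_into_into)
  have F_lf: "far F a b (lf a b g) = g" if "a \<in> obj C" "b \<in> obj C" "g \<in> hom D (fob F a) (fob F b)" for a b g
    unfolding lf_def using ff[OF that(1,2)] that(3) by (metis bij_betw_inv_into_right)
  have eqI: "f = g" if "f \<in> hom C a b" "g \<in> hom C a b" "far F a b f = far F a b g" for a b f g
    using that ff[of a b] category_obj[OF C] unfolding bij_betw_def inj_on_def by blast
  obtain G0 e where G0: "\<And>d. d \<in> obj D \<Longrightarrow> G0 d \<in> obj C \<and> is_iso D (fob F (G0 d)) d (e d)"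
    using es by metis
  then have e: "d \<in> obj D \<Longrightarrow> e d \<in> hom D (fob F (G0 d)) d" for d by (auto simp: is_iso_def)
  obtain e' where e': "\<And>d. d \<in> obj D \<Longrightarrow> e' d \<in> hom D d (fob F (G0 d)) \<and>
     comp D (fob F (G0 d)) d (fob F (G0 d)) (e' d) (e d) = ident D (fob F (G0 d)) \<and>
     comp D d (fob F (G0 d)) d (e d) (e' d) = ident D d"
    using G0 unfolding is_iso_def by metis
  note Dc = category_comp[OF D] and Da = category_assoc[OF D] and Dl = category_ident_left[OF D]
    and Dr = category_ident_right[OF D] and Do = category_obj[OF D]
  note Fo = functor_obj[OF F] and Fh = functor_hom[OF F] and Fi = functor_ident[OF F] and Fc = functor_comp[OF F]
  let ?T = "\<lambda>d. fob F (G0 d)"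
  \<comment> \<open>the conjugate of \<open>g : d \<rightarrow> d'\<close> by the chosen isomorphisms\<close>
  define gm where "gm d d' g = comp D (?T d) d (?T d')
      (comp D d d' (?T d') (e' d') g) (e d)" for d d' g
  have gm: "gm d d' g \<in> hom D (?T d) (?T d')" if "g \<in> hom D d d'" for d d' g
    unfolding gm_def using that Do[OF that] e e' by (meson Dc)
  have e_gm: "comp D (?T d) (?T d') d' (e d') (gm d d' g) = comp D (?T d) d d' g (e d)"
    if g: "g \<in> hom D d d'" for d d' g
  proof -
    have o: "d \<in> obj D" "d' \<in> obj D" using Do[OF g] by auto
    have h: "comp D d d' (?T d') (e' d') g \<in> hom D d (?T d')" using g e' o Dc by meson
    have "comp D (?T d) (?T d') d' (e d') (gm d d' g) =
       comp D (?T d) d d' (comp D d (?T d') d' (e d') (comp D d d' (?T d') (e' d') g)) (e d)"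
      unfolding gm_def using e o h by (simp add: Da)
    also have "comp D d (?T d') d' (e d') (comp D d d' (?T d') (e' d') g) = g"
      using Da[OF g, of "e' d'" "?T d'" "e d'" d'] e' e o Dl[OF g] by auto
    finally show ?thesis .
  qed
  \<comment> \<open>\<open>e d\<close> can be cancelled on the left, since it has the left inverse \<open>e' d\<close>\<close>
  have e_mono: "g = h" if "d \<in> obj D" "g \<in> hom D x (?T d)" "h \<in> hom D x (?T d)"
    "comp D x (?T d) d (e d) g = comp D x (?T d) d (e d) h" for d x g h
    using Da[OF that(2) e[OF that(1)], of "e' d" "?T d"]
      Da[OF that(3) e[OF that(1)], of "e' d" "?T d"] e'[OF that(1)]
      Dl[OF that(2)] Dl[OF that(3)] that(4) by metis
  define G where "G = \<lparr>fob = (\<lambda>d\<in>obj D. G0 d), far = (\<lambda>d d'. \<lambda>g\<in>hom D d d'. lf (G0 d) (G0 d') (gm d d' g))\<rparr>"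
  have Gh: "far G d d' g \<in> hom C (G0 d) (G0 d')" "far F (G0 d) (G0 d') (far G d d' g) = gm d d' g"
    if "g \<in> hom D d d'" for d d' g
    using that Do[OF that] G0 gm[OF that] by (auto simp: G_def lf_hom F_lf)
  have Gfob: "d \<in> obj D \<Longrightarrow> fob G d = G0 d" for d by (simp add: G_def)
  have G: "is_functor D C G"
    unfolding is_functor_def
  proof (intro conjI allI ballI impI)
    show "fob G \<in> obj D \<rightarrow>\<^sub>E obj C" using G0 by (auto simp: G_def)
    show "far G a b \<in> hom D a b \<rightarrow>\<^sub>E hom C (fob G a) (fob G b)" for a b
    proof (rule PiE_I)
      show "far G a b x = undefined" if "x \<notin> hom D a b" for x using that by (simp add: G_def)
      show "far G a b x \<in> hom C (fob G a) (fob G b)" if "x \<in> hom D a b" for x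
        using that Gh Do[OF that] by (simp add: Gfob)
    qed
    fix d assume d: "d \<in> obj D"
    show "far G d d (ident D d) = ident C (fob G d)"
    proof (rule eqI)
      have i: "ident D d \<in> hom D d d" using D d by (simp add: category_ident)
      show "far G d d (ident D d) \<in> hom C (G0 d) (G0 d)" by (rule Gh[OF i])
      show "ident C (fob G d) \<in> hom C (G0 d) (G0 d)" using C d G0 by (simp add: category_ident Gfob)
      have "gm d d (ident D d) = ident D (?T d)"
        by (rule e_mono[OF d gm[OF i]])
           (use e_gm[OF i] d G0 D in \<open>auto simp: category_ident Fo Dl[OF e] Dr[OF e]\<close>)
      then show "far F (G0 d) (G0 d) (far G d d (ident D d)) = far F (G0 d) (G0 d) (ident C (fob G d))"
        using d G0 Gh(2)[OF i] by (simp add: Gfob Fi)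
    qed
  next
    fix a b c f g assume f: "f \<in> hom D a b" and g: "g \<in> hom D b c"
    have o: "a \<in> obj D" "b \<in> obj D" "c \<in> obj D" using Do[OF f] Do[OF g] by auto
    have gf: "comp D a b c g f \<in> hom D a c" using Dc[OF f g] .
    have "far G a c (comp D a b c g f) = comp C (G0 a) (G0 b) (G0 c) (far G b c g) (far G a b f)"
    proof (rule eqI)
      show "far G a c (comp D a b c g f) \<in> hom C (G0 a) (G0 c)" by (rule Gh[OF gf])
      show "comp C (G0 a) (G0 b) (G0 c) (far G b c g) (far G a b f) \<in> hom C (G0 a) (G0 c)"
        using Gh(1)[OF f] Gh(1)[OF g] category_comp[OF C] by blast
      have "gm a c (comp D a b c g f) = comp D (?T a) (?T b) (?T c) (gm b c g) (gm a b f)"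
      proof (rule e_mono[OF o(3) gm[OF gf] Dc[OF gm[OF f] gm[OF g]]])
        have "comp D (?T a) (?T c) c (e c) (comp D (?T a) (?T b) (?T c) (gm b c g) (gm a b f)) =
           comp D (?T a) (?T b) c (comp D (?T b) b c g (e b)) (gm a b f)"
          unfolding Da[OF gm[OF f] gm[OF g] e[OF o(3)]] e_gm[OF g] ..
        also have "\<dots> = comp D (?T a) b c g (comp D (?T a) a b f (e a))"
          unfolding Da[OF gm[OF f] e[OF o(2)] g, symmetric] e_gm[OF f] ..
        also have "\<dots> = comp D (?T a) a c (comp D a b c g f) (e a)"
          by (rule Da[OF e[OF o(1)] f g])
        finally show "comp D (?T a) (?T c) c (e c) (gm a c (comp D a b c g f)) =
           comp D (?T a) (?T c) c (e c) (comp D (?T a) (?T b) (?T c) (gm b c g) (gm a b f))"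
          unfolding e_gm[OF gf] by simp
      qed
      then show "far F (G0 a) (G0 c) (far G a c (comp D a b c g f)) =
         far F (G0 a) (G0 c) (comp C (G0 a) (G0 b) (G0 c) (far G b c g) (far G a b f))"
        unfolding Gh(2)[OF gf] Fc[OF Gh(1)[OF f] Gh(1)[OF g]] Gh(2)[OF f] Gh(2)[OF g] .
    qed
    then show "far G a c (comp D a b c g f) = comp C (fob G a) (fob G b) (fob G c) (far G b c g) (far G a b f)"
      using o by (simp add: Gfob)
  qed
  define \<eta> where "\<eta> = (\<lambda>a\<in>obj C. lf a (G0 (fob F a)) (e' (fob F a)))"
  define \<eta>' where "\<eta>' a = lf (G0 (fob F a)) a (e (fob F a))" for a
  have \<eta>: "\<eta> a \<in> hom C a (G0 (fob F a))" "far F a (G0 (fob F a)) (\<eta> a) = e' (fob F a)"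
    "\<eta>' a \<in> hom C (G0 (fob F a)) a" "far F (G0 (fob F a)) a (\<eta>' a) = e (fob F a)" if "a \<in> obj C" for a
    using that G0 Fo e e' by (auto simp: \<eta>_def \<eta>'_def lf_hom F_lf)
  have n1: "nat_iso C C (id_ftr C) (comp_ftr C G F) \<eta>"
    unfolding nat_iso_def nat_trans_def
  proof (intro conjI allI ballI impI)
    show "\<eta> \<in> (\<Pi>\<^sub>E a\<in>obj C. hom C (fob (id_ftr C) a) (fob (comp_ftr C G F) a))"
    proof (rule PiE_I)
      show "\<eta> x \<in> hom C (fob (id_ftr C) x) (fob (comp_ftr C G F) x)" if "x \<in> obj C" for x
        using that \<eta>(1) Fo by (simp add: id_ftr_def comp_ftr_def Gfob)
    qed (simp add: \<eta>_def)
    fix a b f assume f: "f \<in> hom C a b"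
    have o: "a \<in> obj C" "b \<in> obj C" using category_obj[OF C f] by auto
    note Ff = Fh[OF f]
    have "comp C a b (G0 (fob F b)) (\<eta> b) f =
        comp C a (G0 (fob F a)) (G0 (fob F b)) (far G (fob F a) (fob F b) (far F a b f)) (\<eta> a)"
    proof (rule eqI)
      show "comp C a b (G0 (fob F b)) (\<eta> b) f \<in> hom C a (G0 (fob F b))"
        using f o \<eta> category_comp[OF C] by blast
      show "comp C a (G0 (fob F a)) (G0 (fob F b)) (far G (fob F a) (fob F b) (far F a b f)) (\<eta> a) \<in> hom C a (G0 (fob F b))"
        using Gh(1)[OF Ff] o \<eta> category_comp[OF C] by blast
      show "far F a (G0 (fob F b)) (comp C a b (G0 (fob F b)) (\<eta> b) f) =
          far F a (G0 (fob F b)) (comp C a (G0 (fob F a)) (G0 (fob F b)) (far G (fob F a) (fob F b) (far F a b f)) (\<eta> a))"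
        unfolding Fc[OF f \<eta>(1)[OF o(2)]] Fc[OF \<eta>(1)[OF o(1)] Gh(1)[OF Ff]] Gh(2)[OF Ff] \<eta>(2)[OF o(1)] \<eta>(2)[OF o(2)]
      proof (rule e_mono)
        let ?a = "fob F a" and ?b = "fob F b" and ?f = "far F a b f"
        let ?a' = "?T ?a" and ?b' = "?T ?b"
        show b: "?b \<in> obj D" by (simp add: Fo o)
        have a: "?a \<in> obj D" by (simp add: Fo o)
        have ea: "e' ?a \<in> hom D ?a ?a'" and eb: "e' ?b \<in> hom D ?b ?b'" using e' a b by auto
        show "comp D ?a ?b ?b' (e' ?b) ?f \<in> hom D ?a ?b'" by (rule Dc[OF Ff eb])
        show "comp D ?a ?a' ?b' (gm ?a ?b ?f) (e' ?a) \<in> hom D ?a ?b'" by (rule Dc[OF ea gm[OF Ff]])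
        have "comp D ?a ?b' ?b (e ?b) (comp D ?a ?b ?b' (e' ?b) ?f) = ?f"
          unfolding Da[OF Ff eb e[OF b]] using e' b Dl[OF Ff] by simp
        moreover have "comp D ?a ?b' ?b (e ?b) (comp D ?a ?a' ?b' (gm ?a ?b ?f) (e' ?a)) = ?f"
          unfolding Da[OF ea gm[OF Ff] e[OF b]] e_gm[OF Ff] Da[OF ea e[OF a] Ff, symmetric]
          using e' a Dr[OF Ff] by simp
        ultimately show "comp D ?a ?b' ?b (e ?b) (comp D ?a ?b ?b' (e' ?b) ?f) =
          comp D ?a ?b' ?b (e ?b) (comp D ?a ?a' ?b' (gm ?a ?b ?f) (e' ?a))" by simp
      qed
    qed
    then show "comp C (fob (id_ftr C) a) (fob (id_ftr C) b) (fob (comp_ftr C G F) b) (\<eta> b) (far (id_ftr C) a b f) =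
       comp C (fob (id_ftr C) a) (fob (comp_ftr C G F) a) (fob (comp_ftr C G F) b) (far (comp_ftr C G F) a b f) (\<eta> a)"
      using o f Fo by (simp add: id_ftr_def comp_ftr_def Gfob)
  next
    fix a assume a: "a \<in> obj C"
    let ?b = "G0 (fob F a)"
    have Fa: "fob F a \<in> obj D" using Fo[OF a] .
    have b: "?b \<in> obj C" using G0[OF Fa] by simp
    have "comp C a ?b a (\<eta>' a) (\<eta> a) = ident C a"
    proof (rule eqI)
      show "comp C a ?b a (\<eta>' a) (\<eta> a) \<in> hom C a a" using \<eta>[OF a] category_comp[OF C] by blast
      show "ident C a \<in> hom C a a" using category_ident[OF C a] .
      show "far F a a (comp C a ?b a (\<eta>' a) (\<eta> a)) = far F a a (ident C a)"
        unfolding Fc[OF \<eta>(1)[OF a] \<eta>(3)[OF a]] using \<eta>[OF a] e'[OF Fa] Fi[OF a] by simp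
    qed
    moreover have "comp C ?b a ?b (\<eta> a) (\<eta>' a) = ident C ?b"
    proof (rule eqI)
      show "comp C ?b a ?b (\<eta> a) (\<eta>' a) \<in> hom C ?b ?b" using \<eta>[OF a] category_comp[OF C] by blast
      show "ident C ?b \<in> hom C ?b ?b" using category_ident[OF C b] .
      show "far F ?b ?b (comp C ?b a ?b (\<eta> a) (\<eta>' a)) = far F ?b ?b (ident C ?b)"
        unfolding Fc[OF \<eta>(3)[OF a] \<eta>(1)[OF a]] using \<eta>[OF a] e'[OF Fa] Fi[OF b] by simp
    qed
    ultimately show "is_iso C (fob (id_ftr C) a) (fob (comp_ftr C G F) a) (\<eta> a)"
      unfolding is_iso_def using a Fa \<eta>[OF a] by (auto simp: id_ftr_def comp_ftr_def Gfob)
  qed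
  have n2: "nat_iso D D (comp_ftr D F G) (id_ftr D) (\<lambda>d\<in>obj D. e d)"
    unfolding nat_iso_def nat_trans_def
  proof (intro conjI allI ballI impI)
    show "(\<lambda>d\<in>obj D. e d) \<in> (\<Pi>\<^sub>E a\<in>obj D. hom D (fob (comp_ftr D F G) a) (fob (id_ftr D) a))"
      using e by (auto simp: id_ftr_def comp_ftr_def Gfob)
    fix a b f assume f: "f \<in> hom D a b"
    then show "comp D (fob (comp_ftr D F G) a) (fob (comp_ftr D F G) b) (fob (id_ftr D) b)
         ((\<lambda>d\<in>obj D. e d) b) (far (comp_ftr D F G) a b f) =
        comp D (fob (comp_ftr D F G) a) (fob (id_ftr D) a) (fob (id_ftr D) b) (far (id_ftr D) a b f)
         ((\<lambda>d\<in>obj D. e d) a)"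
      using Do[OF f] e_gm[OF f] Gh(2)[OF f] by (simp add: id_ftr_def comp_ftr_def Gfob)
  next
    fix a assume "a \<in> obj D"
    then show "is_iso D (fob (comp_ftr D F G) a) (fob (id_ftr D) a) ((\<lambda>d\<in>obj D. e d) a)"
      using G0 by (simp add: id_ftr_def comp_ftr_def Gfob)
  qed
  show ?thesis unfolding equivalent_categories_def using C D F G n1 n2 by blast
qed

lemma category_full_subcat: "category C \<Longrightarrow> category (full_subcat C P)"
  unfolding category_def full_subcat_def by (simp split: if_splits)

lemma compose_hom: "f \<in> A \<rightarrow>\<^sub>E B \<Longrightarrow> g \<in> B \<rightarrow>\<^sub>E C \<Longrightarrow> compose A g f \<in> A \<rightarrow>\<^sub>E C"
  by (auto simp: compose_def PiE_def Pi_def extensional_def)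

lemma SET_simps [simp]:
  "obj SET = UNIV" "hom SET A B = (A \<rightarrow>\<^sub>E B)" "ident SET A = (\<lambda>x\<in>A. x)" "comp SET A B C g f = compose A g f"
  by (auto simp: SET_def)

lemma compose_restrict_right: "f \<in> A \<rightarrow>\<^sub>E B \<Longrightarrow> compose A f (\<lambda>x\<in>A. x) = f"
  by (rule extensionalityI[of _ A]) (auto simp: compose_def PiE_def)

lemma compose_restrict_left: "f \<in> A \<rightarrow>\<^sub>E B \<Longrightarrow> compose A (\<lambda>x\<in>B. x) f = f"
  by (rule extensionalityI[of _ A]) (auto simp: compose_def PiE_def Pi_def)

lemma compose_compose:
  "f \<in> A \<rightarrow>\<^sub>E B \<Longrightarrow> compose A h (compose A g f) = compose A (compose B h g) f"
  by (rule extensionalityI[of _ A]) (auto simp: compose_def PiE_def Pi_def)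

lemma category_SET: "category SET"
  unfolding category_def
proof (intro conjI allI ballI impI)
  fix a b c :: "'a set" and f g :: "'a \<Rightarrow> 'a"
  assume "f \<in> hom SET a b" "g \<in> hom SET b c"
  then show "comp SET a b c g f \<in> hom SET a c" using compose_hom[of f a b g c] by simp
next
  fix a b c d :: "'a set" and f g h :: "'a \<Rightarrow> 'a"
  assume "f \<in> hom SET a b"
  then show "comp SET a c d h (comp SET a b c g f) = comp SET a b d (comp SET b c d h g) f"
    using compose_compose[of f a b h g] by simp
qed (simp_all add: compose_restrict_right compose_restrict_left)

lemma PiE_eqI: "f \<in> PiE A B \<Longrightarrow> g \<in> PiE A B' \<Longrightarrow> (\<And>x. x \<in> A \<Longrightarrow> f x = g x) \<Longrightarrow> f = g"
  by (rule extensionalityI[of _ A]) (auto simp: PiE_def)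

lemma nat_transD:
  assumes "nat_trans C D F G \<tau>"
  shows nat_trans_ext: "\<tau> \<in> (\<Pi>\<^sub>E a\<in>obj C. hom D (fob F a) (fob G a))"
    and nat_trans_hom: "a \<in> obj C \<Longrightarrow> \<tau> a \<in> hom D (fob F a) (fob G a)"
    and nat_trans_natural: "f \<in> hom C a b \<Longrightarrow>
        comp D (fob F a) (fob F b) (fob G b) (\<tau> b) (far F a b f) =
        comp D (fob F a) (fob G a) (fob G b) (far G a b f) (\<tau> a)"
  using assms unfolding nat_trans_def by (auto simp: PiE_def Pi_def)

lemma nat_trans_ident:
  assumes C: "category C" and D: "category D" and F: "is_functor C D F"
  shows "nat_trans C D F F (\<lambda>a\<in>obj C. ident D (fob F a))"
  unfolding nat_trans_def using functor_obj[OF F] category_ident[OF D] category_obj[OF C]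
    category_ident_left[OF D functor_hom[OF F]] category_ident_right[OF D functor_hom[OF F]]
  by auto

lemma nat_trans_comp:
  assumes C: "category C" and D: "category D"
    and F: "is_functor C D F" and G: "is_functor C D G" and H: "is_functor C D H"
    and \<sigma>: "nat_trans C D F G \<sigma>" and \<tau>: "nat_trans C D G H \<tau>"
  shows "nat_trans C D F H (\<lambda>a\<in>obj C. comp D (fob F a) (fob G a) (fob H a) (\<tau> a) (\<sigma> a))"
  unfolding nat_trans_def
proof (intro conjI allI impI)
  note h = nat_trans_hom[OF \<sigma>] nat_trans_hom[OF \<tau>]
  show "(\<lambda>a\<in>obj C. comp D (fob F a) (fob G a) (fob H a) (\<tau> a) (\<sigma> a)) \<in>
      (\<Pi>\<^sub>E a\<in>obj C. hom D (fob F a) (fob H a))"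
    using h category_comp[OF D] by auto
  fix a b f assume f: "f \<in> hom C a b"
  then have o: "a \<in> obj C" "b \<in> obj C" using category_obj[OF C f] by auto
  note Da = category_assoc[OF D]
  have "comp D (fob F a) (fob F b) (fob H b) (comp D (fob F b) (fob G b) (fob H b) (\<tau> b) (\<sigma> b)) (far F a b f) =
    comp D (fob F a) (fob G a) (fob H b) (comp D (fob G a) (fob G b) (fob H b) (\<tau> b) (far G a b f)) (\<sigma> a)"
    unfolding Da[OF functor_hom[OF F f] h(1)[OF o(2)] h(2)[OF o(2)], symmetric] nat_trans_natural[OF \<sigma> f]
    by (rule Da[OF h(1)[OF o(1)] functor_hom[OF G f] h(2)[OF o(2)]])
  also have "\<dots> = comp D (fob F a) (fob H a) (fob H b) (far H a b f) (comp D (fob F a) (fob G a) (fob H a) (\<tau> a) (\<sigma> a))"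
    unfolding nat_trans_natural[OF \<tau> f]
    by (rule Da[OF h(1)[OF o(1)] h(2)[OF o(1)] functor_hom[OF H f], symmetric])
  finally show "comp D (fob F a) (fob F b) (fob H b) ((\<lambda>a\<in>obj C. comp D (fob F a) (fob G a) (fob H a) (\<tau> a) (\<sigma> a)) b) (far F a b f) =
    comp D (fob F a) (fob H a) (fob H b) (far H a b f) ((\<lambda>a\<in>obj C. comp D (fob F a) (fob G a) (fob H a) (\<tau> a) (\<sigma> a)) a)"
    using o by simp
qed

lemma category_fun_cat:
  assumes C: "category C" and D: "category D"
  shows "category (fun_cat C D)"
proof -
  have o: "obj (fun_cat C D) = {F. is_functor C D F}"
    and h: "hom (fun_cat C D) F G = {\<tau>. is_functor C D F \<and> is_functor C D G \<and> nat_trans C D F G \<tau>}"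
    and i: "ident (fun_cat C D) F = (\<lambda>a\<in>obj C. ident D (fob F a))"
    and c: "comp (fun_cat C D) F G H \<tau> \<sigma> = (\<lambda>a\<in>obj C. comp D (fob F a) (fob G a) (fob H a) (\<tau> a) (\<sigma> a))"
    for F G H :: "('a, 'b, 'c, 'd) ftr" and \<tau> \<sigma>
    by (auto simp: fun_cat_def)
  show ?thesis
    unfolding category_def o h i c mem_Collect_eq
  proof (intro conjI allI ballI impI; (elim conjE)?)
    fix F G \<tau> assume t: "nat_trans C D F G \<tau>"
    show "(\<lambda>a\<in>obj C. comp D (fob F a) (fob F a) (fob G a) (\<tau> a) ((\<lambda>a\<in>obj C. ident D (fob F a)) a)) = \<tau>"
      using category_ident_right[OF D nat_trans_hom[OF t]]
      by (intro extensionalityI[of _ "obj C"]) (use nat_trans_ext[OF t] in \<open>auto simp: PiE_def\<close>)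
    show "(\<lambda>a\<in>obj C. comp D (fob F a) (fob G a) (fob G a) ((\<lambda>a\<in>obj C. ident D (fob G a)) a) (\<tau> a)) = \<tau>"
      using category_ident_left[OF D nat_trans_hom[OF t]]
      by (intro extensionalityI[of _ "obj C"]) (use nat_trans_ext[OF t] in \<open>auto simp: PiE_def\<close>)
  next
    fix F G H K \<sigma> \<tau> \<rho> assume t: "nat_trans C D F G \<sigma>" "nat_trans C D G H \<tau>" "nat_trans C D H K \<rho>"
    show "(\<lambda>a\<in>obj C. comp D (fob F a) (fob H a) (fob K a) (\<rho> a)
          ((\<lambda>a\<in>obj C. comp D (fob F a) (fob G a) (fob H a) (\<tau> a) (\<sigma> a)) a)) =
       (\<lambda>a\<in>obj C. comp D (fob F a) (fob G a) (fob K a)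
          ((\<lambda>a\<in>obj C. comp D (fob G a) (fob H a) (fob K a) (\<rho> a) (\<tau> a)) a) (\<sigma> a))"
      using category_assoc[OF D nat_trans_hom[OF t(1)] nat_trans_hom[OF t(2)] nat_trans_hom[OF t(3)]]
      by (intro extensionalityI[of _ "obj C"]) auto
  qed (simp_all add: nat_trans_ident[OF C D] nat_trans_comp[OF C D])
qed

text \<open>
  The pointwise inverses of a natural transformation are automatically natural; so no inverse
  transformation has to be exhibited.
\<close>

lemma is_iso_fun_cat_SET:
  assumes F: "is_functor C SET F" and G: "is_functor C SET G" and t: "nat_trans C SET F G \<tau>"
    and C: "category C"
    and b: "\<And>a. a \<in> obj C \<Longrightarrow> bij_betw (\<tau> a) (fob F a) (fob G a)"
  shows "is_iso (fun_cat C SET) F G \<tau>"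
proof -
  define \<sigma> where "\<sigma> = (\<lambda>a\<in>obj C. \<lambda>y\<in>fob G a. inv_into (fob F a) (\<tau> a) y)"
  have l: "\<sigma> a (\<tau> a x) = x" if "a \<in> obj C" "x \<in> fob F a" for a x
    using b[OF that(1)] that by (simp add: \<sigma>_def bij_betwE bij_betw_inv_into_left)
  have r: "\<tau> a (\<sigma> a y) = y" "\<sigma> a y \<in> fob F a" if "a \<in> obj C" "y \<in> fob G a" for a y
    using b[OF that(1)] that
    by (auto simp: \<sigma>_def bij_betw_inv_into_right bij_betw_imp_surj_on intro: inv_into_into)
  have sh: "\<sigma> a \<in> fob G a \<rightarrow>\<^sub>E fob F a" if "a \<in> obj C" for a
    using r that by (intro PiE_I) (auto simp: \<sigma>_def)
  have "nat_trans C SET G F \<sigma>"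
    unfolding nat_trans_def
  proof (intro conjI allI impI)
    show "\<sigma> \<in> (\<Pi>\<^sub>E a\<in>obj C. hom SET (fob G a) (fob F a))"
      using sh by (intro PiE_I) (auto simp: \<sigma>_def)
    fix a b f assume f: "f \<in> hom C a b"
    then have o: "a \<in> obj C" "b \<in> obj C" using category_obj[OF C f] by auto
    have Ff: "far F a b f \<in> fob F a \<rightarrow>\<^sub>E fob F b"
      using functor_hom[OF F f] by auto
    have n: "\<tau> b (far F a b f x) = far G a b f (\<tau> a x)" if "x \<in> fob F a" for x
      using fun_cong[OF nat_trans_natural[OF t f], of x] that by (simp add: compose_def)
    have "\<sigma> b (far G a b f y) = far F a b f (\<sigma> a y)" if y: "y \<in> fob G a" for y
      using n[OF r(2)[OF o(1) y]] r(1)[OF o(1) y] l[OF o(2)] PiE_mem[OF Ff r(2)[OF o(1) y]] by metis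
    then show "comp SET (fob G a) (fob G b) (fob F b) (\<sigma> b) (far G a b f) =
        comp SET (fob G a) (fob F a) (fob F b) (far F a b f) (\<sigma> a)"
      by (auto simp: compose_def fun_eq_iff)
  qed
  moreover have "(\<lambda>a\<in>obj C. compose (fob F a) (\<sigma> a) (\<tau> a)) = (\<lambda>a\<in>obj C. \<lambda>x\<in>fob F a. x)"
    using l by (auto simp: fun_eq_iff compose_def)
  moreover have "(\<lambda>a\<in>obj C. compose (fob G a) (\<tau> a) (\<sigma> a)) = (\<lambda>a\<in>obj C. \<lambda>x\<in>fob G a. x)"
    using r by (auto simp: fun_eq_iff compose_def)
  ultimately show ?thesis
    using F G t unfolding is_iso_def by (auto simp: fun_cat_def)
qed

section \<open>Products\<close>

lemma map2_eq_iff_nth: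
  "length xs = length as \<Longrightarrow>
    map2 f as xs = ys \<longleftrightarrow> length ys = length as \<and> (\<forall>i<length as. f (as ! i) (xs ! i) = ys ! i)"
  by (auto simp: list_eq_iff_nth_eq)

lemma is_product_iff:
  "is_product C as p \<pi>s \<longleftrightarrow>
     set as \<subseteq> obj C \<and> p \<in> obj C \<and> length \<pi>s = length as \<and> (\<forall>i<length as. \<pi>s ! i \<in> hom C p (as ! i)) \<and>
     (\<forall>z\<in>obj C. \<forall>fs. length fs = length as \<longrightarrow> (\<forall>i<length as. fs ! i \<in> hom C z (as ! i)) \<longrightarrow>
        (\<exists>!u. u \<in> hom C z p \<and> (\<forall>i<length as. comp C z p (as ! i) (\<pi>s ! i) u = fs ! i)))"
proof (cases "length \<pi>s = length as")
  case True
  have "(length as = length fs \<and> H \<longrightarrow> (\<exists>!u. Q u \<and> length fs = length as \<and> R u)) \<longleftrightarrow>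
      (length fs = length as \<longrightarrow> H \<longrightarrow> (\<exists>!u. Q u \<and> R u))" for fs :: "'b list" and H and Q R :: "'b \<Rightarrow> bool"
    by auto
  then show ?thesis unfolding is_product_def list_all2_conv_all_nth map2_eq_iff_nth[OF True]
    by (simp only:) (simp add: True)
next
  case False
  then show ?thesis unfolding is_product_def by (auto dest: list_all2_lengthD)
qed

text \<open>
  Any two products of the same family are isomorphic, compatibly with the projections, and functors
  preserve isomorphisms; hence it suffices to preserve one chosen product of each family.
\<close>

lemma cartesian_functor_if_chosen_products:
  assumes C: "category C" and D: "category D" and F: "is_functor C D F"
    and ex: "\<And>as. set as \<subseteq> obj C \<Longrightarrow> \<exists>p \<pi>s. is_product C as p \<pi>s \<and>
      is_product D (map (fob F) as) (fob F p) (map2 (\<lambda>a \<pi>. far F p a \<pi>) as \<pi>s)"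
  shows "cartesian_functor C D F"
  unfolding cartesian_functor_def
proof (intro conjI allI impI F)
  fix as q \<rho>s assume q: "is_product C as q \<rho>s"
  then have q': "set as \<subseteq> obj C" "q \<in> obj C" "length \<rho>s = length as" "\<And>i. i < length as \<Longrightarrow> \<rho>s ! i \<in> hom C q (as ! i)"
    and uq: "\<And>z fs. z \<in> obj C \<Longrightarrow> length fs = length as \<Longrightarrow> (\<forall>i<length as. fs ! i \<in> hom C z (as ! i)) \<Longrightarrow>
        (\<exists>!u. u \<in> hom C z q \<and> (\<forall>i<length as. comp C z q (as ! i) (\<rho>s ! i) u = fs ! i))"
    unfolding is_product_iff by blast+
  obtain p \<pi>s where p: "is_product C as p \<pi>s"
    and Fp: "is_product D (map (fob F) as) (fob F p) (map2 (\<lambda>a \<pi>. far F p a \<pi>) as \<pi>s)"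
    using ex[OF q'(1)] by blast
  from p have p': "p \<in> obj C" "length \<pi>s = length as" "\<And>i. i < length as \<Longrightarrow> \<pi>s ! i \<in> hom C p (as ! i)"
    and up: "\<And>z fs. z \<in> obj C \<Longrightarrow> length fs = length as \<Longrightarrow> (\<forall>i<length as. fs ! i \<in> hom C z (as ! i)) \<Longrightarrow>
        (\<exists>!u. u \<in> hom C z p \<and> (\<forall>i<length as. comp C z p (as ! i) (\<pi>s ! i) u = fs ! i))"
    unfolding is_product_iff by blast+
  obtain u where u: "u \<in> hom C q p" "\<And>i. i < length as \<Longrightarrow> comp C q p (as ! i) (\<pi>s ! i) u = \<rho>s ! i"
    using up[OF q'(2,3)] q'(4) by blast
  obtain v where v: "v \<in> hom C p q" "\<And>i. i < length as \<Longrightarrow> comp C p q (as ! i) (\<rho>s ! i) v = \<pi>s ! i"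
    using uq[OF p'(1,2)] p'(3) by blast
  \<comment> \<open>uniqueness of factorisations through the projections of \<open>q\<close>\<close>
  have vu: "comp C q p q v u = ident C q"
  proof -
    have "comp C q q (as ! i) (\<rho>s ! i) (comp C q p q v u) = \<rho>s ! i" if "i < length as" for i
      using category_assoc[OF C u(1) v(1) q'(4)[OF that]] u(2) v(2) that by simp
    moreover have "comp C q q (as ! i) (\<rho>s ! i) (ident C q) = \<rho>s ! i" if "i < length as" for i
      using category_ident_right[OF C q'(4)[OF that]] .
    moreover have "comp C q p q v u \<in> hom C q q" "ident C q \<in> hom C q q"
      using category_comp[OF C u(1) v(1)] category_ident[OF C q'(2)] by auto
    ultimately show ?thesis using uq[OF q'(2,3)] q'(4) by blast
  qed
  have FuFv: "comp D (fob F q) (fob F p) (fob F q) (far F p q v) (far F q p u) = ident D (fob F q)"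
    using functor_comp[OF F u(1) v(1)] vu functor_ident[OF F q'(2)] by simp
  note Fu = functor_hom[OF F u(1)] and Fv = functor_hom[OF F v(1)]
  note D\<pi> = functor_hom[OF F p'(3)] and D\<rho> = functor_hom[OF F q'(4)]
  show "is_product D (map (fob F) as) (fob F q) (map2 (\<lambda>a \<pi>. far F q a \<pi>) as \<rho>s)"
    unfolding is_product_iff
  proof (intro conjI ballI allI impI)
    show "set (map (fob F) as) \<subseteq> obj D" "fob F q \<in> obj D" using q' functor_obj[OF F] by auto
    show "length (map2 (far F q) as \<rho>s) = length (map (fob F) as)" using q'(3) by simp
    show "map2 (far F q) as \<rho>s ! i \<in> hom D (fob F q) (map (fob F) as ! i)"
      if "i < length (map (fob F) as)" for i using that q'(3) D\<rho> by simp
    fix z fs assume z: "z \<in> obj D" "length fs = length (map (fob F) as)"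
      "\<forall>i<length (map (fob F) as). fs ! i \<in> hom D z (map (fob F) as ! i)"
    then have "\<exists>!w. w \<in> hom D z (fob F p) \<and> (\<forall>i<length (map (fob F) as).
        comp D z (fob F p) (map (fob F) as ! i) (map2 (far F p) as \<pi>s ! i) w = fs ! i)"
      using Fp unfolding is_product_iff by blast
    then have U: "\<exists>!w. w \<in> hom D z (fob F p) \<and> (\<forall>i<length as.
        comp D z (fob F p) (fob F (as ! i)) (far F p (as ! i) (\<pi>s ! i)) w = fs ! i)"
      using p'(2) by (simp cong: conj_cong)
    then obtain w where w: "w \<in> hom D z (fob F p)"
      "\<And>i. i < length as \<Longrightarrow> comp D z (fob F p) (fob F (as ! i)) (far F p (as ! i) (\<pi>s ! i)) w = fs ! i" by blast
    have "\<exists>!x. x \<in> hom D z (fob F q) \<and> (\<forall>i<length as.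
        comp D z (fob F q) (fob F (as ! i)) (far F q (as ! i) (\<rho>s ! i)) x = fs ! i)"
    proof (rule ex1I[of _ "comp D z (fob F p) (fob F q) (far F p q v) w"], intro conjI allI impI)
      show "comp D z (fob F p) (fob F q) (far F p q v) w \<in> hom D z (fob F q)"
        by (rule category_comp[OF D w(1) Fv])
      fix i assume i: "i < length as"
      show "comp D z (fob F q) (fob F (as ! i)) (far F q (as ! i) (\<rho>s ! i))
          (comp D z (fob F p) (fob F q) (far F p q v) w) = fs ! i"
        unfolding category_assoc[OF D w(1) Fv D\<rho>[OF i]] functor_comp[OF F v(1) q'(4)[OF i], symmetric] v(2)[OF i]
        by (rule w(2)[OF i])
    next
      fix x assume x: "x \<in> hom D z (fob F q) \<and> (\<forall>i<length as.
        comp D z (fob F q) (fob F (as ! i)) (far F q (as ! i) (\<rho>s ! i)) x = fs ! i)"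
      let ?ux = "comp D z (fob F q) (fob F p) (far F q p u) x"
      have "comp D z (fob F p) (fob F (as ! i)) (far F p (as ! i) (\<pi>s ! i)) ?ux = fs ! i"
        if i: "i < length as" for i
        unfolding category_assoc[OF D conjunct1[OF x] Fu D\<pi>[OF i]] functor_comp[OF F u(1) p'(3)[OF i], symmetric] u(2)[OF i]
        using x i by blast
      moreover have "?ux \<in> hom D z (fob F p)" using category_comp[OF D _ Fu] x by blast
      ultimately have ux: "?ux = w" using U w by blast
      show "x = comp D z (fob F p) (fob F q) (far F p q v) w"
        unfolding ux[symmetric] category_assoc[OF D conjunct1[OF x] Fu Fv] FuFv
        using category_ident_left[OF D] x by simp
    qed
    then show "\<exists>!x. x \<in> hom D z (fob F q) \<and> (\<forall>i<length (map (fob F) as).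
        comp D z (fob F q) (map (fob F) as ! i) (map2 (far F q) as \<rho>s ! i) x = fs ! i)"
      using q'(3) by (simp cong: conj_cong)
  qed
qed

text \<open>
  In \<open>Set\<close> the universal property need only be tested on elements, because elements are the maps from
  a one-point set and maps are determined by their values.
\<close>

lemma is_product_SET_iff:
  fixes As :: "'a set list"
  shows "is_product SET As P ps \<longleftrightarrow> length ps = length As \<and> (\<forall>i<length As. ps ! i \<in> P \<rightarrow>\<^sub>E As ! i) \<and>
    (\<forall>xs. length xs = length As \<longrightarrow> (\<forall>i<length As. xs ! i \<in> As ! i) \<longrightarrow>
      (\<exists>!x. x \<in> P \<and> (\<forall>i<length As. (ps ! i) x = xs ! i)))"
  (is "_ \<longleftrightarrow> _ \<and> _ \<and> ?U")
proof -
  let ?V = "\<forall>(Z :: 'a set) fs. length fs = length As \<longrightarrow> (\<forall>i<length As. fs ! i \<in> Z \<rightarrow>\<^sub>E As ! i) \<longrightarrow>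
        (\<exists>!u. u \<in> Z \<rightarrow>\<^sub>E P \<and> (\<forall>i<length As. compose Z (ps ! i) u = fs ! i))"
  have VU: "?U" if p: "length ps = length As" "\<forall>i<length As. ps ! i \<in> P \<rightarrow>\<^sub>E As ! i"
    and U: ?V
  proof (intro allI impI)
    fix xs assume xs: "length xs = length As" "\<forall>i<length As. xs ! i \<in> As ! i"
    \<comment> \<open>points of a set are maps from a singleton\<close>
    define Z where "Z = {undefined :: 'a}"
    define fs where "fs = map (\<lambda>x. \<lambda>_\<in>Z. x) xs"
    have ex: "\<exists>!u. u \<in> Z \<rightarrow>\<^sub>E P \<and> (\<forall>i<length As. compose Z (ps ! i) u = fs ! i)"
      by (rule U[rule_format]) (use xs in \<open>auto simp: fs_def\<close>)
    have c: "compose Z (ps ! i) (\<lambda>_\<in>Z. x) = fs ! i \<longleftrightarrow> (ps ! i) x = xs ! i" if "i < length As" for i x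
      using that xs by (auto simp: fs_def compose_def Z_def fun_eq_iff)
    obtain u where u: "u \<in> Z \<rightarrow>\<^sub>E P" "\<forall>i<length As. compose Z (ps ! i) u = fs ! i"
      using ex by blast
    have ru: "u = (\<lambda>_\<in>Z. u undefined)" using u(1) by (auto simp: Z_def fun_eq_iff PiE_def extensional_def)
    show "\<exists>!x. x \<in> P \<and> (\<forall>i<length As. (ps ! i) x = xs ! i)"
    proof (rule ex1I[of _ "u undefined"])
      show "u undefined \<in> P \<and> (\<forall>i<length As. (ps ! i) (u undefined) = xs ! i)"
        using u c[of _ "u undefined"] unfolding ru[symmetric] by (auto simp: Z_def)
      fix x assume x: "x \<in> P \<and> (\<forall>i<length As. (ps ! i) x = xs ! i)"
      then have "(\<lambda>_\<in>Z. x) \<in> Z \<rightarrow>\<^sub>E P \<and> (\<forall>i<length As. compose Z (ps ! i) (\<lambda>_\<in>Z. x) = fs ! i)"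
        using c by auto
      then have "(\<lambda>_\<in>Z. x) = u" using ex u by blast
      then show "x = u undefined" by (auto simp: Z_def)
    qed
  qed
  have UV: "\<exists>!u. u \<in> Z \<rightarrow>\<^sub>E P \<and> (\<forall>i<length As. compose Z (ps ! i) u = fs ! i)"
    if p: "length ps = length As" "\<forall>i<length As. ps ! i \<in> P \<rightarrow>\<^sub>E As ! i" and U: ?U
    and fs: "length fs = length As" "\<forall>i<length As. fs ! i \<in> Z \<rightarrow>\<^sub>E As ! i" for Z :: "'a set" and fs
  proof -
    have ex: "\<exists>!x. x \<in> P \<and> (\<forall>i<length As. (ps ! i) x = (fs ! i) z)" if z: "z \<in> Z" for z
    proof -
      have "\<exists>!x. x \<in> P \<and> (\<forall>i<length As. (ps ! i) x = map (\<lambda>f. f z) fs ! i)"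
        by (rule U[rule_format]) (use fs z in auto)
      then show ?thesis using fs by (simp cong: conj_cong)
    qed
    define u where "u = (\<lambda>z\<in>Z. THE x. x \<in> P \<and> (\<forall>i<length As. (ps ! i) x = (fs ! i) z))"
    have u: "u z \<in> P \<and> (\<forall>i<length As. (ps ! i) (u z) = (fs ! i) z)" if "z \<in> Z" for z
      unfolding u_def using theI'[OF ex[OF that]] that by simp
    show ?thesis
    proof (rule ex1I[of _ u], intro conjI allI impI)
      show "u \<in> Z \<rightarrow>\<^sub>E P" using u by (intro PiE_I) (auto simp: u_def)
      show "compose Z (ps ! i) u = fs ! i" if "i < length As" for i
        by (rule extensionalityI[of _ Z]) (use u fs that in \<open>auto simp: compose_def PiE_def\<close>)
      fix v assume v: "v \<in> Z \<rightarrow>\<^sub>E P \<and> (\<forall>i<length As. compose Z (ps ! i) v = fs ! i)"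
      show "v = u"
      proof (rule PiE_eqI)
        show "v \<in> Z \<rightarrow>\<^sub>E P" using v by simp
        show "u \<in> Z \<rightarrow>\<^sub>E P" by fact
        fix z assume z: "z \<in> Z"
        have "(ps ! i) (v z) = (fs ! i) z" if "i < length As" for i
          using v that z by (metis compose_eq)
        moreover have "v z \<in> P" using v z by auto
        ultimately show "v z = u z" using ex[OF z] u[OF z] by blast
      qed
    qed
  qed
  have "?V \<longleftrightarrow> ?U" if "length ps = length As" "\<forall>i<length As. ps ! i \<in> P \<rightarrow>\<^sub>E As ! i"
    by (rule iffI[OF VU[OF that]], assumption, intro allI impI, rule UV[OF that])
  then show ?thesis unfolding is_product_iff SET_simps by (simp only: ball_UNIV subset_UNIV UNIV_I simp_thms cong: conj_cong)
qed

section \<open>The classifying category\<close>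

locale eq_presentation =
  fixes E :: "'o pres"
  assumes pres: "presentation E"
begin

lemma derivable_wf: "derivable E \<Theta> n s t \<Longrightarrow> wf_trm E \<Theta> n s \<and> wf_trm E \<Theta> n t"
proof (induction rule: derivable.induct)
  case (d_eqn \<Theta> n s t)
  then show ?case using pres by (auto simp: presentation_def)
qed (auto intro!: wf_emsub)

lemma equiv_deq: "equiv (trms E \<Theta> n) (deq E \<Theta> n)"
  unfolding equiv_def refl_on_def sym_on_def trans_on_def deq_def trms_def
  using derivable_wf by (auto intro: d_refl d_sym d_trans)

lemma tcls_eq_iff:
  assumes "wf_trm E \<Theta> n s" "wf_trm E \<Theta> n t"
  shows "tcls E \<Theta> n s = tcls E \<Theta> n t \<longleftrightarrow> derivable E \<Theta> n s t"
  using eq_equiv_class_iff[OF equiv_deq, of s \<Theta> n t] assms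
  by (auto simp: tcls_def trms_def deq_def)

lemma derivable_rep: "wf_trm E \<Theta> n t \<Longrightarrow> derivable E \<Theta> n t (rep (tcls E \<Theta> n t))"
  unfolding rep_def tcls_def deq_def by (rule someI2[of _ t]) (auto intro: d_refl)

text \<open>
  Morphisms are handled through tuples of representing terms; the lemmas below remove the arbitrary
  choice of representatives made in the definition of composition.
\<close>

definition mor :: "nat list \<Rightarrow> nat list \<Rightarrow> 'o trm list \<Rightarrow> 'o trm set list" where
  "mor \<Theta> ns ts = map2 (tcls E \<Theta>) ns ts"

lemma nth_mor [simp]: "length ts = length ns \<Longrightarrow> i < length ns \<Longrightarrow> mor \<Theta> ns ts ! i = tcls E \<Theta> (ns ! i) (ts ! i)"
  by (simp add: mor_def)

lemma length_mor [simp]: "length ts = length ns \<Longrightarrow> length (mor \<Theta> ns ts) = length ns"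
  by (simp add: mor_def)

lemma hom_MM: "cs \<in> hom (MM E) \<Theta> ns \<longleftrightarrow> (\<exists>ts. wfs E \<Theta> ns ts \<and> cs = mor \<Theta> ns ts)"
proof
  assume "cs \<in> hom (MM E) \<Theta> ns"
  then have l: "length cs = length ns" and q: "\<And>i. i < length ns \<Longrightarrow> cs ! i \<in> trms E \<Theta> (ns ! i) // deq E \<Theta> (ns ! i)"
    by (auto simp: MM_def list_all2_conv_all_nth)
  have "\<exists>t. wf_trm E \<Theta> (ns ! i) t \<and> cs ! i = tcls E \<Theta> (ns ! i) t" if "i < length ns" for i
    using q[OF that] by (auto simp: quotient_def trms_def tcls_def)
  then obtain f where f: "\<And>i. i < length ns \<Longrightarrow> wf_trm E \<Theta> (ns ! i) (f i) \<and> cs ! i = tcls E \<Theta> (ns ! i) (f i)"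
    by metis
  show "\<exists>ts. wfs E \<Theta> ns ts \<and> cs = mor \<Theta> ns ts"
    by (rule exI[of _ "map f [0..<length ns]"]) (use f l in \<open>auto intro!: wfsI nth_equalityI\<close>)
next
  assume "\<exists>ts. wfs E \<Theta> ns ts \<and> cs = mor \<Theta> ns ts"
  then obtain ts where t: "wfs E \<Theta> ns ts" "cs = mor \<Theta> ns ts" by blast
  show "cs \<in> hom (MM E) \<Theta> ns"
    using wfs_length[OF t(1)] wfs_nth[OF t(1)] t(2)
    by (auto simp: MM_def list_all2_conv_all_nth trms_def tcls_def intro!: quotientI)
qed

lemma mor_hom: "wfs E \<Theta> ns ts \<Longrightarrow> mor \<Theta> ns ts \<in> hom (MM E) \<Theta> ns"
  using hom_MM by blast

lemma obj_MM [simp]: "obj (MM E) = UNIV"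
  by (simp add: MM_def)

lemma mor_eqI:
  assumes "wfs E \<Theta> ns ts" "wfs E \<Theta> ns ts'" "\<And>j. j < length ns \<Longrightarrow> derivable E \<Theta> (ns ! j) (ts ! j) (ts' ! j)"
  shows "mor \<Theta> ns ts = mor \<Theta> ns ts'"
  by (rule nth_equalityI)
     (use assms in \<open>auto simp: wfs_length tcls_eq_iff wfs_nth\<close>)

text \<open>
  The case \<open>\<Delta> = \<emptyset>\<close> of the extended metasubstitution rule.
\<close>

lemma derivable_csub:
  assumes "derivable E ms n s t" "wfs E \<Theta> ms ss" "wfs E \<Theta> ms ts"
    "\<And>j. j < length ms \<Longrightarrow> derivable E \<Theta> (ms ! j) (ss ! j) (ts ! j)"
  shows "derivable E \<Theta> n (csub n ss s) (csub n ts t)"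
  using d_msub[OF assms(1) wfs_length[OF assms(2)] wfs_length[OF assms(3)], where d = 0 and \<Theta> = \<Theta>] assms(4)
  by (simp add: emsub_eq_csub[OF conjunct1[OF derivable_wf[OF assms(1)]] assms(2)]
      emsub_eq_csub[OF conjunct2[OF derivable_wf[OF assms(1)]] assms(3)])

lemma wfs_reps: "wfs E \<Theta> ns ts \<Longrightarrow> wfs E \<Theta> ns (map rep (mor \<Theta> ns ts))"
  using derivable_wf[OF derivable_rep[OF wfs_nth]] by (intro wfsI) (auto simp: wfs_length)

text \<open>
  The representatives chosen by \<open>rep\<close> are derivably equal to the given terms, and derivable equality
  is a congruence for metasubstitution.
\<close>

lemma comp_mor:
  assumes t: "wfs E ms ns ts" and s: "wfs E ls ms ss"
  shows "comp (MM E) ls ms ns (mor ms ns ts) (mor ls ms ss) = mor ls ns (map2 (\<lambda>n. csub n ss) ns ts)"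
proof -
  note l = wfs_length[OF t] wfs_length[OF s]
  have "tcls E ls (ns ! i) (emsub (ns ! i) 0 (zip ms (map rep (mor ls ms ss))) (rep (tcls E ms (ns ! i) (ts ! i)))) =
      tcls E ls (ns ! i) (csub (ns ! i) ss (ts ! i))" if i: "i < length ns" for i
  proof -
    note d = derivable_rep[OF wfs_nth[OF t i]]
    have ds: "derivable E ls (ms ! j) (ss ! j) (map rep (mor ls ms ss) ! j)" if "j < length ms" for j
      using derivable_rep[OF wfs_nth[OF s that]] that l by simp
    have "derivable E ls (ns ! i) (csub (ns ! i) ss (ts ! i))
        (csub (ns ! i) (map rep (mor ls ms ss)) (rep (tcls E ms (ns ! i) (ts ! i))))"
      by (rule derivable_csub[OF d s wfs_reps[OF s] ds])
    then show ?thesis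
      using derivable_wf d_sym emsub_eq_csub[OF conjunct2[OF derivable_wf[OF d]] wfs_reps[OF s]]
      by (subst tcls_eq_iff) auto
  qed
  then show ?thesis
    by (intro nth_equalityI) (use l in \<open>auto simp: MM_def mor_def\<close>)
qed

lemma wfs_csub: "wfs E ms ns ts \<Longrightarrow> wfs E ls ms ss \<Longrightarrow> wfs E ls ns (map2 (\<lambda>n. csub n ss) ns ts)"
  by (intro wfsI) (auto simp: wfs_length intro!: wf_csub wfs_nth)

lemma ident_MM: "ident (MM E) ms = mor ms ms (map (gen ms) [0..<length ms])"
  by (rule nth_equalityI) (auto simp: MM_def mor_def gen_def)

lemma category_MM: "category (MM E)"
  unfolding category_def
proof (intro conjI allI impI ballI)
  show "ident (MM E) a \<in> hom (MM E) a a" for a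
    unfolding ident_MM by (rule mor_hom[OF wfs_gen])
next
  fix a b c f g assume "f \<in> hom (MM E) a b" "g \<in> hom (MM E) b c"
  then show "comp (MM E) a b c g f \<in> hom (MM E) a c"
    by (auto simp: hom_MM comp_mor intro: wfs_csub)
next
  fix a b f assume "f \<in> hom (MM E) a b"
  then obtain ts where t: "wfs E a b ts" "f = mor a b ts" by (auto simp: hom_MM)
  note l = wfs_length[OF t(1)]
  have "map2 (\<lambda>n. csub n (map (gen a) [0..<length a])) b ts = ts"
    by (rule nth_equalityI) (use l csub_gens[OF wfs_nth[OF t(1)]] in auto)
  then show "comp (MM E) a a b f (ident (MM E) a) = f"
    by (simp add: t(2) ident_MM comp_mor[OF t(1) wfs_gen])
  have "map2 (\<lambda>n. csub n ts) b (map (gen b) [0..<length b]) = ts"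
    by (rule nth_equalityI) (use l csub_gen[OF t(1)] in auto)
  then show "comp (MM E) a b b (ident (MM E) b) f = f"
    by (simp add: t(2) ident_MM comp_mor[OF wfs_gen t(1)])
next
  fix a b c d f g h assume "f \<in> hom (MM E) a b" "g \<in> hom (MM E) b c" "h \<in> hom (MM E) c d"
  then obtain rs ss ts where t: "wfs E a b rs" "wfs E b c ss" "wfs E c d ts"
    "f = mor a b rs" "g = mor b c ss" "h = mor c d ts" by (auto simp: hom_MM)
  note l = wfs_length[OF t(1)] wfs_length[OF t(2)] wfs_length[OF t(3)]
  have "map2 (\<lambda>n. csub n (map2 (\<lambda>m. csub m rs) c ss)) d ts =
      map2 (\<lambda>n. csub n rs) d (map2 (\<lambda>n. csub n ss) d ts)"
    by (rule nth_equalityI) (use l csub_csub[OF wfs_nth[OF t(3)] t(2,1)] in auto)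
  then show "comp (MM E) a c d h (comp (MM E) a b c g f) = comp (MM E) a b d (comp (MM E) b c d h g) f"
    unfolding t(4-6) comp_mor[OF t(2) t(1)] comp_mor[OF t(3) t(2)]
      comp_mor[OF t(3) wfs_csub[OF t(2,1)]] comp_mor[OF wfs_csub[OF t(3,2)] t(1)] by simp
qed auto

end

text \<open>The projections of a concatenation are obtained by cutting the identity into pieces.\<close>

fun split_by :: "'a list list \<Rightarrow> 'b list \<Rightarrow> 'b list list" where
  "split_by [] xs = []"
| "split_by (a # as) xs = take (length a) xs # split_by as (drop (length a) xs)"

lemma length_split_by [simp]: "length (split_by as xs) = length as"
  by (induction as xs rule: split_by.induct) auto

lemma concat_split_by: "length xs = length (concat as) \<Longrightarrow> concat (split_by as xs) = xs"
  by (induction as xs rule: split_by.induct) auto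

lemma split_by_concat: "list_all2 (\<lambda>a b. length b = length a) as bs \<Longrightarrow> split_by as (concat bs) = bs"
  by (induction rule: list_all2_induct) auto

lemma list_all2_split_by:
  "list_all2 P (concat as) xs \<Longrightarrow> list_all2 (list_all2 P) as (split_by as xs)"
proof (induction as xs rule: split_by.induct)
  case (2 a as xs)
  then obtain u v where "xs = u @ v" "list_all2 P a u" "list_all2 P (concat as) v"
    by (auto simp: list_all2_append1)
  then show ?case using 2 list_all2_lengthD[of P a u] by auto
qed simp

lemma list_all2_concat:
  "list_all2 (list_all2 P) as bs \<Longrightarrow> list_all2 P (concat as) (concat bs)"
  by (induction rule: list_all2_induct) (auto intro: list_all2_appendI)

lemma map2_split_by:
  "length xs = length (concat as) \<Longrightarrow> map2 (map2 f) as (split_by as xs) = split_by as (map2 f (concat as) xs)"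
proof (induction as xs rule: split_by.induct)
  case (2 a as xs)
  have "zip (a @ concat as) xs = zip a (take (length a) xs) @ zip (concat as) (drop (length a) xs)"
    using 2(2) by (simp add: zip_append1)
  then show ?case using 2 by simp
qed simp

context eq_presentation
begin

text \<open>
  Composition with a fixed morphism acts on each component of a tuple separately.  Hence composing
  with the pieces of the identity cuts a tuple into pieces, and cutting is inverse to concatenation.
\<close>

lemma product_MM: "is_product (MM E) as (concat as) (split_by as (ident (MM E) (concat as)))"
proof -
  let ?q = "concat as" and ?id = "ident (MM E) (concat as)"
  define K where "K z u n t = tcls E z n (emsub n 0 (zip ?q (map rep u)) (rep t))" for z :: "nat list" and u n t
  have cK: "comp (MM E) z ?q b f u = map2 (K z u) b f" for z b f u
    by (simp add: MM_def K_def[abs_def])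
  define P where "P z n c \<longleftrightarrow> c \<in> trms E z n // deq E z n" for z n c
  have hP: "f \<in> hom (MM E) z b \<longleftrightarrow> list_all2 (P z) b f" for z b f
    by (simp add: MM_def P_def[abs_def])
  have id: "?id \<in> hom (MM E) ?q ?q" by (rule category_ident[OF category_MM]) simp
  have comp_split: "map2 (\<lambda>a \<pi>. comp (MM E) z ?q a \<pi> u) as (split_by as ?id) = split_by as u"
    if u: "u \<in> hom (MM E) z ?q" for z u
  proof -
    have "map2 (map2 (K z u)) as (split_by as ?id) = split_by as (map2 (K z u) ?q ?id)"
      by (rule map2_split_by) (use id hP list_all2_lengthD in metis)
    also have "map2 (K z u) ?q ?id = u" using category_ident_left[OF category_MM u] by (simp add: cK)
    finally show ?thesis by (simp add: cK)
  qed
  show ?thesis unfolding is_product_def hP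
  proof (intro conjI ballI allI impI)
    show "list_all2 (list_all2 (P ?q)) as (split_by as ?id)" using id unfolding hP by (rule list_all2_split_by)
    fix z fs assume fs: "list_all2 (list_all2 (P z)) as fs"
    have sc: "split_by as (concat fs) = fs"
      by (rule split_by_concat) (use fs in \<open>auto elim!: list_all2_mono dest: list_all2_lengthD\<close>)
    show "\<exists>!u. list_all2 (P z) ?q u \<and> map2 (\<lambda>a \<pi>. comp (MM E) z ?q a \<pi> u) as (split_by as ?id) = fs"
    proof (rule ex1I[of _ "concat fs"], intro conjI)
      show "list_all2 (P z) ?q (concat fs)" using fs by (rule list_all2_concat)
      then show "map2 (\<lambda>a \<pi>. comp (MM E) z ?q a \<pi> (concat fs)) as (split_by as ?id) = fs"
        using comp_split[of "concat fs" z] sc by (simp add: hP)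
      fix u assume u: "list_all2 (P z) ?q u \<and> map2 (\<lambda>a \<pi>. comp (MM E) z ?q a \<pi> u) as (split_by as ?id) = fs"
      then have "split_by as u = fs" using comp_split[of u z] by (simp add: hP)
      then show "u = concat fs" using concat_split_by[of u as] u by (metis list_all2_lengthD)
    qed
  qed auto
qed

end

section \<open>Abstract clones with operators\<close>

text \<open>
  A \<open>\<Sigma>\<close>-model in elementary terms: \<open>S n\<close> are the elements in context \<open>n\<close>, \<open>v n i\<close> the variables,
  \<open>s m n a b\<close> is \<open>a\<close> in context \<open>m\<close> with the \<open>m\<close>-tuple \<open>b\<close> of elements in context \<open>n\<close> substituted,
  and \<open>opn\<close> interprets the operators.  Renaming is the special case of substituting variables, so that
  the functoriality and naturality conditions of a model disappear.  The environment \<open>lift_env v s n p b\<close>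
  is \<open>b\<close> under a binder of \<open>p\<close> variables: weakened to \<open>n + p\<close>, and followed by the new variables.
\<close>

definition lift_env :: "(nat \<Rightarrow> nat \<Rightarrow> 'u) \<Rightarrow> (nat \<Rightarrow> nat \<Rightarrow> 'u \<Rightarrow> 'u list \<Rightarrow> 'u) \<Rightarrow> nat \<Rightarrow> nat \<Rightarrow> 'u list \<Rightarrow> 'u list" where
  "lift_env v s n p b = map (\<lambda>x. s n (n + p) x (map (v (n + p)) [0..<n])) b @ map (v (n + p)) [n..<n + p]"

locale op_clone = eq_presentation E for E :: "'o pres" +
  fixes S :: "nat \<Rightarrow> 'u set"
    and v :: "nat \<Rightarrow> nat \<Rightarrow> 'u"
    and s :: "nat \<Rightarrow> nat \<Rightarrow> 'u \<Rightarrow> 'u list \<Rightarrow> 'u"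
    and opn :: "nat \<Rightarrow> 'o \<Rightarrow> 'u list \<Rightarrow> 'u"
  assumes v_in: "i < n \<Longrightarrow> v n i \<in> S n"
    and s_in: "a \<in> S m \<Longrightarrow> length b = m \<Longrightarrow> set b \<subseteq> S n \<Longrightarrow> s m n a b \<in> S n"
    and opn_in: "w \<in> ops E \<Longrightarrow> list_all2 (\<lambda>p a. a \<in> S (n + p)) (arity E w) as \<Longrightarrow> opn n w as \<in> S n"
    and s_v: "length b = m \<Longrightarrow> set b \<subseteq> S n \<Longrightarrow> i < m \<Longrightarrow> s m n (v m i) b = b ! i"
    and s_vs: "a \<in> S n \<Longrightarrow> s n n a (map (v n) [0..<n]) = a"
    and s_s: "a \<in> S k \<Longrightarrow> length b = k \<Longrightarrow> set b \<subseteq> S m \<Longrightarrow> length c = m \<Longrightarrow> set c \<subseteq> S n \<Longrightarrow>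
       s m n (s k m a b) c = s k n a (map (\<lambda>x. s m n x c) b)"
    and s_opn: "w \<in> ops E \<Longrightarrow> list_all2 (\<lambda>p a. a \<in> S (m + p)) (arity E w) as \<Longrightarrow> length b = m \<Longrightarrow> set b \<subseteq> S n \<Longrightarrow>
       s m n (opn m w as) b = opn n w (map2 (\<lambda>p a. s (m + p) (n + p) a (lift_env v s n p b)) (arity E w) as)"
begin

abbreviation "lft \<equiv> lift_env v s"

definition vars :: "nat \<Rightarrow> nat \<Rightarrow> 'u list" where
  "vars n m = map (v m) [0..<n]"

definition env :: "nat \<Rightarrow> nat \<Rightarrow> 'u list \<Rightarrow> bool" where
  "env m n b \<longleftrightarrow> length b = m \<and> set b \<subseteq> S n"

text \<open>
  Environments are the morphisms of a category, with identities \<open>vars n n\<close>, in which \<open>cmp m n c b\<close> is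
  \<open>b\<close> followed by \<open>c\<close>.  Its laws \<open>cmp_assoc\<close> and \<open>lft_cmp\<close> (lifting is functorial) replace explicit
  computations with indices in what follows.
\<close>

definition cmp :: "nat \<Rightarrow> nat \<Rightarrow> 'u list \<Rightarrow> 'u list \<Rightarrow> 'u list" where
  "cmp m n c b = map (\<lambda>x. s m n x c) b"

lemma env_len: "env m n b \<Longrightarrow> length b = m" by (simp add: env_def)
lemma env_nth: "env m n b \<Longrightarrow> i < m \<Longrightarrow> b ! i \<in> S n" by (auto simp: env_def)
lemma envI: "length b = m \<Longrightarrow> (\<And>i. i < m \<Longrightarrow> b ! i \<in> S n) \<Longrightarrow> env m n b"
  by (auto simp: env_def in_set_conv_nth)

lemma env_vars: "n \<le> m \<Longrightarrow> env n m (vars n m)"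
  by (auto simp: env_def vars_def intro: v_in)

lemma length_vars [simp]: "length (vars n m) = n" by (simp add: vars_def)
lemma nth_vars [simp]: "i < n \<Longrightarrow> vars n m ! i = v m i" by (simp add: vars_def)

lemma s_env: "a \<in> S m \<Longrightarrow> env m n b \<Longrightarrow> s m n a b \<in> S n" by (simp add: env_def s_in)

lemma env_cmp: "env k m b \<Longrightarrow> env m n c \<Longrightarrow> env k n (cmp m n c b)"
  unfolding cmp_def by (rule envI) (auto simp: env_len env_nth intro!: s_env)

lemma length_cmp [simp]: "length (cmp m n c b) = length b" by (simp add: cmp_def)

lemma nth_cmp: "i < length b \<Longrightarrow> cmp m n c b ! i = s m n (b ! i) c" by (simp add: cmp_def)

lemma s_cmp: "a \<in> S k \<Longrightarrow> env k m b \<Longrightarrow> env m n c \<Longrightarrow> s m n (s k m a b) c = s k n a (cmp m n c b)"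
  by (simp add: env_def s_s cmp_def)

lemma cmp_assoc: "env k m b \<Longrightarrow> env m n c \<Longrightarrow> env n l d \<Longrightarrow> cmp n l d (cmp m n c b) = cmp m l (cmp n l d c) b"
  by (rule nth_equalityI) (auto simp: nth_cmp env_len s_cmp env_nth)

lemma lft_eq: "lft n p b = cmp n (n + p) (vars n (n + p)) b @ map (v (n + p)) [n..<n + p]"
  by (simp add: lift_env_def cmp_def vars_def)

lemma nth_lft: "i < length b + p \<Longrightarrow>
    lft n p b ! i = (if i < length b then s n (n + p) (b ! i) (vars n (n + p)) else v (n + p) (n + (i - length b)))"
  by (auto simp: lift_env_def vars_def nth_append)

lemma length_lft [simp]: "length (lft n p b) = length b + p"
  by (simp add: lift_env_def)

lemma env_lft: "env m n b \<Longrightarrow> env (m + p) (n + p) (lft n p b)"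
  using env_cmp[of m n b "n + p" "vars n (n + p)"] env_vars[of n "n + p"]
  by (auto simp: lft_eq env_def v_in)

lemma s_vars: "env m n b \<Longrightarrow> i < m \<Longrightarrow> s m n (v m i) b = b ! i"
  by (simp add: env_def s_v)

lemma cmp_vars: "env m n c \<Longrightarrow> k \<le> m \<Longrightarrow> cmp m n c (vars k m) = take k c"
  by (rule nth_equalityI) (auto simp: cmp_def s_vars env_len)

lemma vars_cmp: "env m n b \<Longrightarrow> cmp n n (vars n n) b = b"
  by (rule nth_equalityI) (auto simp: cmp_def env_nth env_len s_vs vars_def)

lemma cmp_vars_lft:
  assumes "env m n c"
  shows "cmp (m + p) (n + p) (lft n p c) (vars m (m + p)) = cmp n (n + p) (vars n (n + p)) c"
  by (subst cmp_vars[OF env_lft[OF assms]]) (simp_all add: lft_eq env_len[OF assms])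

lemma cmp_append: "cmp m n c (b @ b') = cmp m n c b @ cmp m n c b'"
  by (simp add: cmp_def)

lemma cmp_lft_vars:
  assumes "env m n c"
  shows "cmp (m + p) (n + p) (lft n p c) (map (v (m + p)) [m..<m + p]) = map (v (n + p)) [n..<n + p]"
  by (rule nth_equalityI)
     (auto simp: cmp_def s_vars[OF env_lft[OF assms]], simp add: lft_eq nth_append env_len[OF assms])

lemma lft_cmp:
  assumes "env k m b" "env m n c"
  shows "lft n p (cmp m n c b) = cmp (m + p) (n + p) (lft n p c) (lft m p b)"
proof -
  have "cmp (m + p) (n + p) (lft n p c) (cmp m (m + p) (vars m (m + p)) b) =
      cmp n (n + p) (vars n (n + p)) (cmp m n c b)"
    using cmp_assoc[OF assms(1) env_vars[OF le_add1] env_lft[OF assms(2)]]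
      cmp_assoc[OF assms env_vars[OF le_add1]] cmp_vars_lft[OF assms(2)] by simp
  then show ?thesis
    unfolding lft_eq[of m] lft_eq[of n p "cmp m n c b"] cmp_append cmp_lft_vars[OF assms(2)] by simp
qed

lemma lft_vars: "lft n p (vars n n) = vars (n + p) (n + p)"
  unfolding lft_eq cmp_vars[OF env_vars[of n "n + p", simplified] order_refl]
  by (rule nth_equalityI) (auto simp: nth_append)

text \<open>
  An interpretation of the metavariables \<open>\<Theta>\<close> at stage \<open>k\<close> is an element of \<open>\<Prod>\<^sub>j S (k + m\<^sub>j)\<close>.
  Environments act on these by \<open>msb\<close>, which leaves the last \<open>m\<^sub>j\<close> variables alone; \<open>mwk\<close> is the
  action of the weakening \<open>k \<subseteq> k + p\<close>, needed under binders.
\<close>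

definition menv :: "nat list \<Rightarrow> nat \<Rightarrow> 'u list \<Rightarrow> bool" where
  "menv \<Theta> k \<theta> \<longleftrightarrow> length \<theta> = length \<Theta> \<and> (\<forall>j<length \<Theta>. \<theta> ! j \<in> S (k + \<Theta> ! j))"

definition msb :: "nat list \<Rightarrow> nat \<Rightarrow> nat \<Rightarrow> 'u list \<Rightarrow> 'u list \<Rightarrow> 'u list" where
  "msb \<Theta> k l c \<theta> = map2 (\<lambda>m x. s (k + m) (l + m) x (lft l m c)) \<Theta> \<theta>"

lemma menv_len: "menv \<Theta> k \<theta> \<Longrightarrow> length \<theta> = length \<Theta>" by (simp add: menv_def)
lemma menv_nth: "menv \<Theta> k \<theta> \<Longrightarrow> j < length \<Theta> \<Longrightarrow> \<theta> ! j \<in> S (k + \<Theta> ! j)" by (simp add: menv_def)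

lemma nth_msb: "menv \<Theta> k \<theta> \<Longrightarrow> j < length \<Theta> \<Longrightarrow>
    msb \<Theta> k l c \<theta> ! j = s (k + \<Theta> ! j) (l + \<Theta> ! j) (\<theta> ! j) (lft l (\<Theta> ! j) c)"
  by (simp add: msb_def menv_len)

lemma length_msb: "menv \<Theta> k \<theta> \<Longrightarrow> length (msb \<Theta> k l c \<theta>) = length \<Theta>"
  by (simp add: msb_def menv_len)

lemma menv_msb: "menv \<Theta> k \<theta> \<Longrightarrow> env k l c \<Longrightarrow> menv \<Theta> l (msb \<Theta> k l c \<theta>)"
  unfolding menv_def using nth_msb[of \<Theta> k \<theta>]
  by (auto simp: msb_def menv_def intro!: s_env env_lft)

lemma msb_msb:
  assumes "menv \<Theta> k \<theta>" "env k l b" "env l m c"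
  shows "msb \<Theta> l m c (msb \<Theta> k l b \<theta>) = msb \<Theta> k m (cmp l m c b) \<theta>"
  by (rule nth_equalityI)
     (use assms in \<open>auto simp: nth_msb[OF menv_msb[OF assms(1,2)]] nth_msb[OF assms(1)]
        length_msb[OF assms(1)] length_msb[OF menv_msb[OF assms(1,2)]]
        s_cmp[OF menv_nth[OF assms(1)] env_lft env_lft] lft_cmp\<close>)

lemma msb_vars: "menv \<Theta> k \<theta> \<Longrightarrow> msb \<Theta> k k (vars k k) \<theta> = \<theta>"
  by (rule nth_equalityI)
     (auto simp: nth_msb lft_vars length_msb menv_len s_vs[folded vars_def] menv_nth)

definition mwk :: "nat list \<Rightarrow> nat \<Rightarrow> nat \<Rightarrow> 'u list \<Rightarrow> 'u list" where
  "mwk \<Theta> k p \<theta> = msb \<Theta> k (k + p) (vars k (k + p)) \<theta>"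

lemma menv_mwk: "menv \<Theta> k \<theta> \<Longrightarrow> menv \<Theta> (k + p) (mwk \<Theta> k p \<theta>)"
  unfolding mwk_def by (rule menv_msb) (auto intro: env_vars)

lemma msb_mwk:
  assumes "menv \<Theta> k \<theta>" "env k l c"
  shows "msb \<Theta> (k + p) (l + p) (lft l p c) (mwk \<Theta> k p \<theta>) = mwk \<Theta> l p (msb \<Theta> k l c \<theta>)"
  using assms unfolding mwk_def
  by (simp add: msb_msb[OF assms(1) env_vars env_lft] msb_msb[OF assms env_vars] cmp_vars_lft)

text \<open>
  Evaluation of a term in context \<open>n\<close> at stage \<open>k\<close>, for an interpretation \<open>\<theta>\<close> of the
  metavariables and an arbitrary environment \<open>e : env n k\<close>.  The interpretation in a model is
  the case where \<open>e\<close> consists of variables; allowing all environments turns the substitution lemmas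
  below into statements that can be proved by induction on terms.
\<close>

fun ev :: "nat list \<Rightarrow> nat \<Rightarrow> 'u list \<Rightarrow> 'u list \<Rightarrow> 'o trm \<Rightarrow> 'u" where
  "ev \<Theta> k \<theta> e (Var i) = e ! i"
| "ev \<Theta> k \<theta> e (MVar j ts) = s (k + \<Theta> ! j) k (\<theta> ! j) (vars k k @ map (ev \<Theta> k \<theta> e) ts)"
| "ev \<Theta> k \<theta> e (Op w as) = opn k w (map (\<lambda>(p, t). ev \<Theta> (k + p) (mwk \<Theta> k p \<theta>) (lft k p e) t) as)"

lemma list_all2_map_arity:
  assumes "map fst as = ar" "\<And>p t. (p, t) \<in> set as \<Longrightarrow> P p (f p t)"
  shows "list_all2 P ar (map (\<lambda>(p, t). f p t) as)"
  unfolding assms(1)[symmetric] using assms(2) by (auto simp: list_all2_map1 list_all2_map2 intro!: list.rel_refl_strong)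

lemma ev_in:
  assumes "wf_trm E \<Theta> n t" "menv \<Theta> k \<theta>" "env n k e"
  shows "ev \<Theta> k \<theta> e t \<in> S k"
  using assms
proof (induction arbitrary: k \<theta> e rule: wf_trm.induct)
  case (wf_MVar j ts n)
  have "env (k + \<Theta> ! j) k (vars k k @ map (ev \<Theta> k \<theta> e) ts)"
    using wf_MVar env_vars[of k k] by (auto simp: env_def)
  then show ?case using wf_MVar by (auto intro: s_env menv_nth)
next
  case (wf_Op w as n)
  show ?case unfolding ev.simps
    by (rule opn_in[OF wf_Op.hyps(1) list_all2_map_arity[OF wf_Op.hyps(2)]])
       (rule wf_Op.IH[OF _ menv_mwk[OF wf_Op.prems(1)] env_lft[OF wf_Op.prems(2)]])
qed (auto simp: env_nth)

lemma env_evs: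
  assumes "wf_trm E \<Theta> n (MVar j ts)" "menv \<Theta> k \<theta>" "env n k e"
  shows "env (k + \<Theta> ! j) k (vars k k @ map (ev \<Theta> k \<theta> e) ts)"
  using assms(1) ev_in[OF _ assms(2,3)] env_vars[of k k]
  by (auto simp: env_def elim: wf_trm.cases)

lemma map_arity_cong:
  assumes "\<And>p t. (p, t) \<in> set as \<Longrightarrow> f p t = g p t"
  shows "map (\<lambda>(p, t). f p t) as = map (\<lambda>(p, t). g p t) as"
  using assms by auto

lemma map2_arity:
  assumes "map fst as = ar"
  shows "map2 g ar (map (\<lambda>(p, t). f p t) as) = map (\<lambda>(p, t). g p (f p t)) as"
  unfolding assms[symmetric] by (induction as) auto

text \<open>
  Substitution into the value of a term can be moved to its environment and to the interpretation of
  its metavariables.  At a metavariable, both sides are substitutions into \<open>\<theta> ! j\<close> of the same composite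
  environment; at an operator, the claim is the axiom \<open>s_opn\<close> and the functoriality of lifting.
\<close>

lemma s_ev:
  assumes "wf_trm E \<Theta> n t" "menv \<Theta> k \<theta>" "env n k e" "env k l c"
  shows "s k l (ev \<Theta> k \<theta> e t) c = ev \<Theta> l (msb \<Theta> k l c \<theta>) (cmp k l c e) t"
  using assms
proof (induction arbitrary: k l c \<theta> e rule: wf_trm.induct)
  case (wf_Var i n)
  then show ?case by (simp add: cmp_def env_len)
next
  case (wf_MVar j ts n)
  let ?m = "\<Theta> ! j" and ?E = "vars k k @ map (ev \<Theta> k \<theta> e) ts"
  let ?E' = "vars l l @ map (ev \<Theta> l (msb \<Theta> k l c \<theta>) (cmp k l c e)) ts"
  note p = wf_MVar.prems
  have w: "wf_trm E \<Theta> n (MVar j ts)" using wf_MVar.hyps by (rule wf_trm.wf_MVar)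
  note env = env_evs[OF w p(1,2)] and env' = env_evs[OF w menv_msb[OF p(1,3)] env_cmp[OF p(2,3)]]
  have th: "\<theta> ! j \<in> S (k + ?m)" using p wf_MVar.hyps menv_nth by blast
  have ts: "map (\<lambda>t. s k l (ev \<Theta> k \<theta> e t) c) ts = map (ev \<Theta> l (msb \<Theta> k l c \<theta>) (cmp k l c e)) ts"
    using wf_MVar.IH[OF _ p] by auto
  have "s k l (ev \<Theta> k \<theta> e (MVar j ts)) c = s (k + ?m) l (\<theta> ! j) (cmp k l c ?E)"
    using s_cmp[OF th env p(3)] by simp
  also have "cmp k l c ?E = c @ map (ev \<Theta> l (msb \<Theta> k l c \<theta>) (cmp k l c e)) ts"
    using cmp_vars[OF p(3) order_refl] env_len[OF p(3)] ts by (simp add: cmp_append) (simp add: cmp_def comp_def)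
  also have "\<dots> = cmp (l + ?m) l ?E' (lft l ?m c)"
  proof -
    have "cmp (l + ?m) l ?E' (cmp l (l + ?m) (vars l (l + ?m)) c) = c"
      using cmp_assoc[OF p(3) env_vars env'] cmp_vars[OF env', of l] vars_cmp[OF p(3)] by simp
    moreover have "cmp (l + ?m) l ?E' (map (v (l + ?m)) [l..<l + ?m]) = map (ev \<Theta> l (msb \<Theta> k l c \<theta>) (cmp k l c e)) ts"
      by (rule nth_equalityI) (use wf_MVar.hyps in \<open>auto simp: nth_cmp s_vars[OF env'] nth_append\<close>)
    ultimately show ?thesis by (simp add: lft_eq cmp_append)
  qed
  also have "s (k + ?m) l (\<theta> ! j) \<dots> = ev \<Theta> l (msb \<Theta> k l c \<theta>) (cmp k l c e) (MVar j ts)"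
    using s_cmp[OF th env_lft[OF p(3)] env'] nth_msb[OF p(1) wf_MVar.hyps(1)] by simp
  finally show ?case .
next
  case (wf_Op w as n)
  note p = wf_Op.prems
  have la: "list_all2 (\<lambda>p a. a \<in> S (k + p)) (arity E w)
      (map (\<lambda>(p, t). ev \<Theta> (k + p) (mwk \<Theta> k p \<theta>) (lft k p e) t) as)"
    by (rule list_all2_map_arity[OF wf_Op.hyps(2)])
       (rule ev_in[OF wf_Op.hyps(3) menv_mwk[OF p(1)] env_lft[OF p(2)]])
  have "s (k + q) (l + q) (ev \<Theta> (k + q) (mwk \<Theta> k q \<theta>) (lft k q e) t) (lft l q c) =
     ev \<Theta> (l + q) (mwk \<Theta> l q (msb \<Theta> k l c \<theta>)) (lft l q (cmp k l c e)) t" if "(q, t) \<in> set as" for q t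
    using wf_Op.IH[OF that menv_mwk[OF p(1)] env_lft[OF p(2)] env_lft[OF p(3)]]
    by (simp add: msb_mwk[OF p(1,3)] lft_cmp[OF p(2,3)])
  then show ?case unfolding ev.simps s_opn[OF wf_Op.hyps(1) la env_len[OF p(3)] p(3)[unfolded env_def, THEN conjunct2]]
      map2_arity[OF wf_Op.hyps(2)] by (auto cong: map_arity_cong)
qed

lemma ev_ren:
  assumes "wf_trm E \<Theta> m t" "menv \<Theta> k \<theta>" "env n k e" "\<And>i. i < m \<Longrightarrow> f i < n"
  shows "ev \<Theta> k \<theta> e (ren m n f t) = ev \<Theta> k \<theta> (map (\<lambda>i. e ! f i) [0..<m]) t"
  using assms
proof (induction arbitrary: k \<theta> e n f rule: wf_trm.induct)
  case (wf_MVar j ts m)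
  have "map (ev \<Theta> k \<theta> e) (map (ren m n f) ts) = map (ev \<Theta> k \<theta> (map (\<lambda>i. e ! f i) [0..<m])) ts"
    using wf_MVar.IH[OF _ wf_MVar.prems] by auto
  then show ?case by (simp del: map_map)
next
  case (wf_Op w as m)
  note p = wf_Op.prems
  have "ev \<Theta> (k + q) (mwk \<Theta> k q \<theta>) (lft k q e) (ren (m + q) (n + q) (fplus m n f q) t) =
      ev \<Theta> (k + q) (mwk \<Theta> k q \<theta>) (lft k q (map (\<lambda>i. e ! f i) [0..<m])) t" if "(q, t) \<in> set as" for q t
  proof -
    have "ev \<Theta> (k + q) (mwk \<Theta> k q \<theta>) (lft k q e) (ren (m + q) (n + q) (fplus m n f q) t) =
       ev \<Theta> (k + q) (mwk \<Theta> k q \<theta>) (map (\<lambda>i. lft k q e ! fplus m n f q i) [0..<m + q]) t"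
      by (rule wf_Op.IH[OF that menv_mwk[OF p(1)] env_lft[OF p(2)]]) (auto simp: fplus_def p trans_less_add1)
    also have "map (\<lambda>i. lft k q e ! fplus m n f q i) [0..<m + q] = lft k q (map (\<lambda>i. e ! f i) [0..<m])"
      by (rule nth_equalityI)
         (auto simp: fplus_def nth_lft env_len[OF p(2)] p(3) trans_less_add1)
    finally show ?thesis .
  qed
  then show ?case by (auto simp: case_prod_beta intro!: arg_cong[where f = "opn k w"])
qed auto

lemma ev_weaken:
  assumes "wf_trm E \<Theta> n t" "menv \<Theta> k \<theta>" "env n k e"
  shows "ev \<Theta> (k + p) (mwk \<Theta> k p \<theta>) (lft k p e) (ren n (n + p) id t) =
     s k (k + p) (ev \<Theta> k \<theta> e t) (vars k (k + p))"
proof -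
  have "ev \<Theta> (k + p) (mwk \<Theta> k p \<theta>) (lft k p e) (ren n (n + p) id t) =
      ev \<Theta> (k + p) (mwk \<Theta> k p \<theta>) (map (\<lambda>i. lft k p e ! id i) [0..<n]) t"
    by (rule ev_ren[OF assms(1) menv_mwk[OF assms(2)] env_lft[OF assms(3)]]) auto
  also have "map (\<lambda>i. lft k p e ! id i) [0..<n] = cmp k (k + p) (vars k (k + p)) e"
    by (rule nth_equalityI) (auto simp: nth_lft nth_cmp env_len[OF assms(3)])
  finally show ?thesis using s_ev[OF assms env_vars[OF le_add1]] by (simp add: mwk_def id_def)
qed

lemma env_map_ev:
  assumes "menv \<Theta> k \<theta>" "env n k e" "\<And>t. t \<in> set \<sigma> \<Longrightarrow> wf_trm E \<Theta> n t" "length \<sigma> = m"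
  shows "env m k (map (ev \<Theta> k \<theta> e) \<sigma>)"
  using assms ev_in by (auto simp: env_def)

lemma ev_sub:
  assumes "wf_trm E \<Theta> m t" "menv \<Theta> k \<theta>" "env n k e" "length \<sigma> = m" "\<And>s. s \<in> set \<sigma> \<Longrightarrow> wf_trm E \<Theta> n s"
  shows "ev \<Theta> k \<theta> e (sub n \<sigma> t) = ev \<Theta> k \<theta> (map (ev \<Theta> k \<theta> e) \<sigma>) t"
  using assms
proof (induction arbitrary: k \<theta> e n \<sigma> rule: wf_trm.induct)
  case (wf_MVar j ts m)
  have "map (ev \<Theta> k \<theta> e) (map (sub n \<sigma>) ts) = map (ev \<Theta> k \<theta> (map (ev \<Theta> k \<theta> e) \<sigma>)) ts"
    using wf_MVar.IH[OF _ wf_MVar.prems] by auto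
  then show ?case by (simp del: map_map)
next
  case (wf_Op w as m)
  note p = wf_Op.prems
  have "ev \<Theta> (k + q) (mwk \<Theta> k q \<theta>) (lft k q e) (sub (n + q) (lift_sub n q \<sigma>) t) =
      ev \<Theta> (k + q) (mwk \<Theta> k q \<theta>) (lft k q (map (ev \<Theta> k \<theta> e) \<sigma>)) t" if "(q, t) \<in> set as" for q t
  proof -
    have "ev \<Theta> (k + q) (mwk \<Theta> k q \<theta>) (lft k q e) (sub (n + q) (lift_sub n q \<sigma>) t) =
       ev \<Theta> (k + q) (mwk \<Theta> k q \<theta>) (map (ev \<Theta> (k + q) (mwk \<Theta> k q \<theta>) (lft k q e)) (lift_sub n q \<sigma>)) t"
      by (rule wf_Op.IH[OF that menv_mwk[OF p(1)] env_lft[OF p(2)]])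
         (auto simp: p intro: wf_lift_sub[of \<sigma>])
    also have "map (ev \<Theta> (k + q) (mwk \<Theta> k q \<theta>) (lft k q e)) (lift_sub n q \<sigma>) = lft k q (map (ev \<Theta> k \<theta> e) \<sigma>)"
      by (rule nth_equalityI)
         (auto simp: nth_lift_sub ev_weaken[OF p(4) p(1,2)] nth_lft env_len[OF p(2)])
    finally show ?thesis .
  qed
  then show ?case unfolding sub_Op by (auto simp: case_prod_beta intro!: arg_cong[where f = "opn k w"])
qed auto

text \<open>
  The interpretation of the metavariables under which a term has the value of its
  metasubstitution instance: the value of \<open>s\<^sub>j\<close>, with the bound variables \<open>y\<^sub>1,\<dots>,y\<^bsub>m\<^sub>j\<^esub>\<close> interpreted
  by fresh variables.
\<close>

definition mev :: "nat list \<Rightarrow> nat list \<Rightarrow> nat \<Rightarrow> 'u list \<Rightarrow> 'u list \<Rightarrow> 'o trm list \<Rightarrow> 'u list" where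
  "mev \<Theta> ms k \<theta> e ss = map2 (\<lambda>m t. ev \<Theta> (k + m) (mwk \<Theta> k m \<theta>) (lft k m e) t) ms ss"

lemma nth_mev: "length ss = length ms \<Longrightarrow> j < length ms \<Longrightarrow>
    mev \<Theta> ms k \<theta> e ss ! j = ev \<Theta> (k + ms ! j) (mwk \<Theta> k (ms ! j) \<theta>) (lft k (ms ! j) e) (ss ! j)"
  by (simp add: mev_def)

lemma menv_mev:
  assumes "menv \<Theta> k \<theta>" "env n k e" "length ss = length ms"
    "\<And>j. j < length ms \<Longrightarrow> wf_trm E \<Theta> (n + ms ! j) (ss ! j)"
  shows "menv ms k (mev \<Theta> ms k \<theta> e ss)"
  unfolding menv_def
  by (auto simp: nth_mev assms(3) intro!: ev_in[OF assms(4)] menv_mwk assms(1) env_lft assms(2))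
     (simp add: mev_def assms(3))

text \<open>
  At a metavariable, \<open>ev_sub\<close> yields the value of \<open>s\<^sub>j\<close> in the environment \<open>e\<close> extended by the values of
  the arguments.  By \<open>s_ev\<close>, the same value results from evaluating \<open>s\<^sub>j\<close> with fresh variables for
  \<open>y\<^sub>1,\<dots>,y\<^bsub>m\<^sub>j\<^esub>\<close> and substituting the arguments afterwards.
\<close>

lemma ev_msub:
  assumes "wf_trm E ms n t" "menv \<Theta> k \<theta>" "env n k e" "length \<phi> = length ms"
    "\<And>j. j < length ms \<Longrightarrow> fst (\<phi> ! j) = ms ! j \<and> wf_trm E \<Theta> (n + ms ! j) (snd (\<phi> ! j))"
  shows "ev \<Theta> k \<theta> e (msub n \<phi> t) = ev ms k (mev \<Theta> ms k \<theta> e (map snd \<phi>)) e t"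
  using assms
proof (induction arbitrary: k \<theta> e \<phi> rule: wf_trm.induct)
  case (wf_MVar j ts n)
  note p = wf_MVar.prems
  let ?m = "ms ! j" and ?\<theta> = "mev \<Theta> ms k \<theta> e (map snd \<phi>)"
  have sj: "wf_trm E \<Theta> (n + ?m) (snd (\<phi> ! j))" using p(4) wf_MVar.hyps(1) by blast
  have wts: "wf_trm E \<Theta> n t" if "t \<in> set (map (msub n \<phi>) ts)" for t
    using that wf_msub[OF wf_MVar.hyps(3) p(3,4)] by auto
  have ts: "map (ev \<Theta> k \<theta> e) (map (msub n \<phi>) ts) = map (ev ms k ?\<theta> e) ts"
    using wf_MVar.IH[OF _ p] by auto
  have ets: "env ?m k (map (ev ms k ?\<theta> e) ts)"
    using env_map_ev[OF p(1,2), where m = ?m and \<sigma> = "map (msub n \<phi>) ts"] wts ts wf_MVar.hyps(2)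
    by (simp del: map_map)
  let ?F = "vars k k @ map (ev ms k ?\<theta> e) ts"
  have F: "env (k + ?m) k ?F" using ets env_vars[of k k] by (auto simp: env_def)
  have "ev \<Theta> k \<theta> e (msub n \<phi> (MVar j ts)) =
     ev \<Theta> k \<theta> (map (ev \<Theta> k \<theta> e) (map Var [0..<n] @ map (msub n \<phi>) ts)) (snd (\<phi> ! j))"
    unfolding msub.simps
    by (rule ev_sub[OF sj p(1,2)]) (use wts wf_MVar.hyps in \<open>auto intro: wf_trm.intros\<close>)
  also have "map (ev \<Theta> k \<theta> e) (map Var [0..<n] @ map (msub n \<phi>) ts) = e @ map (ev ms k ?\<theta> e) ts"
    using ts env_len[OF p(2)] by (auto simp: comp_def intro!: nth_equalityI)
  finally have 1: "ev \<Theta> k \<theta> e (msub n \<phi> (MVar j ts)) = ev \<Theta> k \<theta> (e @ map (ev ms k ?\<theta> e) ts) (snd (\<phi> ! j))" .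
  have 2: "e @ map (ev ms k ?\<theta> e) ts = cmp (k + ?m) k ?F (lft k ?m e)"
  proof -
    have "cmp (k + ?m) k ?F (cmp k (k + ?m) (vars k (k + ?m)) e) = e"
      using cmp_assoc[OF p(2) env_vars F] cmp_vars[OF F, of k] vars_cmp[OF p(2)] by simp
    moreover have "cmp (k + ?m) k ?F (map (v (k + ?m)) [k..<k + ?m]) = map (ev ms k ?\<theta> e) ts"
      by (rule nth_equalityI) (use wf_MVar.hyps in \<open>auto simp: nth_cmp s_vars[OF F] nth_append\<close>)
    ultimately show ?thesis by (simp add: lft_eq cmp_append)
  qed
  have 3: "msb \<Theta> (k + ?m) k ?F (mwk \<Theta> k ?m \<theta>) = \<theta>"
    unfolding mwk_def using msb_msb[OF p(1) env_vars F] cmp_vars[OF F, of k] msb_vars[OF p(1)] by simp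
  have "ev \<Theta> k \<theta> e (msub n \<phi> (MVar j ts)) = 
      s (k + ?m) k (ev \<Theta> (k + ?m) (mwk \<Theta> k ?m \<theta>) (lft k ?m e) (snd (\<phi> ! j))) ?F"
    unfolding 1 2 using s_ev[OF sj menv_mwk[OF p(1)] env_lft[OF p(2)] F] unfolding 3 by simp
  also have "\<dots> = ev ms k ?\<theta> e (MVar j ts)"
    using wf_MVar.hyps(1) p(3) by (simp add: nth_mev)
  finally show ?case .
next
  case (wf_Op w as n)
  note p = wf_Op.prems
  define \<psi> where "\<psi> q = map (\<lambda>(m, s). (m, ren (n + m) (n + q + m) (\<lambda>i. if i < n then i else i + q) s)) \<phi>" for q
  have "ev \<Theta> (k + q) (mwk \<Theta> k q \<theta>) (lft k q e) (msub (n + q) (\<psi> q) t) =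
      ev ms (k + q) (mwk ms k q (mev \<Theta> ms k \<theta> e (map snd \<phi>))) (lft k q e) t" if "(q, t) \<in> set as" for q t
  proof -
    have \<psi>: "length (\<psi> q) = length ms"
      "j < length ms \<Longrightarrow> \<psi> q ! j = (ms ! j, ren (n + ms ! j) (n + q + ms ! j) (\<lambda>i. if i < n then i else i + q) (snd (\<phi> ! j)))" for j
      using p(3,4) by (auto simp: \<psi>_def case_prod_beta)
    have "ev \<Theta> (k + q) (mwk \<Theta> k q \<theta>) (lft k q e) (msub (n + q) (\<psi> q) t) =
      ev ms (k + q) (mev \<Theta> ms (k + q) (mwk \<Theta> k q \<theta>) (lft k q e) (map snd (\<psi> q))) (lft k q e) t"
      by (rule wf_Op.IH[OF that menv_mwk[OF p(1)] env_lft[OF p(2)] \<psi>(1)])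
         (use p(4) in \<open>auto simp: \<psi> intro!: wf_ren\<close>)
    also have "mev \<Theta> ms (k + q) (mwk \<Theta> k q \<theta>) (lft k q e) (map snd (\<psi> q)) = mwk ms k q (mev \<Theta> ms k \<theta> e (map snd \<phi>))" (is "?lhs = ?rhs")
    proof (rule nth_equalityI)
      show "length ?lhs =
          length ?rhs"
        using p(3) \<psi>(1) by (simp add: mev_def mwk_def msb_def)
      fix j assume "j < length ?lhs"
      then have j: "j < length ms" using \<psi>(1) by (simp add: mev_def)
      let ?m = "ms ! j"
      have sj: "wf_trm E \<Theta> (n + ?m) (snd (\<phi> ! j))" using p(4) j by blast
      let ?th = "mwk \<Theta> (k + q) ?m (mwk \<Theta> k q \<theta>)"
      have thq: "menv \<Theta> (k + q + ?m) ?th" by (intro menv_mwk p(1))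
      have ee: "env (n + q + ?m) (k + q + ?m) (lft (k + q) ?m (lft k q e))" by (intro env_lft p(2))
      note iota = env_vars[of k "k + q"]
      have "?lhs ! j =
        ev \<Theta> (k + q + ?m) ?th (lft (k + q) ?m (lft k q e))
         (ren (n + ?m) (n + q + ?m) (\<lambda>i. if i < n then i else i + q) (snd (\<phi> ! j)))"
        using j \<psi> by (simp add: nth_mev)
      also have "\<dots> = ev \<Theta> (k + q + ?m) ?th
          (map (\<lambda>i. lft (k + q) ?m (lft k q e) ! (if i < n then i else i + q)) [0..<n + ?m]) (snd (\<phi> ! j))"
        by (rule ev_ren[OF sj thq ee]) auto
      also have "\<dots> = ev \<Theta> (k + q + ?m) (msb \<Theta> (k + ?m) (k + q + ?m) (lft (k + q) ?m (vars k (k + q))) (mwk \<Theta> k ?m \<theta>))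
          (cmp (k + ?m) (k + q + ?m) (lft (k + q) ?m (vars k (k + q))) (lft k ?m e)) (snd (\<phi> ! j))"
      proof -
        have 1: "map (\<lambda>i. lft (k + q) ?m (lft k q e) ! (if i < n then i else i + q)) [0..<n + ?m] =
          lft (k + q) ?m (cmp k (k + q) (vars k (k + q)) e)"
        by (rule nth_equalityI)
           (auto simp: nth_lft nth_cmp env_len[OF p(2)])
        have 2: "lft (k + q) ?m (cmp k (k + q) (vars k (k + q)) e) =
            cmp (k + ?m) (k + q + ?m) (lft (k + q) ?m (vars k (k + q))) (lft k ?m e)"
          by (rule lft_cmp[OF p(2)]) (auto intro: env_vars)
        have 3: "?th = msb \<Theta> (k + ?m) (k + q + ?m) (lft (k + q) ?m (vars k (k + q))) (mwk \<Theta> k ?m \<theta>)"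
          unfolding msb_mwk[OF p(1) iota[OF le_add1]] by (simp add: mwk_def)
        show ?thesis unfolding 1 2 3 ..
      qed
      also have "\<dots> = s (k + ?m) (k + q + ?m) (ev \<Theta> (k + ?m) (mwk \<Theta> k ?m \<theta>) (lft k ?m e) (snd (\<phi> ! j))) (lft (k + q) ?m (vars k (k + q)))"
        by (rule s_ev[OF sj menv_mwk[OF p(1)] env_lft[OF p(2)] env_lft[OF iota[OF le_add1]], symmetric])
      also have "\<dots> = ?rhs ! j"
        using j p(3) by (simp add: mwk_def[of ms] msb_def nth_mev mev_def)
      finally show "?lhs ! j = ?rhs ! j" .
    qed
    finally show ?thesis .
  qed
  then show ?case unfolding msub.simps \<psi>_def[symmetric]
    by (auto simp: case_prod_beta intro!: arg_cong[where f = "opn k w"])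
qed auto

lemma ev_emsub:
  assumes "wf_trm E ms n t" "menv \<Theta> k \<theta>" "env (n + d) k e" "length ss = length ms"
    "\<And>j. j < length ms \<Longrightarrow> wf_trm E \<Theta> (d + ms ! j) (ss ! j)"
  shows "ev \<Theta> k \<theta> e (emsub n d (zip ms ss) t) = ev ms k (mev \<Theta> ms k \<theta> (drop n e) ss) (take n e) t"
proof -
  let ?\<phi> = "map (\<lambda>(m, s). (m, ren (d + m) (n + d + m) (\<lambda>i. n + i) s)) (zip ms ss)"
  have de: "env d k (drop n e)" using assms(3) by (auto simp: env_def dest: in_set_dropD)
  have \<phi>: "length ?\<phi> = length ms" "\<And>j. j < length ms \<Longrightarrow> ?\<phi> ! j = (ms ! j, ren (d + ms ! j) (n + d + ms ! j) (\<lambda>i. n + i) (ss ! j))"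
    using assms(4) by auto
  have m\<phi>: "mev \<Theta> ms k \<theta> e (map snd ?\<phi>) = mev \<Theta> ms k \<theta> (drop n e) ss" (is "?lhs = ?rhs")
  proof (rule nth_equalityI)
    fix j assume "j < length ?lhs"
    then have j: "j < length ms" using \<phi>(1) by (simp add: mev_def)
    let ?m = "ms ! j"
    have "ev \<Theta> (k + ?m) (mwk \<Theta> k ?m \<theta>) (lft k ?m e) (ren (d + ?m) (n + d + ?m) (\<lambda>i. n + i) (ss ! j)) =
      ev \<Theta> (k + ?m) (mwk \<Theta> k ?m \<theta>) (map (\<lambda>i. lft k ?m e ! (n + i)) [0..<d + ?m]) (ss ! j)"
      by (rule ev_ren[OF assms(5)[OF j] menv_mwk[OF assms(2)] env_lft[OF assms(3)]]) auto
    also have "map (\<lambda>i. lft k ?m e ! (n + i)) [0..<d + ?m] = lft k ?m (drop n e)"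
      by (rule nth_equalityI) (auto simp: nth_lft env_len[OF assms(3)])
    finally show "?lhs ! j = ?rhs ! j"
      using j \<phi> assms(4) by (simp add: nth_mev)
  qed (simp add: mev_def assms(4))
  have "ev \<Theta> k \<theta> e (emsub n d (zip ms ss) t) = ev ms k (mev \<Theta> ms k \<theta> e (map snd ?\<phi>)) e (ren n (n + d) id t)"
    unfolding emsub_def
    by (rule ev_msub[OF wf_ren[OF assms(1)] assms(2,3)]) (use assms(4,5) in \<open>auto intro!: wf_ren\<close>)
  also have "\<dots> = ev ms k (mev \<Theta> ms k \<theta> (drop n e) ss) (map (\<lambda>i. e ! id i) [0..<n]) t"
    unfolding m\<phi> by (rule ev_ren[OF assms(1) menv_mev[OF assms(2) de assms(4,5)] assms(3)]) auto
  also have "map (\<lambda>i. e ! id i) [0..<n] = take n e"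
    by (rule nth_equalityI) (auto simp: env_len[OF assms(3)])
  finally show ?thesis .
qed

definition valid :: "nat list \<Rightarrow> nat \<Rightarrow> 'o trm \<Rightarrow> 'o trm \<Rightarrow> bool" where
  "valid \<Theta> n t t' \<longleftrightarrow> (\<forall>k \<theta> e. menv \<Theta> k \<theta> \<longrightarrow> env n k e \<longrightarrow> ev \<Theta> k \<theta> e t = ev \<Theta> k \<theta> e t')"

text \<open>
  The only rule that requires an argument is extended metasubstitution, for which \<open>ev_emsub\<close> expresses
  the values of both instances by values of the premises.
\<close>

lemma soundness:
  assumes "\<And>\<Theta> n t t'. (\<Theta>, n, t, t') \<in> eqns E \<Longrightarrow> valid \<Theta> n t t'"
    and "derivable E \<Theta> n t t'"
  shows "valid \<Theta> n t t'"
  using assms(2)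
proof (induction rule: derivable.induct)
  case (d_msub ms n s t ss ts \<Theta> d)
  have w: "wf_trm E ms n s" "wf_trm E ms n t" using derivable_wf[OF d_msub.hyps(1)] by auto
  have ws: "j < length ms \<Longrightarrow> wf_trm E \<Theta> (d + ms ! j) (ss ! j)" "j < length ms \<Longrightarrow> wf_trm E \<Theta> (d + ms ! j) (ts ! j)" for j
    using derivable_wf d_msub.hyps(4) by blast+
  show ?case unfolding valid_def
  proof (intro allI impI)
    fix k \<theta> e assume m: "menv \<Theta> k \<theta>" and e: "env (n + d) k e"
    have de: "env d k (drop n e)" and te: "env n k (take n e)"
      using e by (auto simp: env_def dest: in_set_dropD in_set_takeD)
    have "mev \<Theta> ms k \<theta> (drop n e) ss = mev \<Theta> ms k \<theta> (drop n e) ts"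
      by (rule nth_equalityI)
         (use d_msub.IH(2) menv_mwk[OF m] env_lft[OF de] d_msub.hyps(2,3) in \<open>auto simp: mev_def valid_def\<close>)
    then show "ev \<Theta> k \<theta> e (emsub n d (zip ms ss) s) = ev \<Theta> k \<theta> e (emsub n d (zip ms ts) t)"
      using ev_emsub[OF w(1) m e d_msub.hyps(2)] ev_emsub[OF w(2) m e d_msub.hyps(3)] ws
        d_msub.IH(1)[unfolded valid_def, rule_format, OF menv_mev[OF m de d_msub.hyps(3)] te] by simp
  qed
qed (use assms(1) in \<open>auto simp: valid_def\<close>)

definition new_vars :: "nat \<Rightarrow> nat \<Rightarrow> 'u list" where
  "new_vars n k = map (v (n + k)) [n..<n + k]"

lemma env_new_vars: "env k (n + k) (new_vars n k)"
  by (rule envI) (auto simp: new_vars_def intro: v_in)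

text \<open>
  An equation is evaluated in an arbitrary environment \<open>e\<close> at stage \<open>k\<close> by evaluating it in \<open>n\<close> fresh
  variables at stage \<open>n + k\<close> and substituting \<open>e\<close> for them.  The metavariables are
  interpreted in the other \<open>k\<close> variables; this matches the shape of the extended
  metasubstitution rule, where \<open>s\<^sub>j\<close> lives in \<open>\<Delta>\<close> and the equation in \<open>\<Gamma>\<close>.
\<close>

lemma validI_vars:
  assumes "wf_trm E \<Theta> n t" "wf_trm E \<Theta> n t'"
    and "\<And>k \<theta>. menv \<Theta> k \<theta> \<Longrightarrow> ev \<Theta> (n + k) (msb \<Theta> k (n + k) (new_vars n k) \<theta>) (vars n (n + k)) t =
      ev \<Theta> (n + k) (msb \<Theta> k (n + k) (new_vars n k) \<theta>) (vars n (n + k)) t'"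
  shows "valid \<Theta> n t t'"
  unfolding valid_def
proof (intro allI impI)
  fix k \<theta> e assume m: "menv \<Theta> k \<theta>" and e: "env n k e"
  define \<iota> where "\<iota> = new_vars n k"
  have i: "env k (n + k) \<iota>" unfolding \<iota>_def by (rule env_new_vars)
  let ?c = "e @ vars k k"
  have c: "env (n + k) k ?c" using e env_vars[of k k] by (auto simp: env_def)
  have ci: "cmp (n + k) k ?c \<iota> = vars k k"
    by (rule nth_equalityI) (auto simp: \<iota>_def new_vars_def cmp_def s_vars[OF c] nth_append env_len[OF e])
  have th: "\<theta> = msb \<Theta> (n + k) k ?c (msb \<Theta> k (n + k) \<iota> \<theta>)"
    unfolding msb_msb[OF m i c] ci msb_vars[OF m] ..
  have ee: "e = cmp (n + k) k ?c (vars n (n + k))"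
    using cmp_vars[OF c, of n] env_len[OF e] by simp
  have "ev \<Theta> k \<theta> e u = s (n + k) k (ev \<Theta> (n + k) (msb \<Theta> k (n + k) \<iota> \<theta>) (vars n (n + k)) u) ?c"
    if "wf_trm E \<Theta> n u" for u
    unfolding s_ev[OF that menv_msb[OF m i] env_vars[OF le_add1] c] using th ee by simp
  then show "ev \<Theta> k \<theta> e t = ev \<Theta> k \<theta> e t'"
    using assms(1,2) assms(3)[OF m] by (simp add: \<iota>_def)
qed

end

section \<open>Computing with the substitution tensor\<close>

text \<open>
  All structural maps of the substitution tensor are induced by maps on representatives.  Each of
  the lemmas below describes one of them by its value at the class of a triple \<open>(k, a, b)\<close>.
\<close>

lemma FF_simps [simp]:
  "obj FF = UNIV" "hom FF m n = ({..<m} \<rightarrow>\<^sub>E {..<n})" "ident FF n = (\<lambda>i\<in>{..<n}. i)"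
  "comp FF l m n g f = compose {..<l} g f"
  by (auto simp: FF_def)

lemma fob_mk_psh [simp]: "fob (mk_psh S a) = S"
  by (simp add: mk_psh_def)

lemma far_mk_psh: "f \<in> hom FF k l \<Longrightarrow> x \<in> S k \<Longrightarrow> far (mk_psh S a) k l f x = a k l f x"
  by (simp add: mk_psh_def)

lemma fplus_hom: "f \<in> {..<k} \<rightarrow>\<^sub>E {..<l} \<Longrightarrow> fplus k l f p \<in> {..<k + p} \<rightarrow>\<^sub>E {..<l + p}"
  by (auto simp: fplus_def PiE_def Pi_def intro: trans_less_add1)

lemma tens_raw_iff [simp]:
  "(k, a, b) \<in> tens_raw X Y n \<longleftrightarrow> a \<in> fob X k \<and> length b = k \<and> set b \<subseteq> fob Y n"
  by (simp add: tens_raw_def)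

lemma tcl_eqI: "(u, w) \<in> tens_rel X Y n \<Longrightarrow> tcl X Y n u = tcl X Y n w"
  unfolding tcl_def by (auto intro: tr_sym tr_trans)

lemma tcl_step:
  "f \<in> hom FF k l \<Longrightarrow> a \<in> fob X k \<Longrightarrow> length b = l \<Longrightarrow> set b \<subseteq> fob Y n \<Longrightarrow>
    tcl X Y n (l, far X k l f a, b) = tcl X Y n (k, a, map (\<lambda>i. b ! f i) [0..<k])"
  by (rule tcl_eqI, rule tr_step)

text \<open>
  Since the equivalence relation is generated by the coend relation, it suffices that \<open>\<phi>\<close> is constant
  along its generating steps.
\<close>

lemma lift_tcl:
  assumes "\<And>k l f a b. f \<in> hom FF k l \<Longrightarrow> a \<in> fob X k \<Longrightarrow> length b = l \<Longrightarrow> set b \<subseteq> fob Y n \<Longrightarrow>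
      \<phi> l (far X k l f a) b = \<phi> k a (map (\<lambda>i. b ! f i) [0..<k])"
    and "(k, a, b) \<in> tens_raw X Y n"
  shows "lift \<phi> (tcl X Y n (k, a, b)) = \<phi> k a b"
proof -
  let ?p = "\<lambda>(k, a, b). \<phi> k a b"
  have const: "?p u = ?p w" if "(u, w) \<in> tens_rel X Y n" for u w
    using that
  proof induction
    case (tr_step f k l a b)
    show ?case unfolding prod.case by (rule assms(1)[OF tr_step])
  qed simp_all
  have "?p ` tcl X Y n (k, a, b) \<subseteq> {?p (k, a, b)}"
  proof
    fix y assume "y \<in> ?p ` tcl X Y n (k, a, b)"
    then obtain w where w: "((k, a, b), w) \<in> tens_rel X Y n" and y: "y = ?p w" unfolding tcl_def by blast
    show "y \<in> {?p (k, a, b)}" unfolding y singleton_iff by (rule const[OF w, symmetric])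
  qed
  moreover have "?p (k, a, b) \<in> ?p ` tcl X Y n (k, a, b)"
    using tr_refl[OF assms(2)] unfolding tcl_def by blast
  ultimately have "?p ` tcl X Y n (k, a, b) = {?p (k, a, b)}"
    by blast
  then show ?thesis by (simp add: lift_def)
qed

lemma fob_tens: "c \<in> fob (tens X Y) n \<longleftrightarrow> (\<exists>k a b. (k, a, b) \<in> tens_raw X Y n \<and> c = tcl X Y n (k, a, b))"
  unfolding tens_def fob_mk_psh quotient_def tcl_def by (auto simp: Bex_def)

lemma tcl_in_tens: "(k, a, b) \<in> tens_raw X Y n \<Longrightarrow> tcl X Y n (k, a, b) \<in> fob (tens X Y) n"
  unfolding fob_tens by blast

definition psh_closed :: "'a psh \<Rightarrow> bool" where
  "psh_closed X \<longleftrightarrow> (\<forall>k l f x. f \<in> hom FF k l \<longrightarrow> x \<in> fob X k \<longrightarrow> far X k l f x \<in> fob X l)"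

lemma psh_closedD: "psh_closed X \<Longrightarrow> f \<in> {..<k} \<rightarrow>\<^sub>E {..<l} \<Longrightarrow> x \<in> fob X k \<Longrightarrow> far X k l f x \<in> fob X l"
  unfolding psh_closed_def FF_simps by blast

lemma map_nth_less:
  assumes "f \<in> {..<k} \<rightarrow>\<^sub>E {..<length b}"
  shows "map (\<lambda>i. map g b ! f i) [0..<k] = map g (map (\<lambda>i. b ! f i) [0..<k])"
  using assms by (auto simp: PiE_def Pi_def)

lemma set_map_nth:
  assumes "f \<in> {..<k} \<rightarrow>\<^sub>E {..<length b}" "set b \<subseteq> B"
  shows "set (map (\<lambda>i. b ! f i) [0..<k]) \<subseteq> B"
  using assms by (auto simp: PiE_def Pi_def subset_iff)

lemma far_tens:
  assumes "psh_closed Y" "f \<in> hom FF m n" "(k, a, b) \<in> tens_raw X Y m"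
  shows "far (tens X Y) m n f (tcl X Y m (k, a, b)) = tcl X Y n (k, a, map (far Y m n f) b)"
proof -
  have "far (tens X Y) m n f (tcl X Y m (k, a, b)) = lift (\<lambda>k a b. tcl X Y n (k, a, map (far Y m n f) b)) (tcl X Y m (k, a, b))"
    using tcl_in_tens[OF assms(3)] assms(2) unfolding tens_def fob_mk_psh by (rule far_mk_psh[rotated])
  also have "\<dots> = tcl X Y n (k, a, map (far Y m n f) b)"
  proof (rule lift_tcl[OF _ assms(3)])
    fix k l g a b assume g: "g \<in> hom FF k l" and a: "a \<in> fob X k" and b: "length b = l" "set b \<subseteq> fob Y m"
    have "set (map (far Y m n f) b) \<subseteq> fob Y n" using b psh_closedD[OF assms(1)] assms(2) by auto
    then show "tcl X Y n (l, far X k l g a, map (far Y m n f) b) =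
        tcl X Y n (k, a, map (far Y m n f) (map (\<lambda>i. b ! g i) [0..<k]))"
      using tcl_step[OF g a, of "map (far Y m n f) b" Y n] b g map_nth_less[of g k b "far Y m n f"] by (simp del: map_map)
  qed
  finally show ?thesis .
qed

lemma psh_homD:
  assumes "psh_hom X Y \<phi>"
  shows psh_hom_in: "x \<in> fob X k \<Longrightarrow> \<phi> k x \<in> fob Y k"
    and psh_hom_natural: "f \<in> hom FF k l \<Longrightarrow> x \<in> fob X k \<Longrightarrow> \<phi> l (far X k l f x) = far Y k l f (\<phi> k x)"
    and psh_hom_ext: "\<phi> k \<in> fob X k \<rightarrow>\<^sub>E fob Y k"
proof -
  show e: "\<phi> k \<in> fob X k \<rightarrow>\<^sub>E fob Y k" for k using assms by (simp add: psh_hom_def)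
  show "x \<in> fob X k \<Longrightarrow> \<phi> k x \<in> fob Y k" by (rule PiE_mem[OF e])
  show "f \<in> hom FF k l \<Longrightarrow> x \<in> fob X k \<Longrightarrow> \<phi> l (far X k l f x) = far Y k l f (\<phi> k x)"
    using assms unfolding psh_hom_def by blast
qed

lemma psh_hom_image: "psh_hom X Y \<phi> \<Longrightarrow> \<phi> k ` fob X k \<subseteq> fob Y k"
  by (auto intro: psh_hom_in)

lemma tens_map_tcl:
  assumes \<phi>: "psh_hom X X' \<phi>" and \<psi>: "\<psi> n ` fob Y n \<subseteq> fob Y' n" and r: "(k, a, b) \<in> tens_raw X Y n"
  shows "tens_map X' Y' \<phi> \<psi> n (tcl X Y n (k, a, b)) = tcl X' Y' n (k, \<phi> k a, map (\<psi> n) b)"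
  unfolding tens_map_def
proof (rule lift_tcl[OF _ r])
  fix k l f a b assume f: "f \<in> hom FF k l" and a: "a \<in> fob X k" and b: "length b = l" "set b \<subseteq> fob Y n"
  have "set (map (\<psi> n) b) \<subseteq> fob Y' n" using b \<psi> by auto
  then show "tcl X' Y' n (l, \<phi> l (far X k l f a), map (\<psi> n) b) =
      tcl X' Y' n (k, \<phi> k a, map (\<psi> n) (map (\<lambda>i. b ! f i) [0..<k]))"
    using tcl_step[OF f psh_hom_in[OF \<phi> a], of "map (\<psi> n) b" Y' n] b f map_nth_less[of f k b "\<psi> n"]
    by (simp del: map_map add: psh_hom_natural[OF \<phi> f a])
qed

lemma tens_map_id_right:
  assumes "psh_hom X X' \<phi>" "(k, a, b) \<in> tens_raw X Y n"
  shows "tens_map X' Y \<phi> (\<lambda>_ x. x) n (tcl X Y n (k, a, b)) = tcl X' Y n (k, \<phi> k a, b)"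
  using tens_map_tcl[OF assms(1) _ assms(2), where \<psi> = "\<lambda>_ x. x" and Y' = Y] by simp

text \<open>
  This is not an instance of \<open>tens_map_tcl\<close>: the function \<open>\<lambda>_ x. x\<close> is not \<open>undefined\<close> off the carrier,
  so that \<open>psh_hom\<close> does not hold of it.
\<close>

lemma tens_map_id_left:
  assumes \<psi>: "\<psi> n ` fob Y n \<subseteq> fob Y' n" and r: "(k, a, b) \<in> tens_raw X Y n"
  shows "tens_map X Y' (\<lambda>_ x. x) \<psi> n (tcl X Y n (k, a, b)) = tcl X Y' n (k, a, map (\<psi> n) b)"
  unfolding tens_map_def
proof (rule lift_tcl[OF _ r])
  fix k l f a b assume f: "f \<in> hom FF k l" and a: "a \<in> fob X k" and b: "length b = l" "set b \<subseteq> fob Y n"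
  have "set (map (\<psi> n) b) \<subseteq> fob Y' n" using b \<psi> by auto
  then show "tcl X Y' n (l, far X k l f a, map (\<psi> n) b) =
      tcl X Y' n (k, a, map (\<psi> n) (map (\<lambda>i. b ! f i) [0..<k]))"
    using tcl_step[OF f a, of "map (\<psi> n) b" Y' n] b f map_nth_less[of f k b "\<psi> n"]
    by (simp del: map_map)
qed

lemma fob_yon [simp]: "fob (yon n) k = ({..<n} \<rightarrow>\<^sub>E {..<k})"
  by (simp add: yon_def)

lemma far_yon: "f \<in> {..<k} \<rightarrow>\<^sub>E {..<l} \<Longrightarrow> \<rho> \<in> {..<n} \<rightarrow>\<^sub>E {..<k} \<Longrightarrow> far (yon n) k l f \<rho> = compose {..<n} f \<rho>"
  unfolding yon_def by (subst far_mk_psh) auto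

lemma pt_in: "i < n \<Longrightarrow> pt i \<in> {..<1} \<rightarrow>\<^sub>E {..<n}"
  by (auto simp: pt_def)

lemma pt_0 [simp]: "pt i 0 = i"
  by (simp add: pt_def)

lemma yon_1_eq_pt: "\<rho> \<in> {..<1} \<rightarrow>\<^sub>E B \<Longrightarrow> \<rho> = pt (\<rho> 0)"
  by (auto simp: pt_def fun_eq_iff PiE_def extensional_def)

lemma yon_1_less: "(\<rho> :: nat \<Rightarrow> nat) \<in> {..<1} \<rightarrow>\<^sub>E {..<n} \<Longrightarrow> \<rho> 0 < n"
  by (drule PiE_mem[where x = 0]) simp_all

lemma lunit_tcl:
  assumes "(k, \<rho>, b) \<in> tens_raw (yon 1) Y n"
  shows "lunit n (tcl (yon 1) Y n (k, \<rho>, b)) = b ! \<rho> 0"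
  unfolding lunit_def
proof (rule lift_tcl[OF _ assms])
  fix k l f \<rho> b assume f: "f \<in> hom FF k l" and r: "\<rho> \<in> fob (yon 1) k"
  have "far (yon 1) k l f \<rho> = compose {..<1} f \<rho>" using f r far_yon by auto
  moreover have "compose {..<1} f \<rho> 0 = f (\<rho> 0)" by (rule compose_eq) simp
  moreover have "\<rho> 0 < k" using r by (intro yon_1_less) (simp only: fob_yon)
  ultimately show "b ! far (yon 1) k l f \<rho> 0 = map (\<lambda>i. b ! f i) [0..<k] ! \<rho> 0" by simp
qed

lemma psh_comp:
  assumes "is_functor FF SET X" "f \<in> {..<k} \<rightarrow>\<^sub>E {..<l}" "g \<in> {..<l} \<rightarrow>\<^sub>E {..<m}" "x \<in> fob X k"
  shows "far X l m g (far X k l f x) = far X k m (compose {..<k} g f) x"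
  using functor_comp[OF assms(1), of f k l g m] assms(2-4) by (simp add: compose_def)

lemma psh_ident:
  assumes "is_functor FF SET X" "x \<in> fob X k"
  shows "far X k k (\<lambda>i\<in>{..<k}. i) x = x"
  using functor_ident[OF assms(1), of k] assms(2) by simp

lemma psh_closed_functor: "is_functor FF SET X \<Longrightarrow> psh_closed X"
  unfolding psh_closed_def using functor_hom[of FF SET X] by (auto simp: PiE_def Pi_def)

lemma runit_tcl:
  assumes X: "is_functor FF SET X" and r: "(k, a, b) \<in> tens_raw X (yon 1) n"
  shows "runit X n (tcl X (yon 1) n (k, a, b)) = far X k n (\<lambda>i\<in>{..<k}. (b ! i) 0) a"
  unfolding runit_def
proof (rule lift_tcl[OF _ r])
  fix k l f a b assume f: "f \<in> hom FF k l" and a: "a \<in> fob X k" and b: "length b = l" "set b \<subseteq> fob (yon 1) n"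
  have "(b ! i) 0 < n" if "i < l" for i
    by (rule yon_1_less) (use b that in \<open>metis fob_yon nth_mem subsetD\<close>)
  then have "far X l n (\<lambda>i\<in>{..<l}. (b ! i) 0) (far X k l f a) = far X k n (compose {..<k} (\<lambda>i\<in>{..<l}. (b ! i) 0) f) a"
    by (intro psh_comp[OF X _ _ a]) (use f in auto)
  also have "compose {..<k} (\<lambda>i\<in>{..<l}. (b ! i) 0) f = (\<lambda>i\<in>{..<k}. (map (\<lambda>i. b ! f i) [0..<k] ! i) 0)"
    using f by (auto simp: compose_def fun_eq_iff PiE_def Pi_def)
  finally show "far X l n (\<lambda>i\<in>{..<l}. (b ! i) 0) (far X k l f a) = far X k n (\<lambda>i\<in>{..<k}. (map (\<lambda>i. b ! f i) [0..<k] ! i) 0) a" .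
qed

lemma assoc_tcl:
  assumes Y: "psh_closed Y" and r: "(k, a, b) \<in> tens_raw X Y l" and c: "length c = l" "set c \<subseteq> fob Z n"
  shows "assoc X Y Z n (tcl (tens X Y) Z n (l, tcl X Y l (k, a, b), c)) =
    tcl X (tens Y Z) n (k, a, map (\<lambda>b'. tcl Y Z n (l, b', c)) b)"
proof -
  have inner: "lift (\<lambda>k a b. tcl X (tens Y Z) n (k, a, map (\<lambda>b'. tcl Y Z n (l, b', c)) b)) (tcl X Y l (k, a, b)) =
      tcl X (tens Y Z) n (k, a, map (\<lambda>b'. tcl Y Z n (l, b', c)) b)"
    if r: "(k, a, b) \<in> tens_raw X Y l" and c: "length c = l" "set c \<subseteq> fob Z n" for l k a b c
  proof (rule lift_tcl[OF _ r])
    fix k m f a b assume f: "f \<in> hom FF k m" and a: "a \<in> fob X k" and b: "length b = m" "set b \<subseteq> fob Y l"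
    have "set (map (\<lambda>b'. tcl Y Z n (l, b', c)) b) \<subseteq> fob (tens Y Z) n"
      using b c by (auto intro!: tcl_in_tens)
    then show "tcl X (tens Y Z) n (m, far X k m f a, map (\<lambda>b'. tcl Y Z n (l, b', c)) b) =
        tcl X (tens Y Z) n (k, a, map (\<lambda>b'. tcl Y Z n (l, b', c)) (map (\<lambda>i. b ! f i) [0..<k]))"
      using tcl_step[OF f a, of "map (\<lambda>b'. tcl Y Z n (l, b', c)) b" "tens Y Z" n] b f map_nth_less[of f k b "\<lambda>b'. tcl Y Z n (l, b', c)"]
      by (simp del: map_map)
  qed
  have "assoc X Y Z n (tcl (tens X Y) Z n (l, tcl X Y l (k, a, b), c)) =
     lift (\<lambda>k a b. tcl X (tens Y Z) n (k, a, map (\<lambda>b'. tcl Y Z n (l, b', c)) b)) (tcl X Y l (k, a, b))"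
    unfolding assoc_def
  proof (rule lift_tcl)
    show "(l, tcl X Y l (k, a, b), c) \<in> tens_raw (tens X Y) Z n" using tcl_in_tens[OF r] c by simp
    fix l l' f u c assume f: "f \<in> hom FF l l'" and u: "u \<in> fob (tens X Y) l" and c: "length c = l'" "set c \<subseteq> fob Z n"
    obtain k a b where r: "(k, a, b) \<in> tens_raw X Y l" and u: "u = tcl X Y l (k, a, b)"
      using u unfolding fob_tens by blast
    have r': "(k, a, map (far Y l l' f) b) \<in> tens_raw X Y l'"
      using r f psh_closedD[OF Y] by auto
    have c': "length (map (\<lambda>i. c ! f i) [0..<l]) = l" "set (map (\<lambda>i. c ! f i) [0..<l]) \<subseteq> fob Z n"
      using c f set_map_nth[of f l c] by auto
    have "tcl Y Z n (l', far Y l l' f y, c) = tcl Y Z n (l, y, map (\<lambda>i. c ! f i) [0..<l])" if "y \<in> set b" for y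
      by (rule tcl_step[OF f _ c]) (use that r in auto)
    then have "map (\<lambda>b'. tcl Y Z n (l', b', c)) (map (far Y l l' f) b) =
        map (\<lambda>b'. tcl Y Z n (l, b', map (\<lambda>i. c ! f i) [0..<l])) b"
      by simp
    then show "lift (\<lambda>k a b. tcl X (tens Y Z) n (k, a, map (\<lambda>b'. tcl Y Z n (l', b', c)) b)) (far (tens X Y) l l' f u) =
       lift (\<lambda>k a b. tcl X (tens Y Z) n (k, a, map (\<lambda>b'. tcl Y Z n (l, b', map (\<lambda>i. c ! f i) [0..<l])) b)) u"
      unfolding u far_tens[OF Y f r] inner[OF r' c] inner[OF r c'] by (simp only:)
  qed
  then show ?thesis using inner[OF r c] by simp
qed

lemma fob_pexp [simp]: "fob (pexp X p) k = fob X (k + p)"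
  by (simp add: pexp_def)

lemma far_pexp: "f \<in> {..<k} \<rightarrow>\<^sub>E {..<l} \<Longrightarrow> a \<in> fob X (k + p) \<Longrightarrow>
    far (pexp X p) k l f a = far X (k + p) (l + p) (fplus k l f p) a"
  unfolding pexp_def by (subst far_mk_psh) auto

lemma incl_in: "incl k p \<in> {..<k} \<rightarrow>\<^sub>E {..<k + p}"
  by (auto simp: incl_def)

text \<open>
  For \<open>f : k \<rightarrow> l\<close>, the lifted tuple composed with \<open>f + p\<close> is the lift of the tuple composed with \<open>f\<close>, as
  \<open>f + p\<close> is the identity on the new variables.
\<close>

lemma exp_str_tcl:
  assumes Y: "psh_closed Y" and \<eta>: "\<And>j. j < p \<Longrightarrow> \<eta> (m + p) (pt (m + j)) \<in> fob Y (m + p)"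
    and r: "(k, a, b) \<in> tens_raw (pexp X p) Y m"
  shows "exp_str X Y \<eta> p m (tcl (pexp X p) Y m (k, a, b)) = tcl X Y (m + p)
     (k + p, a, map (far Y m (m + p) (incl m p)) b @ map (\<lambda>j. \<eta> (m + p) (pt (m + j))) [0..<p])"
  unfolding exp_str_def
proof (rule lift_tcl[OF _ r])
  fix k l f a b assume f: "f \<in> hom FF k l" and a: "a \<in> fob (pexp X p) k" and b: "length b = l" "set b \<subseteq> fob Y m"
  let ?w = "\<lambda>b. map (far Y m (m + p) (incl m p)) b @ map (\<lambda>j. \<eta> (m + p) (pt (m + j))) [0..<p]"
  have "set (?w b) \<subseteq> fob Y (m + p)" using b psh_closedD[OF Y incl_in] \<eta> by auto
  then have "tcl X Y (m + p) (l + p, far X (k + p) (l + p) (fplus k l f p) a, ?w b) =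
      tcl X Y (m + p) (k + p, a, map (\<lambda>i. ?w b ! fplus k l f p i) [0..<k + p])"
    by (intro tcl_step) (use a b fplus_hom[of f k l p] f in auto)
  also have "map (\<lambda>i. ?w b ! fplus k l f p i) [0..<k + p] = ?w (map (\<lambda>i. b ! f i) [0..<k])"
    using f b by (intro nth_equalityI) (auto simp: fplus_def nth_append PiE_def Pi_def)
  finally show "tcl X Y (m + p) (l + p, far (pexp X p) k l f a, ?w b) = tcl X Y (m + p) (k + p, a, ?w (map (\<lambda>i. b ! f i) [0..<k]))"
    using f a by (simp add: far_pexp)
qed

lemma prodexp_fob [simp]: "fob (prodexp X ns) k = {as. list_all2 (\<lambda>p a. a \<in> fob X (k + p)) ns as}"
  by (simp add: prodexp_def)

lemma map2_cong_all2:
  "list_all2 (\<lambda>x y. f x y = g x y) xs ys \<Longrightarrow> map2 f xs ys = map2 g xs ys"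
  by (induction rule: list_all2_induct) auto

lemma far_prodexp:
  assumes "f \<in> {..<k} \<rightarrow>\<^sub>E {..<l}" "list_all2 (\<lambda>p a. a \<in> fob X (k + p)) ns as"
  shows "far (prodexp X ns) k l f as = map2 (\<lambda>p. far X (k + p) (l + p) (fplus k l f p)) ns as"
proof -
  have "far (prodexp X ns) k l f as = map2 (\<lambda>p. far (pexp X p) k l f) ns as"
    unfolding prodexp_def by (subst far_mk_psh) (use assms in auto)
  also have "\<dots> = map2 (\<lambda>p. far X (k + p) (l + p) (fplus k l f p)) ns as"
    by (rule map2_cong_all2, rule list_all2_mono[OF assms(2)]) (use assms(1) in \<open>simp add: far_pexp\<close>)
  finally show ?thesis .
qed

lemma fob_sigF: "u \<in> fob (sigF E X) k \<longleftrightarrow>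
    (\<exists>w as. u = (w, as) \<and> w \<in> ops E \<and> list_all2 (\<lambda>p a. a \<in> fob X (k + p)) (arity E w) as)"
  by (auto simp: sigF_def)

lemma far_sigF:
  assumes "f \<in> {..<k} \<rightarrow>\<^sub>E {..<l}" "w \<in> ops E" "list_all2 (\<lambda>p a. a \<in> fob X (k + p)) (arity E w) as"
  shows "far (sigF E X) k l f (w, as) = (w, map2 (\<lambda>p. far X (k + p) (l + p) (fplus k l f p)) (arity E w) as)"
  unfolding sigF_def by (subst far_mk_psh) (use assms in \<open>auto simp: far_prodexp\<close>)

lemma strength_tcl:
  assumes Y: "psh_closed Y" and \<eta>: "\<And>p j. j < p \<Longrightarrow> \<eta> (m + p) (pt (m + j)) \<in> fob Y (m + p)"
    and r: "(k, (w, as), b) \<in> tens_raw (sigF E X) Y m"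
  shows "strength E X Y \<eta> m (tcl (sigF E X) Y m (k, (w, as), b)) =
    (w, map2 (\<lambda>p a. tcl X Y (m + p)
     (k + p, a, map (far Y m (m + p) (incl m p)) b @ map (\<lambda>j. \<eta> (m + p) (pt (m + j))) [0..<p])) (arity E w) as)"
proof -
  have w: "w \<in> ops E" and as: "list_all2 (\<lambda>p a. a \<in> fob X (k + p)) (arity E w) as" and b: "length b = k" "set b \<subseteq> fob Y m"
    using r by (auto simp: fob_sigF)
  define \<phi> where "\<phi> = (\<lambda>k (w, as) b. (w, map2 (\<lambda>p a. exp_str X Y \<eta> p m (tcl (pexp X p) Y m (k, a, b))) (arity E w) as))"
  have "lift \<phi> (tcl (sigF E X) Y m (k, (w, as), b)) = \<phi> k (w, as) b"
  proof (rule lift_tcl[OF _ r])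
    fix k l f u b assume f: "f \<in> hom FF k l" and u: "u \<in> fob (sigF E X) k" and b: "length b = l" "set b \<subseteq> fob Y m"
    obtain w as where u: "u = (w, as)" "w \<in> ops E" "list_all2 (\<lambda>p a. a \<in> fob X (k + p)) (arity E w) as"
      using u unfolding fob_sigF by blast
    have l: "length as = length (arity E w)" using u(3) by (simp add: list_all2_lengthD)
    have "map2 (\<lambda>p a. exp_str X Y \<eta> p m (tcl (pexp X p) Y m (l, a, b))) (arity E w)
        (map2 (\<lambda>p. far X (k + p) (l + p) (fplus k l f p)) (arity E w) as) =
       map2 (\<lambda>p a. exp_str X Y \<eta> p m (tcl (pexp X p) Y m (k, a, map (\<lambda>i. b ! f i) [0..<k]))) (arity E w) as"
    proof (rule nth_equalityI)
      fix i assume "i < length (map2 (\<lambda>p a. exp_str X Y \<eta> p m (tcl (pexp X p) Y m (l, a, b))) (arity E w)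
        (map2 (\<lambda>p. far X (k + p) (l + p) (fplus k l f p)) (arity E w) as))"
      then have i: "i < length (arity E w)" using l by simp
      have a: "as ! i \<in> fob X (k + arity E w ! i)" using u(3) i by (auto simp: list_all2_conv_all_nth)
      show "map2 (\<lambda>p a. exp_str X Y \<eta> p m (tcl (pexp X p) Y m (l, a, b))) (arity E w)
        (map2 (\<lambda>p. far X (k + p) (l + p) (fplus k l f p)) (arity E w) as) ! i =
       map2 (\<lambda>p a. exp_str X Y \<eta> p m (tcl (pexp X p) Y m (k, a, map (\<lambda>i. b ! f i) [0..<k]))) (arity E w) as ! i"
        using tcl_step[OF f, of "as ! i" "pexp X (arity E w ! i)" b Y m] a f b i l by (simp add: far_pexp)
    qed (simp add: l)
    then show "\<phi> l (far (sigF E X) k l f u) b = \<phi> k u (map (\<lambda>i. b ! f i) [0..<k])"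
      using f by (simp add: u(1) far_sigF[OF _ u(2,3)] \<phi>_def)
  qed
  also have "\<phi> k (w, as) b = (w, map2 (\<lambda>p a. tcl X Y (m + p)
     (k + p, a, map (far Y m (m + p) (incl m p)) b @ map (\<lambda>j. \<eta> (m + p) (pt (m + j))) [0..<p])) (arity E w) as)"
    unfolding \<phi>_def prod.case prod.inject
    by (intro conjI refl map2_cong_all2 list_all2_mono[OF as] exp_str_tcl[where \<eta> = \<eta>] Y \<eta>) (use b in auto)
  finally show ?thesis by (simp add: strength_def \<phi>_def)
qed

section \<open>Models as abstract clones\<close>

locale clone_hom = C: op_clone E S v s opn + D: op_clone E S' v' s' opn'
  for E :: "'o pres" and S :: "nat \<Rightarrow> 'u set" and v s opn and S' :: "nat \<Rightarrow> 'u set" and v' s' opn' +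
  fixes h :: "nat \<Rightarrow> 'u \<Rightarrow> 'u"
  assumes h_in: "a \<in> S n \<Longrightarrow> h n a \<in> S' n"
    and h_v: "i < n \<Longrightarrow> h n (v n i) = v' n i"
    and h_s: "a \<in> S m \<Longrightarrow> length b = m \<Longrightarrow> set b \<subseteq> S n \<Longrightarrow> h n (s m n a b) = s' m n (h m a) (map (h n) b)"
    and h_opn: "w \<in> ops E \<Longrightarrow> list_all2 (\<lambda>p a. a \<in> S (n + p)) (arity E w) as \<Longrightarrow>
      h n (opn n w as) = opn' n w (map2 (\<lambda>p. h (n + p)) (arity E w) as)"
begin

lemma h_menv: "C.menv \<Theta> k \<theta> \<Longrightarrow> D.menv \<Theta> k (map2 (\<lambda>m. h (k + m)) \<Theta> \<theta>)"
  by (auto simp: C.menv_def D.menv_def h_in)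

lemma h_vars: "n \<le> m \<Longrightarrow> map (h m) (C.vars n m) = D.vars n m"
  by (rule nth_equalityI) (auto simp: h_v)

lemma h_s_env: "a \<in> S m \<Longrightarrow> C.env m n b \<Longrightarrow> h n (s m n a b) = s' m n (h m a) (map (h n) b)"
  by (simp add: C.env_def h_s)

lemma h_lft: "C.env m n b \<Longrightarrow> map (h (n + p)) (C.lft n p b) = D.lft n p (map (h n) b)"
  by (rule nth_equalityI)
     (auto simp: C.nth_lft D.nth_lft h_v h_s_env[OF C.env_nth C.env_vars] C.env_len h_vars)

lemma h_mwk: "C.menv \<Theta> k \<theta> \<Longrightarrow>
    map2 (\<lambda>m. h (k + p + m)) \<Theta> (C.mwk \<Theta> k p \<theta>) = D.mwk \<Theta> k p (map2 (\<lambda>m. h (k + m)) \<Theta> \<theta>)"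
  unfolding C.mwk_def D.mwk_def
  by (rule nth_equalityI)
     (auto simp: C.nth_msb D.nth_msb h_menv C.length_msb D.length_msb C.menv_len
        h_s_env[OF C.menv_nth C.env_lft[OF C.env_vars]] h_lft[OF C.env_vars] h_vars)

lemma h_ev:
  assumes "wf_trm E \<Theta> n t" "C.menv \<Theta> k \<theta>" "C.env n k e"
  shows "h k (C.ev \<Theta> k \<theta> e t) = D.ev \<Theta> k (map2 (\<lambda>m. h (k + m)) \<Theta> \<theta>) (map (h k) e) t"
  using assms
proof (induction arbitrary: k \<theta> e rule: wf_trm.induct)
  case (wf_Var i n)
  then show ?case by (simp add: C.env_len)
next
  case (wf_MVar j ts n)
  note p = wf_MVar.prems
  have w: "wf_trm E \<Theta> n (MVar j ts)" using wf_MVar.hyps by (rule wf_trm.wf_MVar)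
  have "map (h k) (map (C.ev \<Theta> k \<theta> e) ts) = map (D.ev \<Theta> k (map2 (\<lambda>m. h (k + m)) \<Theta> \<theta>) (map (h k) e)) ts"
    using wf_MVar.IH[OF _ p] by auto
  then show ?case
    using h_s_env[OF C.menv_nth[OF p(1) wf_MVar.hyps(1)] C.env_evs[OF w p]] wf_MVar.hyps(1) C.menv_len[OF p(1)]
    by (simp del: map_map add: h_vars)
next
  case (wf_Op w as n)
  note p = wf_Op.prems
  have la: "list_all2 (\<lambda>p a. a \<in> S (k + p)) (arity E w)
      (map (\<lambda>(p, t). C.ev \<Theta> (k + p) (C.mwk \<Theta> k p \<theta>) (C.lft k p e) t) as)"
    by (rule C.list_all2_map_arity[OF wf_Op.hyps(2)])
       (rule C.ev_in[OF wf_Op.hyps(3) C.menv_mwk[OF p(1)] C.env_lft[OF p(2)]])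
  have "h (k + q) (C.ev \<Theta> (k + q) (C.mwk \<Theta> k q \<theta>) (C.lft k q e) t) =
     D.ev \<Theta> (k + q) (D.mwk \<Theta> k q (map2 (\<lambda>m. h (k + m)) \<Theta> \<theta>)) (D.lft k q (map (h k) e)) t" if "(q, t) \<in> set as" for q t
    using wf_Op.IH[OF that C.menv_mwk[OF p(1)] C.env_lft[OF p(2)]] by (simp add: h_mwk[OF p(1)] h_lft[OF p(2)])
  then show ?case
    unfolding C.ev.simps D.ev.simps h_opn[OF wf_Op.hyps(1) la] C.map2_arity[OF wf_Op.hyps(2)]
    by (auto cong: C.map_arity_cong)
qed

end

text \<open>
  The clone of a model: the multiplication \<open>A \<bullet> A \<rightarrow> A\<close> is regarded as an operation on representatives.
\<close>

definition m_var :: "('o, 'u) smodel \<Rightarrow> nat \<Rightarrow> nat \<Rightarrow> 'u" where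
  "m_var A n i = unit A n (pt i)"

definition m_sub :: "('o, 'u) smodel \<Rightarrow> nat \<Rightarrow> nat \<Rightarrow> 'u \<Rightarrow> 'u list \<Rightarrow> 'u" where
  "m_sub A m n a b = mult A n (tcl (car A) (car A) n (m, a, b))"

definition m_op :: "('o, 'u) smodel \<Rightarrow> nat \<Rightarrow> 'o \<Rightarrow> 'u list \<Rightarrow> 'u" where
  "m_op A n w as = alg A n (w, as)"

locale sigma_model = eq_presentation E for E :: "'o pres" +
  fixes A :: "('o, 'u) smodel"
  assumes model: "sig_model E A"
begin

lemma functor_car: "is_functor FF SET (car A)"
  and alg_hom: "psh_hom (sigF E (car A)) (car A) (alg A)"
  and unit_hom: "psh_hom (yon 1) (car A) (unit A)"
  and mult_hom: "psh_hom (tens (car A) (car A)) (car A) (mult A)"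
  and monoid_left: "c \<in> fob (tens (yon 1) (car A)) n \<Longrightarrow>
    mult A n (tens_map (car A) (car A) (unit A) (\<lambda>_ x. x) n c) = lunit n c"
  and monoid_right: "c' \<in> fob (tens (car A) (yon 1)) n \<Longrightarrow>
    mult A n (tens_map (car A) (car A) (\<lambda>_ x. x) (unit A) n c') = runit (car A) n c'"
  using model by (auto simp: sig_model_def monoid_def)

lemma monoid_assoc: "c \<in> fob (tens (tens (car A) (car A)) (car A)) n \<Longrightarrow>
    mult A n (tens_map (car A) (car A) (mult A) (\<lambda>_ x. x) n c) =
    mult A n (tens_map (car A) (car A) (\<lambda>_ x. x) (mult A) n (assoc (car A) (car A) (car A) n c))"
  using model unfolding sig_model_def monoid_def by blast

lemma alg_strength: "c \<in> fob (tens (sigF E (car A)) (car A)) n \<Longrightarrow>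
    mult A n (tens_map (car A) (car A) (alg A) (\<lambda>_ x. x) n c) =
    alg A n (sigF_map E (mult A) n (strength E (car A) (car A) (unit A) n c))"
  using model unfolding sig_model_def by blast

lemma closed_car: "psh_closed (car A)"
  by (rule psh_closed_functor[OF functor_car])

lemma m_var_in: "i < n \<Longrightarrow> m_var A n i \<in> fob (car A) n"
  unfolding m_var_def using psh_hom_in[OF unit_hom] pt_in by simp

text \<open>
  The right unit law, evaluated at a tuple of elements of \<open>y1(n)\<close>, says that the functorial action of
  \<open>f\<close> is the substitution of variables.
\<close>

lemma m_sub_var:
  assumes "f \<in> {..<m} \<rightarrow>\<^sub>E {..<n}" "a \<in> fob (car A) m"
  shows "m_sub A m n a (map (\<lambda>i. m_var A n (f i)) [0..<m]) = far (car A) m n f a"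
proof -
  have r: "(m, a, map (\<lambda>i. pt (f i)) [0..<m]) \<in> tens_raw (car A) (yon 1) n"
    using assms pt_in by (auto simp: PiE_def Pi_def)
  have "mult A n (tcl (car A) (car A) n (m, a, map (unit A n) (map (\<lambda>i. pt (f i)) [0..<m]))) =
    far (car A) m n (\<lambda>i\<in>{..<m}. (map (\<lambda>i. pt (f i)) [0..<m] ! i) 0) a"
    using monoid_right[OF tcl_in_tens[OF r]] tens_map_id_left[where X = "car A" and \<psi> = "unit A", OF psh_hom_image[OF unit_hom] r]
      runit_tcl[OF functor_car r] by simp
  also have "(\<lambda>i\<in>{..<m}. (map (\<lambda>i. pt (f i)) [0..<m] ! i) 0) = f"
    using assms(1) by (auto simp: fun_eq_iff PiE_def extensional_def)
  finally show ?thesis by (simp add: m_sub_def m_var_def o_def)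
qed

lemma m_sub_incl:
  assumes "a \<in> fob (car A) m"
  shows "far (car A) m (m + p) (incl m p) a = m_sub A m (m + p) a (map (m_var A (m + p)) [0..<m])"
proof -
  have e: "map (\<lambda>i. m_var A (m + p) (incl m p i)) [0..<m] = map (m_var A (m + p)) [0..<m]"
    by (auto simp: incl_def)
  show ?thesis using m_sub_var[OF incl_in assms, of p] unfolding e by simp
qed

text \<open>
  The clone laws are the monoid laws and the compatibility with the strength, evaluated at classes of
  triples.
\<close>

lemma op_clone: "op_clone E (fob (car A)) (m_var A) (m_sub A) (m_op A)"
proof
  let ?X = "car A"
  show "i < n \<Longrightarrow> m_var A n i \<in> fob ?X n" for i n by (rule m_var_in)
  show si: "m_sub A m n a b \<in> fob ?X n" if "a \<in> fob ?X m" "length b = m" "set b \<subseteq> fob ?X n" for a m b n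
    unfolding m_sub_def by (rule psh_hom_in[OF mult_hom tcl_in_tens]) (use that in simp)
  show "m_op A n w as \<in> fob ?X n" if "w \<in> ops E" "list_all2 (\<lambda>p a. a \<in> fob ?X (n + p)) (arity E w) as" for w n as
    unfolding m_op_def by (rule psh_hom_in[OF alg_hom]) (use that in \<open>simp add: fob_sigF\<close>)
  show "m_sub A m n (m_var A m i) b = b ! i" if "length b = m" "set b \<subseteq> fob ?X n" "i < m" for b m n i
  proof -
    have r: "(m, pt i, b) \<in> tens_raw (yon 1) ?X n" using that pt_in by auto
    show ?thesis unfolding m_sub_def m_var_def
      using monoid_left[OF tcl_in_tens[OF r]] tens_map_id_right[OF unit_hom r] lunit_tcl[OF r] by simp
  qed
  show "m_sub A n n a (map (m_var A n) [0..<n]) = a" if a: "a \<in> fob ?X n" for a n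
  proof -
    have "(\<lambda>i\<in>{..<n}. i) \<in> {..<n} \<rightarrow>\<^sub>E {..<n}" by auto
    moreover have e: "map (\<lambda>i. m_var A n ((\<lambda>i\<in>{..<n}. i) i)) [0..<n] = map (m_var A n) [0..<n]" by auto
    ultimately show ?thesis
      using m_sub_var[of "\<lambda>i\<in>{..<n}. i" n n a] a psh_ident[OF functor_car a] unfolding e by simp
  qed
  show "m_sub A m n (m_sub A k m a b) c = m_sub A k n a (map (\<lambda>x. m_sub A m n x c) b)"
    if "a \<in> fob ?X k" "length b = k" "set b \<subseteq> fob ?X m" "length c = m" "set c \<subseteq> fob ?X n" for a k b m c n
  proof -
    have r: "(k, a, b) \<in> tens_raw ?X ?X m" using that by simp
    have r1: "(m, tcl ?X ?X m (k, a, b), c) \<in> tens_raw (tens ?X ?X) ?X n" using tcl_in_tens[OF r] that by simp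
    have r2: "(k, a, map (\<lambda>b'. tcl ?X ?X n (m, b', c)) b) \<in> tens_raw ?X (tens ?X ?X) n"
      using that by (auto intro!: tcl_in_tens)
    show ?thesis unfolding m_sub_def
      using monoid_assoc[OF tcl_in_tens[OF r1]] tens_map_id_right[OF mult_hom r1]
        assoc_tcl[OF closed_car r that(4,5)] tens_map_id_left[where X = ?X and \<psi> = "mult A", OF psh_hom_image[OF mult_hom] r2]
      by (simp add: o_def)
  qed
  show "m_sub A m n (m_op A m w as) b =
      m_op A n w (map2 (\<lambda>p a. m_sub A (m + p) (n + p) a (lift_env (m_var A) (m_sub A) n p b)) (arity E w) as)"
    if "w \<in> ops E" "list_all2 (\<lambda>p a. a \<in> fob ?X (m + p)) (arity E w) as" "length b = m" "set b \<subseteq> fob ?X n" for w m as b n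
  proof -
    have r: "(m, (w, as), b) \<in> tens_raw (sigF E ?X) ?X n" using that by (auto simp: fob_sigF)
    have \<eta>: "unit A (n + p) (pt (n + j)) \<in> fob ?X (n + p)" if "j < p" for p j
      using m_var_in[of "n + j" "n + p"] that by (simp add: m_var_def)
    have le: "map (far ?X n (n + p) (incl n p)) b @ map (\<lambda>j. unit A (n + p) (pt (n + j))) [0..<p] =
        lift_env (m_var A) (m_sub A) n p b" for p
      unfolding lift_env_def using that(4)
      by (intro arg_cong2[where f = "(@)"] map_cong refl m_sub_incl nth_equalityI) (auto simp: m_var_def)
    have "strength E ?X ?X (unit A) n (tcl (sigF E ?X) ?X n (m, (w, as), b)) =
      (w, map2 (\<lambda>p a. tcl ?X ?X (n + p) (m + p, a, lift_env (m_var A) (m_sub A) n p b)) (arity E w) as)"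
      unfolding le[symmetric] by (rule strength_tcl[OF closed_car _ r]) (rule \<eta>)
    then have "m_sub A m n (m_op A m w as) b = alg A n (sigF_map E (mult A) n
      (w, map2 (\<lambda>p a. tcl ?X ?X (n + p) (m + p, a, lift_env (m_var A) (m_sub A) n p b)) (arity E w) as))"
      unfolding m_sub_def m_op_def using alg_strength[OF tcl_in_tens[OF r]] tens_map_id_right[OF alg_hom r] by simp
    also have "\<dots> = m_op A n w (map2 (\<lambda>p a. m_sub A (m + p) (n + p) a (lift_env (m_var A) (m_sub A) n p b)) (arity E w) as)"
      unfolding sigF_map_def prod.case m_op_def m_sub_def
      by (rule arg_cong[where f = "\<lambda>x. alg A n (w, x)"]) (auto intro!: nth_equalityI)
    finally show ?thesis .
  qed
qed

sublocale op_clone E "fob (car A)" "m_var A" "m_sub A" "m_op A"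
  by (rule op_clone)

lemma far_incl_mwk:
  assumes "menv \<Theta> k \<theta>"
  shows "far (prodexp (car A) \<Theta>) k (k + p) (incl k p) \<theta> = mwk \<Theta> k p \<theta>"
proof (rule nth_equalityI)
  have la: "list_all2 (\<lambda>p a. a \<in> fob (car A) (k + p)) \<Theta> \<theta>"
    using assms by (auto simp: menv_def list_all2_conv_all_nth)
  note e = far_prodexp[OF incl_in[of k p] la]
  show "length (far (prodexp (car A) \<Theta>) k (k + p) (incl k p) \<theta>) = length (mwk \<Theta> k p \<theta>)"
    unfolding e mwk_def length_msb[OF assms] using menv_len[OF assms] by simp
  fix j assume "j < length (far (prodexp (car A) \<Theta>) k (k + p) (incl k p) \<theta>)"
  then have j: "j < length \<Theta>" unfolding e by simp
  let ?m = "\<Theta> ! j" and ?f = "fplus k (k + p) (incl k p) (\<Theta> ! j)"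
  have "map (\<lambda>i. m_var A (k + p + ?m) (?f i)) [0..<k + ?m] = lft (k + p) ?m (vars k (k + p))"
    by (rule nth_equalityI) (auto simp: nth_lft fplus_def incl_def s_vars[OF env_vars])
  then show "far (prodexp (car A) \<Theta>) k (k + p) (incl k p) \<theta> ! j = mwk \<Theta> k p \<theta> ! j"
    using m_sub_var[OF fplus_hom[OF incl_in[of k p]] menv_nth[OF assms j]] j menv_len[OF assms]
    unfolding e mwk_def nth_msb[OF assms j] by simp
qed

text \<open>
  The transposes in the interpretation of operators amount to weakening \<open>\<theta>\<close> and lifting the environment of
  variables given by \<open>\<rho>\<close>, as in \<open>ev\<close>.
\<close>

lemma interp_eq_ev:
  assumes "wf_trm E \<Theta> n t" "menv \<Theta> k \<theta>" "\<rho> \<in> {..<n} \<rightarrow>\<^sub>E {..<k}"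
  shows "interp A \<Theta> n t k (\<theta>, \<rho>) = ev \<Theta> k \<theta> (map (\<lambda>i. m_var A k (\<rho> i)) [0..<n]) t"
  using assms
proof (induction arbitrary: k \<theta> \<rho> rule: wf_trm.induct)
  case (wf_Var i n)
  then show ?case by (simp add: unit_n_def m_var_def[symmetric])
next
  case (wf_MVar j ts n)
  have "map (\<lambda>t. interp A \<Theta> n t k (\<theta>, \<rho>)) ts = map (ev \<Theta> k \<theta> (map (\<lambda>i. m_var A k (\<rho> i)) [0..<n])) ts"
    using wf_MVar.IH[OF _ wf_MVar.prems] by simp
  then show ?case by (simp add: mult_n_def m_sub_def[symmetric] vars_def m_var_def[symmetric] cong: map_cong)
next
  case (wf_Op w as n)
  note p = wf_Op.prems
  have la: "list_all2 (\<lambda>p a. a \<in> fob (car A) (k + p)) \<Theta> \<theta>"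
    using p(1) by (auto simp: menv_def list_all2_conv_all_nth)
  have "transpose_psh (ctx A \<Theta> n) q (\<lambda>l ((\<theta>, \<rho>), \<sigma>). interp A \<Theta> (n + q) t l (\<theta>, copair n q \<rho> \<sigma>)) k (\<theta>, \<rho>) =
     ev \<Theta> (k + q) (mwk \<Theta> k q \<theta>) (lft k q (map (\<lambda>i. m_var A k (\<rho> i)) [0..<n])) t" if qt: "(q, t) \<in> set as" for q t
  proof -
    let ?\<rho> = "copair n q (compose {..<n} (incl k q) \<rho>) (incr k q)"
    have \<rho>: "i < n \<Longrightarrow> \<rho> i < k" for i using p(2) by (auto simp: PiE_def Pi_def)
    have f: "far (ctx A \<Theta> n) k (k + q) (incl k q) (\<theta>, \<rho>) = (mwk \<Theta> k q \<theta>, compose {..<n} (incl k q) \<rho>)"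
      unfolding ctx_def pprod_def using incl_in[of k q] p la
      by (subst far_mk_psh) (auto simp: far_incl_mwk far_yon)
    have \<rho>': "?\<rho> \<in> {..<n + q} \<rightarrow>\<^sub>E {..<k + q}"
    proof (rule PiE_I)
      fix i assume i: "i \<in> {..<n + q}"
      show "?\<rho> i \<in> {..<k + q}"
      proof (cases "i < n")
        case True
        then show ?thesis using \<rho>[OF True] by (simp add: copair_def compose_def incl_def)
      next
        case False
        then have "i - n < q" using i by auto
        then show ?thesis using False i by (simp add: copair_def incr_def)
      qed
    qed (simp add: copair_def)
    have "map (\<lambda>i. m_var A (k + q) (?\<rho> i)) [0..<n + q] = lft k q (map (\<lambda>i. m_var A k (\<rho> i)) [0..<n])"
      using \<rho> by (intro nth_equalityI) (auto simp: nth_lft copair_def compose_def incl_def incr_def s_vars[OF env_vars])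
    then show ?thesis
      unfolding transpose_psh_def f prod.case using wf_Op.IH[OF qt menv_mwk[OF p(1)] \<rho>'] by simp
  qed
  then show ?case unfolding interp.simps ev.simps m_op_def[symmetric] by (auto cong: map_arity_cong)
qed

text \<open>
  Satisfaction tests an equation only in environments of variables, validity in all; these agree by
  \<open>validI_vars\<close>.
\<close>

lemma satisfies_iff_valid:
  assumes "wf_trm E \<Theta> n t" "wf_trm E \<Theta> n t'"
  shows "satisfies A (\<Theta>, n, t, t') \<longleftrightarrow> valid \<Theta> n t t'"
proof -
  have z: "(\<theta>, \<rho>) \<in> fob (ctx A \<Theta> n) k \<longleftrightarrow> menv \<Theta> k \<theta> \<and> \<rho> \<in> {..<n} \<rightarrow>\<^sub>E {..<k}" for \<theta> \<rho> k
    by (auto simp: ctx_def pprod_def menv_def list_all2_conv_all_nth)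
  show ?thesis
  proof
    assume s: "satisfies A (\<Theta>, n, t, t')"
    show "valid \<Theta> n t t'"
    proof (rule validI_vars[OF assms])
      fix k \<theta>0 assume m0: "menv \<Theta> k \<theta>0"
      define \<theta> where "\<theta> = msb \<Theta> k (n + k) (new_vars n k) \<theta>0"
      have m: "menv \<Theta> (n + k) \<theta>" unfolding \<theta>_def by (rule menv_msb[OF m0 env_new_vars])
      have "map (\<lambda>i. m_var A (n + k) (incl n k i)) [0..<n] = vars n (n + k)"
        by (auto simp: vars_def incl_def)
      then show "ev \<Theta> (n + k) (msb \<Theta> k (n + k) (new_vars n k) \<theta>0) (vars n (n + k)) t =
          ev \<Theta> (n + k) (msb \<Theta> k (n + k) (new_vars n k) \<theta>0) (vars n (n + k)) t'"
        unfolding \<theta>_def[symmetric]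
        using s z[of \<theta> "incl n k" "n + k"] m incl_in[of n k]
          interp_eq_ev[OF assms(1) m incl_in] interp_eq_ev[OF assms(2) m incl_in]
        by (simp add: satisfies_def)
    qed
  next
    assume v: "valid \<Theta> n t t'"
    show "satisfies A (\<Theta>, n, t, t')"
      unfolding satisfies_def prod.case
    proof (intro allI ballI)
      fix k z assume "z \<in> fob (ctx A \<Theta> n) k"
      then obtain \<theta> \<rho> where zz: "z = (\<theta>, \<rho>)" and m: "menv \<Theta> k \<theta>" and r: "\<rho> \<in> {..<n} \<rightarrow>\<^sub>E {..<k}"
        using z by (cases z) auto
      have "env n k (map (\<lambda>i. m_var A k (\<rho> i)) [0..<n])"
        using r by (intro envI) (auto intro!: v_in simp: PiE_def Pi_def)
      then show "interp A \<Theta> n t k z = interp A \<Theta> n t' k z"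
        unfolding zz interp_eq_ev[OF assms(1) m r] interp_eq_ev[OF assms(2) m r] using v m by (simp add: valid_def)
    qed
  qed
qed

end

text \<open>
  Naturality is not an extra condition on
  a clone homomorphism, since the functorial action is substitution of variables (\<open>m_sub_var\<close>).
\<close>

lemma model_hom_iff:
  assumes "sigma_model E A" "sigma_model E B"
  shows "model_hom E A B h \<longleftrightarrow> (\<forall>n. h n \<in> fob (car A) n \<rightarrow>\<^sub>E fob (car B) n) \<and>
     clone_hom E (fob (car A)) (m_var A) (m_sub A) (m_op A) (fob (car B)) (m_var B) (m_sub B) (m_op B) h"
proof -
  interpret A: sigma_model E A by fact
  interpret B: sigma_model E B by fact
  have tm: "tens_map (car B) (car B) h h n (tcl (car A) (car A) n (m, a, b)) = tcl (car B) (car B) n (m, h m a, map (h n) b)"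
    if "psh_hom (car A) (car B) h" "(m, a, b) \<in> tens_raw (car A) (car A) n" for m a b n
    by (rule tens_map_tcl[where \<psi> = h, OF that(1) psh_hom_image[OF that(1)] that(2)])
  show ?thesis
  proof
    assume h: "model_hom E A B h"
    then have ph: "psh_hom (car A) (car B) h" by (simp add: model_hom_def)
    have "clone_hom E (fob (car A)) (m_var A) (m_sub A) (m_op A) (fob (car B)) (m_var B) (m_sub B) (m_op B) h"
    proof
      show "a \<in> fob (car A) n \<Longrightarrow> h n a \<in> fob (car B) n" for a n by (rule psh_hom_in[OF ph])
      show "h n (m_var A n i) = m_var B n i" if "i < n" for i n
        using h pt_in[OF that] by (simp add: model_hom_def m_var_def)
      show "h n (m_sub A m n a b) = m_sub B m n (h m a) (map (h n) b)"
        if "a \<in> fob (car A) m" "length b = m" "set b \<subseteq> fob (car A) n" for a m b n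
      proof -
        have r: "(m, a, b) \<in> tens_raw (car A) (car A) n" using that by simp
        show ?thesis using h tcl_in_tens[OF r] tm[OF ph r] by (simp add: model_hom_def m_sub_def)
      qed
      show "h n (m_op A n w as) = m_op B n w (map2 (\<lambda>p. h (n + p)) (arity E w) as)"
        if "w \<in> ops E" "list_all2 (\<lambda>p a. a \<in> fob (car A) (n + p)) (arity E w) as" for w n as
        using h that by (auto simp: model_hom_def m_op_def sigF_map_def fob_sigF)
    qed
    then show "(\<forall>n. h n \<in> fob (car A) n \<rightarrow>\<^sub>E fob (car B) n) \<and>
     clone_hom E (fob (car A)) (m_var A) (m_sub A) (m_op A) (fob (car B)) (m_var B) (m_sub B) (m_op B) h"
      using psh_hom_ext[OF ph] by blast
  next
    assume hh: "(\<forall>n. h n \<in> fob (car A) n \<rightarrow>\<^sub>E fob (car B) n) \<and>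
     clone_hom E (fob (car A)) (m_var A) (m_sub A) (m_op A) (fob (car B)) (m_var B) (m_sub B) (m_op B) h"
    then interpret clone_hom E "fob (car A)" "m_var A" "m_sub A" "m_op A" "fob (car B)" "m_var B" "m_sub B" "m_op B" h
      by blast
    have ph: "psh_hom (car A) (car B) h"
      unfolding psh_hom_def
    proof (intro conjI allI impI ballI)
      show "h k \<in> fob (car A) k \<rightarrow>\<^sub>E fob (car B) k" for k using hh by blast
      fix k l f x assume f: "f \<in> hom FF k l" and x: "x \<in> fob (car A) k"
      have fl: "i < k \<Longrightarrow> f i < l" for i using f by (auto simp: PiE_def Pi_def)
      have fs: "set (map (\<lambda>i. m_var A l (f i)) [0..<k]) \<subseteq> fob (car A) l"
        using fl by (auto intro: A.v_in)
      have "map (h l) (map (\<lambda>i. m_var A l (f i)) [0..<k]) = map (\<lambda>i. m_var B l (f i)) [0..<k]"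
        using fl by (auto simp: h_v)
      then show "h l (far (car A) k l f x) = far (car B) k l f (h k x)"
        using A.m_sub_var[of f k l x] B.m_sub_var[of f k l "h k x"] f x h_in[OF x]
          h_s[OF x _ fs] by (simp del: map_map)
    qed
    show "model_hom E A B h"
      unfolding model_hom_def
    proof (intro conjI allI ballI ph)
      fix n u assume "u \<in> fob (sigF E (car A)) n"
      then show "h n (alg A n u) = alg B n (sigF_map E h n u)"
        using h_opn by (auto simp: fob_sigF sigF_map_def m_op_def)
    next
      fix n i assume i: "i \<in> fob (yon 1) n"
      then show "h n (unit A n i) = unit B n i"
        using h_v[OF yon_1_less[OF i[unfolded fob_yon]]] yon_1_eq_pt[OF i[unfolded fob_yon]] by (simp add: m_var_def)
    next
      fix n c assume "c \<in> fob (tens (car A) (car A)) n"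
      then obtain m a b where r: "(m, a, b) \<in> tens_raw (car A) (car A) n" and c: "c = tcl (car A) (car A) n (m, a, b)"
        unfolding fob_tens by blast
      show "h n (mult A n c) = mult B n (tens_map (car B) (car B) h h n c)"
        unfolding c tm[OF ph r] using h_s[of a m b n] r by (simp add: m_sub_def)
    qed
  qed
qed

section \<open>Abstract clones as models\<close>

context op_clone
begin

text \<open>
  Conversely, a clone becomes a presheaf by letting renamings act as substitutions of
  variables, and a model by extending its operations by \<open>undefined\<close>.
\<close>

definition clone_psh :: "'u psh" where
  "clone_psh = mk_psh S (\<lambda>k l f x. s k l x (map (\<lambda>i. v l (f i)) [0..<k]))"

definition clone_model :: "('o, 'u) smodel" where
  "clone_model = \<lparr>car = clone_psh,
     alg = (\<lambda>n. \<lambda>u\<in>fob (sigF E clone_psh) n. opn n (fst u) (snd u)),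
     unit = (\<lambda>n. \<lambda>i\<in>fob (yon 1) n. v n (i 0)),
     mult = (\<lambda>n. \<lambda>c\<in>fob (tens clone_psh clone_psh) n. lift (\<lambda>k a b. s k n a b) c)\<rparr>"

lemma fob_clone_psh [simp]: "fob clone_psh = S"
  by (simp add: clone_psh_def)

lemma far_clone_psh: "f \<in> {..<k} \<rightarrow>\<^sub>E {..<l} \<Longrightarrow> x \<in> S k \<Longrightarrow>
    far clone_psh k l f x = s k l x (map (\<lambda>i. v l (f i)) [0..<k])"
  unfolding clone_psh_def by (subst far_mk_psh) auto

lemma env_ren: "f \<in> {..<k} \<rightarrow>\<^sub>E {..<l} \<Longrightarrow> env k l (map (\<lambda>i. v l (f i)) [0..<k])"
  by (rule envI) (auto intro!: v_in simp: PiE_def Pi_def)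

lemma cmp_ren: "f \<in> {..<k} \<rightarrow>\<^sub>E {..<l} \<Longrightarrow> env l n c \<Longrightarrow>
    cmp l n c (map (\<lambda>i. v l (f i)) [0..<k]) = map (\<lambda>i. c ! f i) [0..<k]"
  by (rule nth_equalityI) (auto simp: nth_cmp s_vars PiE_def Pi_def)

lemma closed_clone_psh: "psh_closed clone_psh"
  unfolding psh_closed_def by (auto simp: far_clone_psh intro!: s_env env_ren)

lemma functor_clone_psh: "is_functor FF SET clone_psh"
  unfolding is_functor_def
proof (intro conjI allI ballI impI)
  show "fob clone_psh \<in> obj FF \<rightarrow>\<^sub>E obj SET" by simp
  show "far clone_psh k l \<in> hom FF k l \<rightarrow>\<^sub>E hom SET (fob clone_psh k) (fob clone_psh l)" for k l
  proof (rule PiE_I)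
    fix f assume f: "f \<in> hom FF k l"
    show "far clone_psh k l f \<in> hom SET (fob clone_psh k) (fob clone_psh l)"
      unfolding SET_simps
    proof (rule PiE_I)
      show "far clone_psh k l f x \<in> fob clone_psh l" if "x \<in> fob clone_psh k" for x
        using closed_clone_psh f that unfolding psh_closed_def by blast
      show "far clone_psh k l f x = undefined" if "x \<notin> fob clone_psh k" for x
        using f that by (simp add: clone_psh_def mk_psh_def)
    qed
  qed (simp add: clone_psh_def mk_psh_def)
  have far_ext: "far clone_psh k l f x = undefined" if "f \<in> {..<k} \<rightarrow>\<^sub>E {..<l}" "x \<notin> S k" for k l f x
    using that by (simp add: clone_psh_def mk_psh_def)
  fix k
  show "far clone_psh k k (ident FF k) = ident SET (fob clone_psh k)"
  proof
    fix x
    have "map (\<lambda>i. v k ((\<lambda>i\<in>{..<k}. i) i)) [0..<k] = map (v k) [0..<k]" by auto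
    then show "far clone_psh k k (ident FF k) x = ident SET (fob clone_psh k) x"
      using far_clone_psh[of "\<lambda>i\<in>{..<k}. i" k k x] far_ext[of "\<lambda>i\<in>{..<k}. i" k k x] s_vs[of x k]
      by (cases "x \<in> S k") (auto simp del: map_eq_conv)
  qed
next
  have far_ext: "far clone_psh k l f x = undefined" if "f \<in> {..<k} \<rightarrow>\<^sub>E {..<l}" "x \<notin> S k" for k l f x
    using that by (simp add: clone_psh_def mk_psh_def)
  fix k l m f g assume "f \<in> hom FF k l" "g \<in> hom FF l m"
  then have f: "f \<in> {..<k} \<rightarrow>\<^sub>E {..<l}" and g: "g \<in> {..<l} \<rightarrow>\<^sub>E {..<m}" by auto
  have gf: "compose {..<k} g f \<in> {..<k} \<rightarrow>\<^sub>E {..<m}" using f g by (rule compose_hom)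
  show "far clone_psh k m (comp FF k l m g f) =
     comp SET (fob clone_psh k) (fob clone_psh l) (fob clone_psh m) (far clone_psh l m g) (far clone_psh k l f)"
  proof
    fix x
    show "far clone_psh k m (comp FF k l m g f) x =
       comp SET (fob clone_psh k) (fob clone_psh l) (fob clone_psh m) (far clone_psh l m g) (far clone_psh k l f) x"
    proof (cases "x \<in> S k")
      case True
      have "far clone_psh l m g (far clone_psh k l f x) =
          s k m x (map (\<lambda>i. map (\<lambda>i. v m (g i)) [0..<l] ! f i) [0..<k])"
        using True far_clone_psh[OF f True] far_clone_psh[OF g s_env[OF True env_ren[OF f]]]
          s_cmp[OF True env_ren[OF f] env_ren[OF g]] cmp_ren[OF f env_ren[OF g]] by simp
      also have "map (\<lambda>i. map (\<lambda>i. v m (g i)) [0..<l] ! f i) [0..<k] = map (\<lambda>i. v m (compose {..<k} g f i)) [0..<k]"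
        using f by (auto simp: compose_def PiE_def Pi_def)
      finally show ?thesis using True far_clone_psh[OF gf True] by (simp add: compose_def)
    qed (use far_ext[OF gf] in \<open>simp add: compose_def\<close>)
  qed
qed

lemma clone_model_simps [simp]:
  "car clone_model = clone_psh"
  "w \<in> ops E \<Longrightarrow> list_all2 (\<lambda>p a. a \<in> S (n + p)) (arity E w) as \<Longrightarrow> alg clone_model n (w, as) = opn n w as"
  "i < n \<Longrightarrow> unit clone_model n (pt i) = v n i"
  using pt_in[of i n] by (auto simp: clone_model_def fob_sigF)

lemma unit_clone_model: "\<rho> \<in> {..<1} \<rightarrow>\<^sub>E {..<n} \<Longrightarrow> unit clone_model n \<rho> = v n (\<rho> 0)"
  by (simp add: clone_model_def)

text \<open>
  Substitution is constant on the classes of the tensor, because acting by \<open>f\<close> and then substituting \<open>b\<close>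
  is, by associativity, substituting \<open>b \<circ> f\<close>.
\<close>

lemma mult_clone_model:
  assumes "a \<in> S m" "length b = m" "set b \<subseteq> S n"
  shows "mult clone_model n (tcl clone_psh clone_psh n (m, a, b)) = s m n a b"
proof -
  have r: "(m, a, b) \<in> tens_raw clone_psh clone_psh n" using assms by simp
  have "lift (\<lambda>k a b. s k n a b) (tcl clone_psh clone_psh n (m, a, b)) = s m n a b"
  proof (rule lift_tcl[OF _ r])
    fix k l f a b assume "f \<in> hom FF k l" "a \<in> fob clone_psh k" "length b = l" "set b \<subseteq> fob clone_psh n"
    then have f: "f \<in> {..<k} \<rightarrow>\<^sub>E {..<l}" and a: "a \<in> S k" and b: "env l n b" by (auto simp: env_def)
    show "s l n (far clone_psh k l f a) b = s k n a (map (\<lambda>i. b ! f i) [0..<k])"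
      unfolding far_clone_psh[OF f a] s_cmp[OF a env_ren[OF f] b] cmp_ren[OF f b] ..
  qed
  then show ?thesis using tcl_in_tens[OF r] by (simp add: clone_model_def)
qed

lemma unit_clone_model_hom: "psh_hom (yon 1) clone_psh (unit clone_model)"
  unfolding psh_hom_def
proof (intro conjI allI impI ballI)
  show "unit clone_model k \<in> fob (yon 1) k \<rightarrow>\<^sub>E fob clone_psh k" for k
  proof (rule PiE_I)
    fix \<rho> assume "\<rho> \<in> fob (yon 1) k"
    then have \<rho>: "\<rho> \<in> {..<1} \<rightarrow>\<^sub>E {..<k}" by (simp only: fob_yon)
    show "unit clone_model k \<rho> \<in> fob clone_psh k"
      unfolding unit_clone_model[OF \<rho>] using v_in[OF yon_1_less[OF \<rho>]] by simp
  qed (simp add: clone_model_def)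
  fix k l f \<rho> assume "f \<in> hom FF k l" "\<rho> \<in> fob (yon 1) k"
  then have f: "f \<in> {..<k} \<rightarrow>\<^sub>E {..<l}" and \<rho>: "\<rho> \<in> {..<1} \<rightarrow>\<^sub>E {..<k}" by (simp_all only: FF_simps fob_yon)
  have c: "compose {..<1} f \<rho> \<in> {..<1} \<rightarrow>\<^sub>E {..<l}" using \<rho> f by (rule compose_hom)
  have "s k l (v k (\<rho> 0)) (map (\<lambda>i. v l (f i)) [0..<k]) = v l (f (\<rho> 0))"
    using s_vars[OF env_ren[OF f] yon_1_less[OF \<rho>]] yon_1_less[OF \<rho>] by simp
  moreover have "compose {..<1} f \<rho> 0 = f (\<rho> 0)" by (rule compose_eq) simp
  ultimately show "unit clone_model l (far (yon 1) k l f \<rho>) = far clone_psh k l f (unit clone_model k \<rho>)"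
    unfolding far_yon[OF f \<rho>] unit_clone_model[OF c] unit_clone_model[OF \<rho>]
      far_clone_psh[OF f v_in[OF yon_1_less[OF \<rho>]]] by simp
qed

lemma mult_clone_model_hom: "psh_hom (tens clone_psh clone_psh) clone_psh (mult clone_model)"
  unfolding psh_hom_def
proof (intro conjI allI impI ballI)
  show "mult clone_model k \<in> fob (tens clone_psh clone_psh) k \<rightarrow>\<^sub>E fob clone_psh k" for k
  proof (rule PiE_I)
    fix c assume "c \<in> fob (tens clone_psh clone_psh) k"
    then show "mult clone_model k c \<in> fob clone_psh k"
      unfolding fob_tens by (auto simp: mult_clone_model intro!: s_in)
  qed (simp add: clone_model_def)
  fix k l f c assume f: "f \<in> hom FF k l" and c: "c \<in> fob (tens clone_psh clone_psh) k"
  obtain m a b where r: "(m, a, b) \<in> tens_raw clone_psh clone_psh k" and c: "c = tcl clone_psh clone_psh k (m, a, b)"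
    using c unfolding fob_tens by blast
  have f': "f \<in> {..<k} \<rightarrow>\<^sub>E {..<l}" and a: "a \<in> S m" and b: "env m k b" using f r by (auto simp: env_def)
  have fb: "map (far clone_psh k l f) b = cmp k l (map (\<lambda>i. v l (f i)) [0..<k]) b"
    using b f' by (auto simp: env_def cmp_def far_clone_psh)
  have e: "env m l (cmp k l (map (\<lambda>i. v l (f i)) [0..<k]) b)" by (rule env_cmp[OF b env_ren[OF f']])
  show "mult clone_model l (far (tens clone_psh clone_psh) k l f c) = far clone_psh k l f (mult clone_model k c)"
    unfolding c far_tens[OF closed_clone_psh f r] fb
    using mult_clone_model[OF a, of "cmp k l (map (\<lambda>i. v l (f i)) [0..<k]) b" l] e mult_clone_model[OF a, of b k] b
      far_clone_psh[OF f' s_env[OF a b]] s_cmp[OF a b env_ren[OF f']]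
    by (simp add: env_def)
qed

lemma alg_clone_model_hom: "psh_hom (sigF E clone_psh) clone_psh (alg clone_model)"
  unfolding psh_hom_def
proof (intro conjI allI impI ballI)
  show "alg clone_model k \<in> fob (sigF E clone_psh) k \<rightarrow>\<^sub>E fob clone_psh k" for k
  proof (rule PiE_I)
    fix u assume "u \<in> fob (sigF E clone_psh) k"
    then show "alg clone_model k u \<in> fob clone_psh k"
      unfolding fob_sigF by (auto intro!: opn_in)
  qed (simp add: clone_model_def)
  fix k l f u assume f: "f \<in> hom FF k l" and u: "u \<in> fob (sigF E clone_psh) k"
  obtain w as where u: "u = (w, as)" and w: "w \<in> ops E" and as: "list_all2 (\<lambda>p a. a \<in> fob clone_psh (k + p)) (arity E w) as"
    using u unfolding fob_sigF by blast
  have f': "f \<in> {..<k} \<rightarrow>\<^sub>E {..<l}" using f by simp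
  note e = env_ren[OF f']
  have as': "list_all2 (\<lambda>p a. a \<in> S (k + p)) (arity E w) as" using as by simp
  have lf: "lft l p (map (\<lambda>i. v l (f i)) [0..<k]) = map (\<lambda>i. v (l + p) (fplus k l f p i)) [0..<k + p]" for p
    using f' by (intro nth_equalityI) (auto simp: nth_lft fplus_def s_vars[OF env_vars] PiE_def Pi_def)
  have e1: "map2 (\<lambda>p. far clone_psh (k + p) (l + p) (fplus k l f p)) (arity E w) as =
      map2 (\<lambda>p a. s (k + p) (l + p) a (lft l p (map (\<lambda>i. v l (f i)) [0..<k]))) (arity E w) as"
    by (rule map2_cong_all2, rule list_all2_mono[OF as']) (simp add: far_clone_psh[OF fplus_hom[OF f']] lf)
  have "list_all2 (\<lambda>p a. a \<in> S (l + p)) (arity E w)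
     (map2 (\<lambda>p a. s (k + p) (l + p) a (lft l p (map (\<lambda>i. v l (f i)) [0..<k]))) (arity E w) as)"
    using as' by (auto simp: list_all2_conv_all_nth intro!: s_env env_lft e)
  then show "alg clone_model l (far (sigF E clone_psh) k l f u) = far clone_psh k l f (alg clone_model k u)"
    unfolding u far_sigF[OF f' w as] e1 using w as' s_opn[OF w as' _ e[unfolded env_def, THEN conjunct2]]
      far_clone_psh[OF f' opn_in[OF w as']] by simp
qed

lemma sig_model_clone_model: "sig_model E clone_model"
proof -
  let ?X = clone_psh and ?A = clone_model
  have "mult ?A n (tens_map ?X ?X (unit ?A) (\<lambda>_ x. x) n c) = lunit n c"
    if c: "c \<in> fob (tens (yon 1) ?X) n" for n c
  proof -
    obtain k \<rho> b where r: "(k, \<rho>, b) \<in> tens_raw (yon 1) ?X n" and c: "c = tcl (yon 1) ?X n (k, \<rho>, b)"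
      using c unfolding fob_tens by blast
    have \<rho>: "\<rho> \<in> {..<1} \<rightarrow>\<^sub>E {..<k}" and b: "length b = k" "set b \<subseteq> S n" using r by (auto simp only: tens_raw_iff fob_yon fob_clone_psh)
    show ?thesis
      unfolding c tens_map_id_right[OF unit_clone_model_hom r] lunit_tcl[OF r] unit_clone_model[OF \<rho>]
      using mult_clone_model[OF v_in b] s_v[OF b] yon_1_less[OF \<rho>] by simp
  qed
  moreover have "mult ?A n (tens_map ?X ?X (\<lambda>_ x. x) (unit ?A) n c) = runit ?X n c"
    if c: "c \<in> fob (tens ?X (yon 1)) n" for n c
  proof -
    obtain k a b where r: "(k, a, b) \<in> tens_raw ?X (yon 1) n" and c: "c = tcl ?X (yon 1) n (k, a, b)"
      using c unfolding fob_tens by blast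
    let ?f = "\<lambda>i\<in>{..<k}. (b ! i) 0"
    have a: "a \<in> S k" and bl: "length b = k" and bs: "set b \<subseteq> {..<1} \<rightarrow>\<^sub>E {..<n}"
      using r unfolding tens_raw_iff fob_yon fob_clone_psh by blast+
    have b: "b ! i \<in> {..<1} \<rightarrow>\<^sub>E {..<n}" if "i < k" for i
      by (rule subsetD[OF bs]) (simp add: bl that)
    have f: "?f \<in> {..<k} \<rightarrow>\<^sub>E {..<n}" using yon_1_less[OF b] by auto
    have "map (unit ?A n) b = map (\<lambda>i. v n (?f i)) [0..<k]"
      by (rule nth_equalityI) (use bl in \<open>auto simp: unit_clone_model[OF b]\<close>)
    then show ?thesis
      unfolding c tens_map_id_left[where X = ?X and \<psi> = "unit ?A", OF psh_hom_image[OF unit_clone_model_hom] r]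
        runit_tcl[OF functor_clone_psh r] far_clone_psh[OF f a]
      using mult_clone_model[OF a, of "map (\<lambda>i. v n (?f i)) [0..<k]" n] env_ren[OF f] by (simp add: env_def)
  qed
  moreover have "mult ?A n (tens_map ?X ?X (mult ?A) (\<lambda>_ x. x) n c) =
      mult ?A n (tens_map ?X ?X (\<lambda>_ x. x) (mult ?A) n (assoc ?X ?X ?X n c))"
    if c: "c \<in> fob (tens (tens ?X ?X) ?X) n" for n c
  proof -
    obtain l u d where r1: "(l, u, d) \<in> tens_raw (tens ?X ?X) ?X n" and c: "c = tcl (tens ?X ?X) ?X n (l, u, d)"
      using c unfolding fob_tens by blast
    then obtain k a b where r: "(k, a, b) \<in> tens_raw ?X ?X l" and u: "u = tcl ?X ?X l (k, a, b)"
      using fob_tens[of u] by auto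
    have a: "a \<in> S k" and b: "env k l b" and d: "env l n d" using r r1 by (auto simp: env_def)
    have r2: "(k, a, map (\<lambda>b'. tcl ?X ?X n (l, b', d)) b) \<in> tens_raw ?X (tens ?X ?X) n"
      using r r1 by (auto intro!: tcl_in_tens)
    have m: "map (mult ?A n) (map (\<lambda>b'. tcl ?X ?X n (l, b', d)) b) = cmp l n d b"
      using b d by (auto simp: cmp_def env_def mult_clone_model)
    show ?thesis
      unfolding c tens_map_id_right[OF mult_clone_model_hom r1]
      using assoc_tcl[OF closed_clone_psh r, of d ?X n] d
        tens_map_id_left[where X = ?X and \<psi> = "mult ?A", OF psh_hom_image[OF mult_clone_model_hom] r2]
        mult_clone_model[OF a, of b l] b s_cmp[OF a b d] mult_clone_model[OF s_env[OF a b], of d n]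
        mult_clone_model[OF a, of "cmp l n d b" n] env_cmp[OF b d]
      unfolding m u by (simp add: env_def)
  qed
  moreover have "mult ?A n (tens_map ?X ?X (alg ?A) (\<lambda>_ x. x) n c) =
      alg ?A n (sigF_map E (mult ?A) n (strength E ?X ?X (unit ?A) n c))"
    if c: "c \<in> fob (tens (sigF E ?X) ?X) n" for n c
  proof -
    obtain m u b where r: "(m, u, b) \<in> tens_raw (sigF E ?X) ?X n" and c: "c = tcl (sigF E ?X) ?X n (m, u, b)"
      using c unfolding fob_tens by blast
    then obtain w as where u: "u = (w, as)" and w: "w \<in> ops E" and as: "list_all2 (\<lambda>p a. a \<in> S (m + p)) (arity E w) as"
      and b: "env m n b"
      by (auto simp: fob_sigF env_def)
    have le: "map (far ?X n (n + p) (incl n p)) b @ map (\<lambda>j. unit ?A (n + p) (pt (n + j))) [0..<p] = lft n p b" (is "?lhs = ?rhs") for p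
    proof (rule nth_equalityI)
      fix i assume i: "i < length ?lhs"
      have "map (\<lambda>i. v (n + p) (incl n p i)) [0..<n] = vars n (n + p)" by (auto simp: incl_def vars_def)
      then show "?lhs ! i = ?rhs ! i"
        using i far_clone_psh[OF incl_in env_nth[OF b]] env_len[OF b] by (auto simp: nth_append nth_lft)
    qed simp
    have \<eta>: "unit ?A (n + p) (pt (n + j)) \<in> fob ?X (n + p)" if "j < p" for p j
      using that by (simp add: v_in)
    have "strength E ?X ?X (unit ?A) n (tcl (sigF E ?X) ?X n (m, (w, as), b)) =
      (w, map2 (\<lambda>p a. tcl ?X ?X (n + p) (m + p, a, lft n p b)) (arity E w) as)"
      unfolding le[symmetric] by (rule strength_tcl[OF closed_clone_psh _ r[unfolded u]]) (rule \<eta>)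
    moreover have "map2 (\<lambda>p. mult ?A (n + p)) (arity E w) (map2 (\<lambda>p a. tcl ?X ?X (n + p) (m + p, a, lft n p b)) (arity E w) as) =
        map2 (\<lambda>p a. s (m + p) (n + p) a (lft n p b)) (arity E w) as"
      using as env_lft[OF b] by (intro nth_equalityI) (auto simp: list_all2_conv_all_nth mult_clone_model env_def)
    moreover have "list_all2 (\<lambda>p a. a \<in> S (n + p)) (arity E w) (map2 (\<lambda>p a. s (m + p) (n + p) a (lft n p b)) (arity E w) as)"
      using as by (auto simp: list_all2_conv_all_nth intro!: s_env env_lft b)
    ultimately show ?thesis
      unfolding c u tens_map_id_right[OF alg_clone_model_hom r[unfolded u]]
      using w as mult_clone_model[OF opn_in[OF w as], of b n] b s_opn[OF w as, of b n]
      by (simp add: sigF_map_def env_def)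
  qed
  ultimately show ?thesis
    unfolding sig_model_def monoid_def
    using functor_clone_psh alg_clone_model_hom unit_clone_model_hom mult_clone_model_hom by simp
qed

lemma sigma_model_clone_model: "sigma_model E clone_model"
  by unfold_locales (rule sig_model_clone_model)

lemma clone_model_clone:
  "i < n \<Longrightarrow> m_var clone_model n i = v n i"
  "a \<in> S m \<Longrightarrow> length b = m \<Longrightarrow> set b \<subseteq> S n \<Longrightarrow> m_sub clone_model m n a b = s m n a b"
  "w \<in> ops E \<Longrightarrow> list_all2 (\<lambda>p a. a \<in> S (n + p)) (arity E w) as \<Longrightarrow> m_op clone_model n w as = opn n w as"
  by (simp_all add: m_var_def m_sub_def m_op_def mult_clone_model)

text \<open>
  The clone read off from \<open>clone_model\<close> differs from the given one in values outside the carrier only.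
  Presenting the identity as a homomorphism between them transports evaluation of terms.
\<close>

lemma clone_model_hom_id:
  "clone_hom E S v s opn S (m_var clone_model) (m_sub clone_model) (m_op clone_model) (\<lambda>_ x. x)"
proof -
  interpret M: sigma_model E clone_model by (rule sigma_model_clone_model)
  have M: "op_clone E S (m_var clone_model) (m_sub clone_model) (m_op clone_model)"
    using M.op_clone by simp
  have map2_id: "map2 (\<lambda>p a. a) xs ys = ys" if "length xs = length ys" for xs :: "nat list" and ys :: "'u list"
    using that by (intro nth_equalityI) auto
  show ?thesis
    by (intro clone_hom.intro op_clone_axioms M clone_hom_axioms.intro)
       (auto simp: clone_model_clone map2_id[OF list_all2_lengthD])
qed

lemma satisfies_clone_model:
  assumes "wf_trm E \<Theta> n t" "wf_trm E \<Theta> n t'" "valid \<Theta> n t t'"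
  shows "satisfies clone_model (\<Theta>, n, t, t')"
proof -
  interpret M: sigma_model E clone_model by (rule sigma_model_clone_model)
  interpret h: clone_hom E S v s opn S "m_var clone_model" "m_sub clone_model" "m_op clone_model" "\<lambda>_ x. x"
    by (rule clone_model_hom_id)
  have map2_id: "map2 (\<lambda>p a. a) xs ys = ys" if "length ys = length xs" for xs :: "nat list" and ys :: "'u list"
    using that by (intro nth_equalityI) auto
  have "M.menv \<Theta> k \<theta> \<longleftrightarrow> menv \<Theta> k \<theta>" "M.env n k e \<longleftrightarrow> env n k e" for k \<theta> n e
    by (simp_all add: M.menv_def menv_def M.env_def env_def)
  moreover have "M.ev \<Theta> k \<theta> e u = ev \<Theta> k \<theta> e u" if "menv \<Theta> k \<theta>" "env n k e" "wf_trm E \<Theta> n u" for k \<theta> e u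
    using h.h_ev[OF that(3,1,2)] that(1) by (simp add: map2_id menv_len)
  ultimately have "M.valid \<Theta> n t t'"
    using assms unfolding M.valid_def valid_def by simp
  then show ?thesis using M.satisfies_iff_valid[OF assms(1,2)] by simp
qed

end

section \<open>From models to functorial models\<close>

context eq_presentation
begin

text \<open>
  The structure of a clone is expressed by terms: \<open>sub_trm m n\<close> is
  \<open>M\<^sub>0[M\<^sub>1[x\<^sub>1,\<dots>,x\<^sub>n],\<dots>,M\<^sub>m[x\<^sub>1,\<dots>,x\<^sub>n]]\<close> with metavariables \<open>M\<^sub>0,\<dots>,M\<^sub>m\<close>, and \<open>op_trm n w\<close> applies the operator \<open>w\<close> to
  generic arguments with \<open>n\<close> parameters.  Maps respecting all terms therefore respect the structure.
\<close>

definition sub_ctx :: "nat \<Rightarrow> nat \<Rightarrow> nat list" where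
  "sub_ctx m n = m # replicate m n"

definition sub_trm :: "nat \<Rightarrow> nat \<Rightarrow> 'o trm" where
  "sub_trm m n = MVar 0 (map (\<lambda>i. gen (sub_ctx m n) (Suc i)) [0..<m])"

definition op_ctx :: "nat \<Rightarrow> 'o \<Rightarrow> nat list" where
  "op_ctx n w = map (\<lambda>p. n + p) (arity E w)"

definition op_trm :: "nat \<Rightarrow> 'o \<Rightarrow> 'o trm" where
  "op_trm n w = Op w (map (\<lambda>i. (arity E w ! i, gen (op_ctx n w) i)) [0..<length (arity E w)])"

lemma wfs_sub_ctx: "wfs E \<Theta> (sub_ctx m n) (t # ts) \<longleftrightarrow> wf_trm E \<Theta> m t \<and> wfs E \<Theta> (replicate m n) ts"
  by (simp add: sub_ctx_def wfs_def)

lemma wf_sub_trm: "wf_trm E (sub_ctx m n) n (sub_trm m n)"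
  unfolding sub_trm_def
proof (rule wf_MVar)
  fix t :: "'o trm" assume "t \<in> set (map (\<lambda>i. gen (sub_ctx m n) (Suc i)) [0..<m])"
  then obtain i where i: "i < m" and t: "t = gen (sub_ctx m n) (Suc i)" by auto
  show "wf_trm E (sub_ctx m n) n t"
    using wf_gen[of "Suc i" "sub_ctx m n" E] i unfolding t by (simp add: sub_ctx_def)
qed (simp_all add: sub_ctx_def)

lemma wf_op_trm: "w \<in> ops E \<Longrightarrow> wf_trm E (op_ctx n w) n (op_trm n w)"
  unfolding op_trm_def
proof (rule wf_Op)
  show "map fst (map (\<lambda>i. (arity E w ! i, gen (op_ctx n w) i)) [0..<length (arity E w)]) = arity E w"
    by (rule nth_equalityI) auto
  fix p and t :: "'o trm" assume "(p, t) \<in> set (map (\<lambda>i. (arity E w ! i, gen (op_ctx n w) i)) [0..<length (arity E w)])"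
  then show "wf_trm E (op_ctx n w) (n + p) t"
    using wf_gen[of _ "op_ctx n w" E] by (auto simp: op_ctx_def)
qed

end

text \<open>
  Evaluation of a term in context \<open>n\<close> at closed interpretations \<open>as\<^sub>j \<in> S m\<^sub>j\<close> of the metavariables
  and at the generic environment: the effect of the term as an operation \<open>\<Prod>\<^sub>j S m\<^sub>j \<rightarrow> S n\<close>.
\<close>

context op_clone
begin

definition cev :: "nat list \<Rightarrow> nat \<Rightarrow> 'u list \<Rightarrow> 'o trm \<Rightarrow> 'u" where
  "cev \<Theta> n as t = ev \<Theta> n (mwk \<Theta> 0 n as) (vars n n) t"

definition tup :: "nat list \<Rightarrow> 'u list \<Rightarrow> bool" where
  "tup \<Theta> as \<longleftrightarrow> list_all2 (\<lambda>m a. a \<in> S m) \<Theta> as"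

lemma tup_menv: "tup \<Theta> as \<longleftrightarrow> menv \<Theta> 0 as"
  by (auto simp: tup_def menv_def list_all2_conv_all_nth)

lemma menv_mwk_0: "tup \<Theta> as \<Longrightarrow> menv \<Theta> n (mwk \<Theta> 0 n as)"
  using menv_mwk[of \<Theta> 0 as n] by (simp add: tup_menv)

lemma env_vars_refl: "env n n (vars n n)"
  by (rule env_vars) simp

lemma env_Nil: "env 0 n []"
  by (simp add: env_def)

lemma vars_0 [simp]: "vars 0 n = []"
  by (simp add: vars_def)

lemma cmp_Nil [simp]: "cmp m n c [] = []"
  by (simp add: cmp_def)

lemma mwk_mwk: "tup \<Theta> as \<Longrightarrow> mwk \<Theta> n p (mwk \<Theta> 0 n as) = mwk \<Theta> 0 (n + p) as"
  using msb_msb[of \<Theta> 0 as n "[]" "n + p" "vars n (n + p)"] env_vars[of n "n + p"]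
  by (simp add: mwk_def tup_menv env_Nil)

lemma cev_in: "wf_trm E \<Theta> n t \<Longrightarrow> tup \<Theta> as \<Longrightarrow> cev \<Theta> n as t \<in> S n"
  unfolding cev_def by (rule ev_in[OF _ menv_mwk_0 env_vars_refl])

lemma cev_Var: "i < n \<Longrightarrow> cev \<Theta> n as (Var i) = v n i"
  by (simp add: cev_def)

lemma cev_MVar:
  assumes "wf_trm E \<Theta> n (MVar j ts)" "tup \<Theta> as"
  shows "cev \<Theta> n as (MVar j ts) = s (\<Theta> ! j) n (as ! j) (map (cev \<Theta> n as) ts)"
proof -
  have j: "j < length \<Theta>" and l: "length ts = \<Theta> ! j" using assms(1) by (auto elim: wf_trm.cases)
  have a: "as ! j \<in> S (\<Theta> ! j)" using assms(2) j by (auto simp: tup_def list_all2_conv_all_nth)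
  note m = assms(2)[unfolded tup_menv]
  let ?F = "vars n n @ map (cev \<Theta> n as) ts"
  have F: "env (n + \<Theta> ! j) n ?F"
    using env_evs[OF assms(1) menv_mwk_0[OF assms(2)] env_vars_refl] by (simp add: cev_def[abs_def])
  have c: "cmp (n + \<Theta> ! j) n ?F (lft n (\<Theta> ! j) []) = map (cev \<Theta> n as) ts"
    by (rule nth_equalityI) (auto simp: l nth_cmp nth_lft s_vars[OF F] nth_append)
  have "cev \<Theta> n as (MVar j ts) = s (n + \<Theta> ! j) n (s (\<Theta> ! j) (n + \<Theta> ! j) (as ! j) (lft n (\<Theta> ! j) [])) ?F"
    using nth_msb[OF m j, of n "[]"] by (simp add: cev_def[abs_def] mwk_def)
  also have "\<dots> = s (\<Theta> ! j) n (as ! j) (map (cev \<Theta> n as) ts)"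
    using s_cmp[OF a _ F, of "lft n (\<Theta> ! j) []"] env_lft[OF env_Nil, of "\<Theta> ! j" n] c by simp
  finally show ?thesis .
qed

lemma cev_Op:
  assumes "tup \<Theta> as"
  shows "cev \<Theta> n as (Op w ts) = opn n w (map (\<lambda>(p, t). cev \<Theta> (n + p) as t) ts)"
  by (simp add: cev_def mwk_mwk[OF assms] lft_vars)

lemma cev_gen:
  assumes "j < length \<Theta>" "tup \<Theta> as"
  shows "cev \<Theta> (\<Theta> ! j) as (gen \<Theta> j) = as ! j"
proof -
  have "map (cev \<Theta> (\<Theta> ! j) as) (map Var [0..<\<Theta> ! j]) = map (v (\<Theta> ! j)) [0..<\<Theta> ! j]"
    by (auto simp: cev_Var)
  moreover have "as ! j \<in> S (\<Theta> ! j)" using assms by (auto simp: tup_def list_all2_conv_all_nth)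
  ultimately show ?thesis
    using cev_MVar[OF wf_gen[OF assms(1), unfolded gen_def] assms(2)] s_vs by (simp add: gen_def del: map_map)
qed

definition cevs :: "nat list \<Rightarrow> nat list \<Rightarrow> 'u list \<Rightarrow> 'o trm list \<Rightarrow> 'u list" where
  "cevs \<Theta> ns as ts = map2 (\<lambda>n. cev \<Theta> n as) ns ts"

lemma length_cevs [simp]: "wfs E \<Theta> ns ts \<Longrightarrow> length (cevs \<Theta> ns as ts) = length ns"
  by (simp add: cevs_def wfs_length)

lemma tup_cevs: "wfs E \<Theta> ns ts \<Longrightarrow> tup \<Theta> as \<Longrightarrow> tup ns (cevs \<Theta> ns as ts)"
  unfolding tup_def[of ns] list_all2_conv_all_nth by (auto simp: cevs_def wfs_length wfs_nth intro!: cev_in)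

lemma cevs_gens: "tup \<Theta> as \<Longrightarrow> cevs \<Theta> \<Theta> as (map (gen \<Theta>) [0..<length \<Theta>]) = as"
  by (rule nth_equalityI) (auto simp: cevs_def cev_gen, auto simp: tup_def list_all2_lengthD)

text \<open>
  Evaluation turns composition of the classifying category into composition of operations.  The
  main point is that the value of \<open>s\<^sub>j\<close> at stage \<open>n\<close> is the weakening of its value at stage 0, by \<open>s_ev\<close>.
\<close>

lemma cev_csub:
  assumes t: "wf_trm E ms n t" and s: "wfs E \<Theta> ms ss" and as: "tup \<Theta> as"
  shows "cev \<Theta> n as (csub n ss t) = cev ms n (cevs \<Theta> ms as ss) t"
proof -
  have m: "mev \<Theta> ms n (mwk \<Theta> 0 n as) [] ss = mwk ms 0 n (cevs \<Theta> ms as ss)" (is "?lhs = ?rhs")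
  proof (rule nth_equalityI)
    note tc = tup_cevs[OF s as, unfolded tup_menv]
    show l: "length ?lhs = length ?rhs"
      using wfs_length[OF s] length_msb[OF tc] by (simp add: mev_def mwk_def)
    fix j assume "j < length ?lhs"
    then have j: "j < length ms" using wfs_length[OF s] by (simp add: mev_def)
    let ?m = "ms ! j"
    have e: "env ?m (n + ?m) (lft n ?m [])" using env_lft[OF env_Nil, of ?m n] by simp
    have "mwk ms 0 n (cevs \<Theta> ms as ss) ! j = s ?m (n + ?m) (cev \<Theta> ?m as (ss ! j)) (lft n ?m [])"
      using nth_msb[OF tc j, of n "[]"] j wfs_length[OF s] by (simp add: mwk_def cevs_def)
    also have "\<dots> = ev \<Theta> (n + ?m) (msb \<Theta> ?m (n + ?m) (lft n ?m []) (mwk \<Theta> 0 ?m as)) (cmp ?m (n + ?m) (lft n ?m []) (vars ?m ?m)) (ss ! j)"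
      unfolding cev_def by (rule s_ev[OF wfs_nth[OF s j] menv_mwk_0[OF as] env_vars_refl e])
    also have "cmp ?m (n + ?m) (lft n ?m []) (vars ?m ?m) = lft n ?m []"
      using cmp_vars[OF e order_refl] by simp
    also have "msb \<Theta> ?m (n + ?m) (lft n ?m []) (mwk \<Theta> 0 ?m as) = mwk \<Theta> n ?m (mwk \<Theta> 0 n as)"
      using msb_mwk[OF as[unfolded tup_menv] env_Nil, of ?m n] by (simp add: mwk_def)
    finally show "?lhs ! j = ?rhs ! j"
      using nth_mev[OF wfs_length[OF s] j] by simp
  qed
  have "ev \<Theta> n (mwk \<Theta> 0 n as) (vars n n) (emsub n 0 (zip ms ss) t) =
      ev ms n (mev \<Theta> ms n (mwk \<Theta> 0 n as) (drop n (vars n n)) ss) (take n (vars n n)) t"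
    by (rule ev_emsub[OF t menv_mwk_0[OF as] _ wfs_length[OF s]]) (use env_vars_refl wfs_nth[OF s] in auto)
  then show ?thesis
    unfolding cev_def emsub_eq_csub[OF t s] by (simp add: m)
qed

lemma cev_derivable:
  assumes "\<And>\<Theta> n t t'. (\<Theta>, n, t, t') \<in> eqns E \<Longrightarrow> valid \<Theta> n t t'"
    and "derivable E \<Theta> n t t'" "tup \<Theta> as"
  shows "cev \<Theta> n as t = cev \<Theta> n as t'"
  using soundness[OF assms(1,2)] menv_mwk_0[OF assms(3)] env_vars_refl unfolding cev_def valid_def by blast

lemma tup_sub_ctx: "tup (sub_ctx m n) (a # b) \<longleftrightarrow> a \<in> S m \<and> env m n b"
  by (auto simp: tup_def sub_ctx_def env_def list_all2_conv_all_nth in_set_conv_nth nth_Cons split: nat.splits intro: subsetD[OF _ nth_mem])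

lemma cev_sub_trm:
  assumes "a \<in> S m" "env m n b"
  shows "cev (sub_ctx m n) n (a # b) (sub_trm m n) = s m n a b"
proof -
  have t: "tup (sub_ctx m n) (a # b)" using assms by (simp add: tup_sub_ctx)
  have "map (cev (sub_ctx m n) n (a # b)) (map (\<lambda>i. gen (sub_ctx m n) (Suc i)) [0..<m]) = b" (is "?lhs = ?rhs")
  proof (rule nth_equalityI)
    fix i assume "i < length ?lhs"
    then show "?lhs ! i = ?rhs ! i"
      using cev_gen[OF _ t, of "Suc i"] by (simp add: sub_ctx_def)
  qed (simp add: env_len[OF assms(2)])
  then show ?thesis
    using cev_MVar[OF wf_sub_trm[unfolded sub_trm_def] t] unfolding sub_trm_def by (simp add: sub_ctx_def del: map_map)
qed

lemma cev_op_trm: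
  assumes "w \<in> ops E" "list_all2 (\<lambda>p a. a \<in> S (n + p)) (arity E w) as"
  shows "cev (op_ctx n w) n as (op_trm n w) = opn n w as"
proof -
  have t: "tup (op_ctx n w) as" using assms(2) by (simp add: tup_def op_ctx_def list_all2_map1)
  have "map (\<lambda>i. cev (op_ctx n w) (n + arity E w ! i) as (gen (op_ctx n w) i)) [0..<length (arity E w)] = as" (is "?lhs = ?rhs")
  proof (rule nth_equalityI)
    fix i assume "i < length ?lhs"
    then show "?lhs ! i = ?rhs ! i"
      using cev_gen[OF _ t, of i] by (simp add: op_ctx_def)
  qed (simp add: list_all2_lengthD[OF assms(2)])
  then show ?thesis unfolding op_trm_def cev_Op[OF t] by (simp add: o_def)
qed

end

context clone_hom
begin

lemma h_tup: "C.tup \<Theta> as \<Longrightarrow> D.tup \<Theta> (map2 h \<Theta> as)"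
  by (auto simp: C.tup_def D.tup_def list_all2_conv_all_nth h_in)

lemma h_cev:
  assumes "wf_trm E \<Theta> n t" "C.tup \<Theta> as"
  shows "h n (C.cev \<Theta> n as t) = D.cev \<Theta> n (map2 h \<Theta> as) t"
  unfolding C.cev_def D.cev_def
  using h_ev[OF assms(1) C.menv_mwk_0[OF assms(2)] C.env_vars_refl] h_mwk[OF assms(2)[unfolded C.tup_menv], of n]
  by (simp add: h_vars)

end

text \<open>
  Conversely to \<open>h_cev\<close>, commuting with the effect of all terms suffices, since the terms
  include those that express the structure.
\<close>

lemma clone_homI:
  assumes "op_clone E S v s opn" "op_clone E S' v' s' opn'"
    and h_in: "\<And>n a. a \<in> S n \<Longrightarrow> h n a \<in> S' n"
    and h: "\<And>\<Theta> n as t. op_clone.tup S \<Theta> as \<Longrightarrow> wf_trm E \<Theta> n t \<Longrightarrow>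
      h n (op_clone.cev v s opn \<Theta> n as t) = op_clone.cev v' s' opn' \<Theta> n (map2 h \<Theta> as) t"
  shows "clone_hom E S v s opn S' v' s' opn' h"
proof -
  interpret C: op_clone E S v s opn by fact
  interpret D: op_clone E S' v' s' opn' by fact
  have l: "length xs = length ys \<Longrightarrow> map2 h (map g xs) ys = map2 (\<lambda>x. h (g x)) xs ys" for g and xs :: "nat list" and ys
    by (intro nth_equalityI) auto
  show ?thesis
  proof
    show "a \<in> S n \<Longrightarrow> h n a \<in> S' n" for a n by (rule h_in)
    show "h n (v n i) = v' n i" if "i < n" for i n
      using h[of "[]" "[]" n "Var i"] that by (simp add: C.cev_Var D.cev_Var C.tup_def wf_Var)
    show "h n (s m n a b) = s' m n (h m a) (map (h n) b)" if "a \<in> S m" "length b = m" "set b \<subseteq> S n" for a m b n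
    proof -
      have b: "C.env m n b" "D.env m n (map (h n) b)" using that h_in by (auto simp: C.env_def D.env_def)
      have "map2 h (C.sub_ctx m n) (a # b) = h m a # map (h n) b"
        using that(2) by (auto simp: C.sub_ctx_def intro!: nth_equalityI)
      then show ?thesis
        using h[of "C.sub_ctx m n" "a # b" n "C.sub_trm m n", OF _ C.wf_sub_trm] b that(1) C.cev_sub_trm[OF that(1) b(1)]
          D.cev_sub_trm[OF h_in[OF that(1)] b(2)] by (simp add: C.tup_sub_ctx)
    qed
    show "h n (opn n w as) = opn' n w (map2 (\<lambda>p. h (n + p)) (arity E w) as)"
      if w: "w \<in> ops E" and as: "list_all2 (\<lambda>p a. a \<in> S (n + p)) (arity E w) as" for w n as
    proof -
      have "C.tup (C.op_ctx n w) as" using as by (simp add: C.tup_def C.op_ctx_def list_all2_map1)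
      moreover have as': "list_all2 (\<lambda>p a. a \<in> S' (n + p)) (arity E w) (map2 (\<lambda>p. h (n + p)) (arity E w) as)"
        using as h_in by (auto simp: list_all2_conv_all_nth)
      moreover have "map2 h (C.op_ctx n w) as = map2 (\<lambda>p. h (n + p)) (arity E w) as"
        using list_all2_lengthD[OF as] by (simp add: C.op_ctx_def l)
      ultimately show ?thesis
        using h[of "C.op_ctx n w" as n "C.op_trm n w", OF _ C.wf_op_trm[OF w]] C.cev_op_trm[OF w as] D.cev_op_trm[OF w as'] by simp
    qed
  qed
qed

section \<open>The category of models\<close>

context eq_presentation
begin

definition e_model :: "('o, 'u) smodel \<Rightarrow> bool" where
  "e_model A \<longleftrightarrow> sig_model E A \<and> (\<forall>e\<in>eqns E. satisfies A e)"

lemma sigma_modelI: "sig_model E A \<Longrightarrow> sigma_model E A"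
  by unfold_locales

definition is_hom :: "('o, 'u) smodel \<Rightarrow> ('o, 'u) smodel \<Rightarrow> (nat \<Rightarrow> 'u \<Rightarrow> 'u) \<Rightarrow> bool" where
  "is_hom A B h \<longleftrightarrow> (\<forall>n. h n \<in> fob (car A) n \<rightarrow>\<^sub>E fob (car B) n) \<and>
     clone_hom E (fob (car A)) (m_var A) (m_sub A) (m_op A) (fob (car B)) (m_var B) (m_sub B) (m_op B) h"

lemma obj_models: "A \<in> obj (models E) \<longleftrightarrow> e_model A"
  by (simp add: models_def full_subcat_def sig_models_def e_model_def)

lemma hom_models: "h \<in> hom (models E) A B \<longleftrightarrow> e_model A \<and> e_model B \<and> is_hom A B h"
  using model_hom_iff[OF sigma_modelI sigma_modelI, of A B h]
  by (auto simp: models_def full_subcat_def sig_models_def e_model_def is_hom_def)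

lemma ident_models: "ident (models E) A = (\<lambda>n. \<lambda>x\<in>fob (car A) n. x)"
  and comp_models: "comp (models E) A B C h g = (\<lambda>n. compose (fob (car A) n) (h n) (g n))"
  by (simp_all add: models_def full_subcat_def sig_models_def)

lemma e_model_clone: "e_model A \<Longrightarrow> op_clone E (fob (car A)) (m_var A) (m_sub A) (m_op A)"
  by (rule sigma_model.op_clone[OF sigma_modelI]) (simp add: e_model_def)

lemma is_hom_ident: 
  assumes "e_model A"
  shows "is_hom A A (\<lambda>n. \<lambda>x\<in>fob (car A) n. x)"
proof -
  interpret A: op_clone E "fob (car A)" "m_var A" "m_sub A" "m_op A" by (rule e_model_clone[OF assms])
  have "map2 (\<lambda>p. \<lambda>x\<in>fob (car A) (n + p). x) ps as = as" if "list_all2 (\<lambda>p a. a \<in> fob (car A) (n + p)) ps as" for n ps as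
    using that by (intro nth_equalityI) (auto simp: list_all2_conv_all_nth)
  moreover have "map (\<lambda>x\<in>B. x) b = b" if "set b \<subseteq> B" for b :: "'a list" and B
    using that by (intro map_idI) auto
  ultimately have "clone_hom E (fob (car A)) (m_var A) (m_sub A) (m_op A) (fob (car A)) (m_var A) (m_sub A) (m_op A) (\<lambda>n. \<lambda>x\<in>fob (car A) n. x)"
    by unfold_locales (simp_all add: A.v_in A.s_in A.opn_in)
  then show ?thesis unfolding is_hom_def by auto
qed

lemma is_hom_comp:
  assumes "is_hom A B g" "is_hom B C h"
  shows "is_hom A C (\<lambda>n. compose (fob (car A) n) (h n) (g n))"
proof -
  interpret g: clone_hom E "fob (car A)" "m_var A" "m_sub A" "m_op A" "fob (car B)" "m_var B" "m_sub B" "m_op B" g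
    using assms by (simp add: is_hom_def)
  interpret h: clone_hom E "fob (car B)" "m_var B" "m_sub B" "m_op B" "fob (car C)" "m_var C" "m_sub C" "m_op C" h
    using assms by (simp add: is_hom_def)
  let ?c = "\<lambda>n. compose (fob (car A) n) (h n) (g n)"
  have "clone_hom E (fob (car A)) (m_var A) (m_sub A) (m_op A) (fob (car C)) (m_var C) (m_sub C) (m_op C) ?c"
  proof
    show "a \<in> fob (car A) n \<Longrightarrow> ?c n a \<in> fob (car C) n" for a n by (simp add: compose_def g.h_in h.h_in)
    show "i < n \<Longrightarrow> ?c n (m_var A n i) = m_var C n i" for i n
      by (simp add: compose_def g.C.v_in g.h_v h.h_v)
    show "?c n (m_sub A m n a b) = m_sub C m n (?c m a) (map (?c n) b)"
      if "a \<in> fob (car A) m" "length b = m" "set b \<subseteq> fob (car A) n" for a m b n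
    proof -
      have "map (?c n) b = map (h n) (map (g n) b)" using that by (auto simp: compose_def)
      moreover have "set (map (g n) b) \<subseteq> fob (car B) n" using that g.h_in by auto
      ultimately show ?thesis
        using that g.h_s[OF that] h.h_s[OF g.h_in[OF that(1)], of "map (g n) b" n]
        by (simp add: compose_def g.C.s_in del: map_map)
    qed
    show "?c n (m_op A n w as) = m_op C n w (map2 (\<lambda>p. ?c (n + p)) (arity E w) as)"
      if w: "w \<in> ops E" and as: "list_all2 (\<lambda>p a. a \<in> fob (car A) (n + p)) (arity E w) as" for w n as
    proof -
      have as': "list_all2 (\<lambda>p a. a \<in> fob (car B) (n + p)) (arity E w) (map2 (\<lambda>p. g (n + p)) (arity E w) as)"
        using as by (auto simp: list_all2_conv_all_nth g.h_in)
      have "map2 (\<lambda>p. h (n + p)) (arity E w) (map2 (\<lambda>p. g (n + p)) (arity E w) as) = map2 (\<lambda>p. ?c (n + p)) (arity E w) as"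
        using as by (intro nth_equalityI) (auto simp: list_all2_conv_all_nth compose_def)
      then show ?thesis
        using g.h_opn[OF w as] h.h_opn[OF w as'] g.C.opn_in[OF w as] by (simp add: compose_def)
    qed
  qed
  moreover have "?c n \<in> fob (car A) n \<rightarrow>\<^sub>E fob (car C) n" for n
    using assms compose_hom[of "g n" "fob (car A) n" "fob (car B) n" "h n"] by (simp add: is_hom_def)
  ultimately show ?thesis by (simp add: is_hom_def)
qed

lemma category_models: "category (models E :: (('o, 'u) smodel, nat \<Rightarrow> 'u \<Rightarrow> 'u) cat)"
  unfolding category_def obj_models hom_models ident_models comp_models
proof (intro conjI allI ballI impI; (elim conjE)?)
  fix A B :: "('o, 'u) smodel" and f assume f: "is_hom A B f"
  then have e: "f n \<in> fob (car A) n \<rightarrow>\<^sub>E fob (car B) n" for n by (simp add: is_hom_def)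
  show "(\<lambda>n. compose (fob (car A) n) (f n) (\<lambda>x\<in>fob (car A) n. x)) = f"
    using compose_restrict_right[OF e] by simp
  show "(\<lambda>n. compose (fob (car A) n) (\<lambda>x\<in>fob (car B) n. x) (f n)) = f"
    using compose_restrict_left[OF e] by simp
next
  fix A B C D :: "('o, 'u) smodel" and f g h assume f: "is_hom A B f"
  then have e: "f n \<in> fob (car A) n \<rightarrow>\<^sub>E fob (car B) n" for n by (simp add: is_hom_def)
  show "(\<lambda>n. compose (fob (car A) n) (h n) (compose (fob (car A) n) (g n) (f n))) =
       (\<lambda>n. compose (fob (car A) n) (compose (fob (car B) n) (h n) (g n)) (f n))"
    by (simp add: compose_compose[OF e])
qed (auto intro: is_hom_ident is_hom_comp simp: obj_models)

end

section \<open>The comparison functor\<close>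

text \<open>
  An injection \<open>'u \<times> 'u \<rightarrow> 'u\<close> is iterated along the list.  Lists of different lengths may share a code,
  which does no harm, as the length of a tuple is determined by the object that indexes it.
\<close>

lemma exists_tuple_coding:
  assumes "infinite (UNIV :: 'u set)"
  shows "\<exists>enc :: 'u list \<Rightarrow> 'u. \<forall>xs ys. length xs = length ys \<longrightarrow> enc xs = enc ys \<longrightarrow> xs = ys"
proof -
  obtain p :: "'u \<times> 'u \<Rightarrow> 'u" where p: "inj p"
    using card_of_Times_same_infinite[OF assms] unfolding card_of_ordIso[symmetric]
    by (auto simp: bij_betw_def)
  define enc where "enc xs = foldr (\<lambda>x y. p (x, y)) xs undefined" for xs
  have "length xs = length ys \<Longrightarrow> enc xs = enc ys \<Longrightarrow> xs = ys" for xs ys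
    by (induction xs ys rule: list_induct2) (auto simp: enc_def dest: injD[OF p])
  then show ?thesis by blast
qed

definition model_tup :: "('o, 'u) smodel \<Rightarrow> nat list \<Rightarrow> 'u list \<Rightarrow> bool" where
  "model_tup A = op_clone.tup (fob (car A))"

definition model_cev :: "('o, 'u) smodel \<Rightarrow> nat list \<Rightarrow> nat \<Rightarrow> 'u list \<Rightarrow> 'o trm \<Rightarrow> 'u" where
  "model_cev A = op_clone.cev (m_var A) (m_sub A) (m_op A)"

locale coded_presentation = eq_presentation E for E :: "'o pres" +
  fixes enc :: "'u list \<Rightarrow> 'u"
  assumes enc_inj: "length xs = length ys \<Longrightarrow> enc xs = enc ys \<Longrightarrow> xs = ys"
begin

definition dec :: "nat \<Rightarrow> 'u \<Rightarrow> 'u list" where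
  "dec k x = (THE xs. length xs = k \<and> enc xs = x)"

lemma dec_enc [simp]: "length xs = k \<Longrightarrow> dec k (enc xs) = xs"
  unfolding dec_def by (rule the_equality) (auto intro: enc_inj)

lemma enc_eq_iff: "length xs = length ys \<Longrightarrow> enc xs = enc ys \<longleftrightarrow> xs = ys"
  using enc_inj by blast

definition tuples :: "('o, 'u) smodel \<Rightarrow> nat list \<Rightarrow> 'u set" where
  "tuples A \<Theta> = enc ` {as. model_tup A \<Theta> as}"

text \<open>
  The functorial model of \<open>A\<close> sends \<open>\<Theta>\<close> to \<open>\<Prod>\<^sub>j A(m\<^sub>j)\<close>, and a tuple of terms to the tuple of the
  operations that they define.  The objects of \<open>SET\<close> are sets of elements of the universe, hence the coding
  of tuples.
\<close>

definition Phi_ob :: "('o, 'u) smodel \<Rightarrow> (nat list, 'o trm set list, 'u set, 'u \<Rightarrow> 'u) ftr" where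
  "Phi_ob A = \<lparr>fob = tuples A,
     far = (\<lambda>\<Theta> ns. \<lambda>cs\<in>hom (MM E) \<Theta> ns. \<lambda>x\<in>tuples A \<Theta>.
       enc (map2 (\<lambda>n c. model_cev A \<Theta> n (dec (length \<Theta>) x) (rep c)) ns cs))\<rparr>"

definition Phi_ar :: "('o, 'u) smodel \<Rightarrow> (nat \<Rightarrow> 'u \<Rightarrow> 'u) \<Rightarrow> nat list \<Rightarrow> 'u \<Rightarrow> 'u" where
  "Phi_ar A h = (\<lambda>\<Theta>. \<lambda>x\<in>tuples A \<Theta>. enc (map2 h \<Theta> (dec (length \<Theta>) x)))"

lemma model_tup_iff: "model_tup A \<Theta> as \<longleftrightarrow> list_all2 (\<lambda>m a. a \<in> fob (car A) m) \<Theta> as" if "e_model A"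
proof -
  interpret op_clone E "fob (car A)" "m_var A" "m_sub A" "m_op A" by (rule e_model_clone[OF that])
  show ?thesis by (simp add: model_tup_def tup_def)
qed

lemma model_tup_length: "e_model A \<Longrightarrow> model_tup A \<Theta> as \<Longrightarrow> length as = length \<Theta>"
  by (simp add: model_tup_iff list_all2_lengthD)

lemma fob_Phi [simp]: "fob (Phi_ob A) = tuples A"
  by (simp add: Phi_ob_def)

lemma tuplesI: "model_tup A \<Theta> as \<Longrightarrow> enc as \<in> tuples A \<Theta>"
  by (simp add: tuples_def)

lemma tuplesE: "x \<in> tuples A \<Theta> \<Longrightarrow> (\<And>as. model_tup A \<Theta> as \<Longrightarrow> x = enc as \<Longrightarrow> P) \<Longrightarrow> P"
  by (auto simp: tuples_def)

lemma e_model_valid: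
  assumes A: "e_model A" and e: "(\<Theta>, n, t, t') \<in> eqns E"
  shows "op_clone.valid (fob (car A)) (m_var A) (m_sub A) (m_op A) \<Theta> n t t'"
proof -
  interpret sigma_model E A using A by (intro sigma_modelI) (simp add: e_model_def)
  have "wf_trm E \<Theta> n t" "wf_trm E \<Theta> n t'" using pres e by (auto simp: presentation_def)
  moreover have "satisfies A (\<Theta>, n, t, t')" using A e unfolding e_model_def by blast
  ultimately show ?thesis using satisfies_iff_valid by blast
qed

lemma model_cev_derivable:
  assumes A: "e_model A" and d: "derivable E \<Theta> n t t'" and as: "model_tup A \<Theta> as"
  shows "model_cev A \<Theta> n as t = model_cev A \<Theta> n as t'"
proof -
  interpret op_clone E "fob (car A)" "m_var A" "m_sub A" "m_op A" by (rule e_model_clone[OF A])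
  show ?thesis unfolding model_cev_def
    by (rule cev_derivable[OF e_model_valid[OF A] d]) (use as in \<open>simp_all add: model_tup_def\<close>)
qed

definition model_cevs :: "('o, 'u) smodel \<Rightarrow> nat list \<Rightarrow> nat list \<Rightarrow> 'u list \<Rightarrow> 'o trm list \<Rightarrow> 'u list" where
  "model_cevs A \<Theta> ns as ts = map2 (\<lambda>n. model_cev A \<Theta> n as) ns ts"

lemma model_tup_cevs:
  assumes "e_model A" "wfs E \<Theta> ns ts" "model_tup A \<Theta> as"
  shows "model_tup A ns (model_cevs A \<Theta> ns as ts)"
proof -
  interpret op_clone E "fob (car A)" "m_var A" "m_sub A" "m_op A" by (rule e_model_clone[OF assms(1)])
  show ?thesis using tup_cevs[OF assms(2)] assms(3)
    by (simp add: model_tup_def model_cevs_def model_cev_def cevs_def)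
qed

lemma model_cevs_gens:
  assumes "e_model A" "model_tup A \<Theta> as"
  shows "model_cevs A \<Theta> \<Theta> as (map (gen \<Theta>) [0..<length \<Theta>]) = as"
proof -
  interpret op_clone E "fob (car A)" "m_var A" "m_sub A" "m_op A" by (rule e_model_clone[OF assms(1)])
  show ?thesis using cevs_gens assms(2)
    by (simp add: model_tup_def model_cevs_def model_cev_def cevs_def)
qed

lemma model_cevs_csub:
  assumes "e_model A" "wfs E ms ns ts" "wfs E \<Theta> ms ss" "model_tup A \<Theta> as"
  shows "model_cevs A \<Theta> ns as (map2 (\<lambda>n. csub n ss) ns ts) = model_cevs A ms ns (model_cevs A \<Theta> ms as ss) ts"
proof -
  interpret op_clone E "fob (car A)" "m_var A" "m_sub A" "m_op A" by (rule e_model_clone[OF assms(1)])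
  show ?thesis
    using cev_csub[OF wfs_nth[OF assms(2)] assms(3)] assms(4) wfs_length[OF assms(2)]
    by (auto simp: model_tup_def model_cevs_def model_cev_def cevs_def intro!: nth_equalityI)
qed

lemma model_cevs_reps:
  assumes "e_model A" "wfs E \<Theta> ns ts" "model_tup A \<Theta> as"
  shows "map2 (\<lambda>n c. model_cev A \<Theta> n as (rep c)) ns (mor \<Theta> ns ts) = model_cevs A \<Theta> ns as ts"
  using wfs_length[OF assms(2)] model_cev_derivable[OF assms(1) derivable_rep[OF wfs_nth[OF assms(2)]] assms(3)]
  by (intro nth_equalityI) (auto simp: model_cevs_def)

lemma far_Phi:
  assumes "e_model A" "wfs E \<Theta> ns ts" "model_tup A \<Theta> as"
  shows "far (Phi_ob A) \<Theta> ns (mor \<Theta> ns ts) (enc as) = enc (model_cevs A \<Theta> ns as ts)"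
  using model_cevs_reps[OF assms] mor_hom[OF assms(2)] tuplesI[OF assms(3)] model_tup_length[OF assms(1,3)]
  by (simp add: Phi_ob_def)

text \<open>
  The identity and composition laws are \<open>model_cevs_gens\<close> and \<open>model_cevs_csub\<close>; that the action does not
  depend on representatives is soundness.
\<close>

lemma is_functor_Phi_ob:
  assumes A: "e_model A"
  shows "is_functor (MM E) SET (Phi_ob A)"
  unfolding is_functor_def
proof (intro conjI allI ballI impI)
  show "fob (Phi_ob A) \<in> obj (MM E) \<rightarrow>\<^sub>E obj SET" by simp
  have h: "far (Phi_ob A) \<Theta> ns f \<in> tuples A \<Theta> \<rightarrow>\<^sub>E tuples A ns" if f: "f \<in> hom (MM E) \<Theta> ns" for \<Theta> ns f
  proof (rule PiE_I)
    obtain ts where ts: "wfs E \<Theta> ns ts" and f': "f = mor \<Theta> ns ts" using f by (auto simp: hom_MM)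
    fix x assume "x \<in> tuples A \<Theta>"
    then show "far (Phi_ob A) \<Theta> ns f x \<in> tuples A ns"
      unfolding f' by (elim tuplesE) (simp add: far_Phi[OF A ts] tuplesI model_tup_cevs[OF A ts])
  qed (use f in \<open>simp add: Phi_ob_def\<close>)
  show "far (Phi_ob A) a b \<in> hom (MM E) a b \<rightarrow>\<^sub>E hom SET (fob (Phi_ob A) a) (fob (Phi_ob A) b)" for a b
    by (rule PiE_I) (use h in \<open>auto simp: Phi_ob_def\<close>)
  show "far (Phi_ob A) a a (ident (MM E) a) = ident SET (fob (Phi_ob A) a)" for a
  proof (rule PiE_eqI)
    show "far (Phi_ob A) a a (ident (MM E) a) \<in> tuples A a \<rightarrow>\<^sub>E tuples A a"
      by (rule h[OF category_ident[OF category_MM]]) simp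
    show "ident SET (fob (Phi_ob A) a) \<in> tuples A a \<rightarrow>\<^sub>E tuples A a" by simp
    fix x assume x: "x \<in> tuples A a"
    then show "far (Phi_ob A) a a (ident (MM E) a) x = ident SET (fob (Phi_ob A) a) x"
      by (elim tuplesE) (use x in \<open>simp add: ident_MM far_Phi[OF A wfs_gen] model_cevs_gens[OF A]\<close>)
  qed
  fix a b c f g assume f: "f \<in> hom (MM E) a b" and g: "g \<in> hom (MM E) b c"
  then obtain ss ts where ss: "wfs E a b ss" "f = mor a b ss" and ts: "wfs E b c ts" "g = mor b c ts"
    by (auto simp: hom_MM)
  show "far (Phi_ob A) a c (comp (MM E) a b c g f) =
    comp SET (fob (Phi_ob A) a) (fob (Phi_ob A) b) (fob (Phi_ob A) c) (far (Phi_ob A) b c g) (far (Phi_ob A) a b f)"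
  proof (rule PiE_eqI)
    show "far (Phi_ob A) a c (comp (MM E) a b c g f) \<in> tuples A a \<rightarrow>\<^sub>E tuples A c"
      by (rule h[OF category_comp[OF category_MM f g]])
    show "comp SET (fob (Phi_ob A) a) (fob (Phi_ob A) b) (fob (Phi_ob A) c) (far (Phi_ob A) b c g) (far (Phi_ob A) a b f) \<in> tuples A a \<rightarrow>\<^sub>E tuples A c"
      using compose_hom[OF h[OF f] h[OF g]] by simp
    fix x assume x: "x \<in> tuples A a"
    then obtain as where as: "model_tup A a as" and x': "x = enc as" by (rule tuplesE)
    show "far (Phi_ob A) a c (comp (MM E) a b c g f) x =
      comp SET (fob (Phi_ob A) a) (fob (Phi_ob A) b) (fob (Phi_ob A) c) (far (Phi_ob A) b c g) (far (Phi_ob A) a b f) x"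
      using x unfolding x' ss(2) ts(2) comp_mor[OF ts(1) ss(1)] far_Phi[OF A wfs_csub[OF ts(1) ss(1)] as]
        model_cevs_csub[OF A ts(1) ss(1) as]
      by (simp add: compose_def far_Phi[OF A ss(1) as] far_Phi[OF A ts(1) model_tup_cevs[OF A ss(1) as]])
  qed
qed

text \<open>
  It suffices to consider concatenations.  The functor acts on each component of a tuple of terms
  separately, so it maps the projections, which are pieces of the identity, to the maps that cut a tuple
  into pieces.
\<close>

lemma cartesian_Phi_ob:
  assumes A: "e_model A"
  shows "cartesian_functor (MM E) SET (Phi_ob A)"
proof (rule cartesian_functor_if_chosen_products[OF category_MM category_SET is_functor_Phi_ob[OF A]])
  fix as :: "nat list list"
  let ?q = "concat as" and ?id = "ident (MM E) (concat as)"
  let ?ps = "split_by as ?id"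
  note prod = product_MM[of as]
  have ps: "length ?ps = length as" "\<And>i. i < length as \<Longrightarrow> ?ps ! i \<in> hom (MM E) ?q (as ! i)"
    using prod unfolding is_product_iff by blast+
  have idl: "length ?id = length ?q" by (simp add: ident_MM)
  have proj: "far (Phi_ob A) ?q (as ! i) (?ps ! i) (enc cs) = enc (split_by as cs ! i)"
    if cs: "model_tup A ?q cs" and i: "i < length as" for cs i
  proof -
    let ?K = "\<lambda>n c. model_cev A ?q n cs (rep c)"
    have "map2 (map2 ?K) as ?ps = split_by as (map2 ?K ?q ?id)" by (rule map2_split_by[OF idl])
    also have "map2 ?K ?q ?id = cs"
      unfolding ident_MM model_cevs_reps[OF A wfs_gen cs] by (rule model_cevs_gens[OF A cs])
    finally have "map2 ?K (as ! i) (?ps ! i) = split_by as cs ! i"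
      using i ps(1) by (simp add: map2_eq_iff_nth)
    then show ?thesis
      using ps(2)[OF i] tuplesI[OF cs] model_tup_length[OF A cs] by (simp add: Phi_ob_def)
  qed
  have "is_product SET (map (fob (Phi_ob A)) as) (fob (Phi_ob A) ?q) (map2 (far (Phi_ob A) ?q) as ?ps)"
    unfolding is_product_SET_iff
  proof (intro conjI allI impI)
    show "length (map2 (far (Phi_ob A) ?q) as ?ps) = length (map (fob (Phi_ob A)) as)" using ps by simp
    show "map2 (far (Phi_ob A) ?q) as ?ps ! i \<in> fob (Phi_ob A) ?q \<rightarrow>\<^sub>E map (fob (Phi_ob A)) as ! i"
      if "i < length (map (fob (Phi_ob A)) as)" for i
      using functor_hom[OF is_functor_Phi_ob[OF A] ps(2)] that ps(1) by simp
    fix xs assume xs: "length xs = length (map (fob (Phi_ob A)) as)"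
      "\<forall>i<length (map (fob (Phi_ob A)) as). xs ! i \<in> map (fob (Phi_ob A)) as ! i"
    then have "\<forall>i<length as. \<exists>bs. model_tup A (as ! i) bs \<and> xs ! i = enc bs" by (auto elim: tuplesE)
    then obtain f where f: "\<And>i. i < length as \<Longrightarrow> model_tup A (as ! i) (f i) \<and> xs ! i = enc (f i)" by metis
    define bss where "bss = map f [0..<length as]"
    have bss: "list_all2 (list_all2 (\<lambda>m a. a \<in> fob (car A) m)) as bss"
      using f by (auto simp: bss_def list_all2_conv_all_nth[of "list_all2 _"] model_tup_iff[OF A])
    have cb: "model_tup A ?q (concat bss)" using list_all2_concat[OF bss] by (simp add: model_tup_iff[OF A])
    have sc: "split_by as (concat bss) = bss"
      by (rule split_by_concat, rule list_all2_mono[OF bss]) (simp add: list_all2_lengthD)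
    have "\<exists>!x. x \<in> tuples A ?q \<and> (\<forall>i<length as. far (Phi_ob A) ?q (as ! i) (?ps ! i) x = xs ! i)"
    proof (rule ex1I[of _ "enc (concat bss)"], intro conjI allI impI)
      show "enc (concat bss) \<in> tuples A ?q" using cb by (rule tuplesI)
      show "far (Phi_ob A) ?q (as ! i) (?ps ! i) (enc (concat bss)) = xs ! i" if "i < length as" for i
        unfolding proj[OF cb that] sc using f[OF that] that by (simp add: bss_def)
      fix x assume x: "x \<in> tuples A ?q \<and> (\<forall>i<length as. far (Phi_ob A) ?q (as ! i) (?ps ! i) x = xs ! i)"
      then obtain cs where cs: "model_tup A ?q cs" and x': "x = enc cs" by (auto elim: tuplesE)
      have l: "length cs = length ?q" using model_tup_length[OF A cs] .
      have sl: "list_all2 (list_all2 (\<lambda>m a. a \<in> fob (car A) m)) as (split_by as cs)"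
        using cs by (intro list_all2_split_by) (simp add: model_tup_iff[OF A])
      have "split_by as cs = bss"
      proof (rule nth_equalityI)
        fix i assume "i < length (split_by as cs)"
        then have i: "i < length as" by simp
        have "enc (split_by as cs ! i) = enc (f i)" using x proj[OF cs i] f[OF i] i unfolding x' by simp
        moreover have "length (split_by as cs ! i) = length (f i)"
          using list_all2_lengthD[OF list_all2_nthD[OF sl i]] model_tup_length[OF A conjunct1[OF f[OF i]]] by simp
        ultimately show "split_by as cs ! i = bss ! i" using enc_inj i by (simp add: bss_def)
      qed (simp add: bss_def)
      then show "x = enc (concat bss)" unfolding x' using concat_split_by[OF l] by simp
    qed
    then show "\<exists>!x. x \<in> fob (Phi_ob A) ?q \<and> (\<forall>i<length (map (fob (Phi_ob A)) as). (map2 (far (Phi_ob A) ?q) as ?ps ! i) x = xs ! i)"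
      using ps(1) by (simp cong: conj_cong)
  qed
  then show "\<exists>p \<pi>s. is_product (MM E) as p \<pi>s \<and>
      is_product SET (map (fob (Phi_ob A)) as) (fob (Phi_ob A) p) (map2 (far (Phi_ob A) p) as \<pi>s)"
    using prod by blast
qed

lemma hom_cev:
  assumes h: "is_hom A B h" and A: "e_model A" and ts: "wfs E \<Theta> ns ts" and as: "model_tup A \<Theta> as"
  shows "map2 h ns (model_cevs A \<Theta> ns as ts) = model_cevs B \<Theta> ns (map2 h \<Theta> as) ts"
    and "model_tup B \<Theta> (map2 h \<Theta> as)"
proof -
  interpret clone_hom E "fob (car A)" "m_var A" "m_sub A" "m_op A" "fob (car B)" "m_var B" "m_sub B" "m_op B" h
    using h by (simp add: is_hom_def)
  show "map2 h ns (model_cevs A \<Theta> ns as ts) = model_cevs B \<Theta> ns (map2 h \<Theta> as) ts"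
    using h_cev[OF wfs_nth[OF ts]] as wfs_length[OF ts]
    by (intro nth_equalityI) (auto simp: model_cevs_def model_cev_def model_tup_def)
  show "model_tup B \<Theta> (map2 h \<Theta> as)" using h_tup as by (simp add: model_tup_def)
qed

lemma Phi_ar_enc: "e_model A \<Longrightarrow> model_tup A \<Theta> as \<Longrightarrow> Phi_ar A h \<Theta> (enc as) = enc (map2 h \<Theta> as)"
  by (simp add: Phi_ar_def tuplesI model_tup_length)

lemma nat_trans_Phi_ar:
  assumes A: "e_model A" and B: "e_model B" and h: "is_hom A B h"
  shows "nat_trans (MM E) SET (Phi_ob A) (Phi_ob B) (Phi_ar A h)"
  unfolding nat_trans_def
proof (intro conjI allI impI)
  have Ph: "Phi_ar A h \<Theta> \<in> tuples A \<Theta> \<rightarrow>\<^sub>E tuples B \<Theta>" for \<Theta>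
  proof (rule PiE_I)
    fix x assume "x \<in> tuples A \<Theta>"
    then show "Phi_ar A h \<Theta> x \<in> tuples B \<Theta>"
      by (elim tuplesE) (simp add: Phi_ar_enc[OF A] tuplesI hom_cev(2)[OF h A wfs_gen])
  qed (simp add: Phi_ar_def)
  then show "Phi_ar A h \<in> (\<Pi>\<^sub>E \<Theta>\<in>obj (MM E). hom SET (fob (Phi_ob A) \<Theta>) (fob (Phi_ob B) \<Theta>))" by (intro PiE_I) auto
  fix a b f assume f: "f \<in> hom (MM E) a b"
  then obtain ts where ts: "wfs E a b ts" "f = mor a b ts" by (auto simp: hom_MM)
  have "Phi_ar A h b (far (Phi_ob A) a b f x) = far (Phi_ob B) a b f (Phi_ar A h a x)" if "x \<in> tuples A a" for x
    using that unfolding ts(2)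
    by (elim tuplesE)
       (simp add: far_Phi[OF A ts(1)] Phi_ar_enc[OF A] model_tup_cevs[OF A ts(1)] hom_cev[OF h A ts(1)] far_Phi[OF B ts(1)])
  then show "comp SET (fob (Phi_ob A) a) (fob (Phi_ob A) b) (fob (Phi_ob B) b) (Phi_ar A h b) (far (Phi_ob A) a b f) =
    comp SET (fob (Phi_ob A) a) (fob (Phi_ob B) a) (fob (Phi_ob B) b) (far (Phi_ob B) a b f) (Phi_ar A h a)"
    by (auto simp: compose_def fun_eq_iff)
qed

text \<open>
  A homomorphism can be read off from the components at the objects \<open>[n]\<close>, whose values are codes of
  tuples of length one.
\<close>

lemma Phi_ar_inj:
  assumes A: "e_model A" and g: "is_hom A B g" and h: "is_hom A B h" and e: "Phi_ar A g = Phi_ar A h"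
  shows "g = h"
proof
  fix n
  show "g n = h n"
  proof (rule PiE_eqI)
    show "g n \<in> fob (car A) n \<rightarrow>\<^sub>E fob (car B) n" using g by (simp add: is_hom_def)
    show "h n \<in> fob (car A) n \<rightarrow>\<^sub>E fob (car B) n" using h by (simp add: is_hom_def)
    fix x assume x: "x \<in> fob (car A) n"
    then have "model_tup A [n] [x]" by (simp add: model_tup_iff[OF A])
    then show "g n x = h n x"
      using fun_cong[OF fun_cong[OF e, of "[n]"], of "enc [x]"] by (simp add: Phi_ar_enc[OF A] enc_eq_iff)
  qed
qed

text \<open>
  A natural transformation is determined by its components at the objects \<open>[n]\<close>, by naturality with
  respect to the projections; naturality with respect to all other terms makes these
  components a homomorphism.
\<close>

lemma Phi_ar_surj:
  assumes A: "e_model A" and B: "e_model B" and t: "nat_trans (MM E) SET (Phi_ob A) (Phi_ob B) \<tau>"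
  shows "\<exists>h. is_hom A B h \<and> Phi_ar A h = \<tau>"
proof -
  have \<tau>: "\<tau> \<Theta> \<in> tuples A \<Theta> \<rightarrow>\<^sub>E tuples B \<Theta>" for \<Theta>
    using nat_trans_hom[OF t, of \<Theta>] by simp
  have nat: "\<tau> ns (enc (model_cevs A \<Theta> ns as ts)) = far (Phi_ob B) \<Theta> ns (mor \<Theta> ns ts) (\<tau> \<Theta> (enc as))"
    if ts: "wfs E \<Theta> ns ts" and as: "model_tup A \<Theta> as" for \<Theta> ns ts as
    using fun_cong[OF nat_trans_natural[OF t mor_hom[OF ts]], of "enc as"] tuplesI[OF as]
    by (simp add: compose_def far_Phi[OF A ts as])
  \<comment> \<open>the component at \<open>[n]\<close>, transported along the codes of tuples of length one\<close>
  define h where "h n = (\<lambda>x\<in>fob (car A) n. hd (dec 1 (\<tau> [n] (enc [x]))))" for n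
  have tup1: "model_tup A [n] [x] \<longleftrightarrow> x \<in> fob (car A) n" "model_tup B [n] [x] \<longleftrightarrow> x \<in> fob (car B) n" for n x
    by (simp_all add: model_tup_iff[OF A] model_tup_iff[OF B])
  have h1: "h n x \<in> fob (car B) n" "\<tau> [n] (enc [x]) = enc [h n x]" if x: "x \<in> fob (car A) n" for n x
  proof -
    have "\<tau> [n] (enc [x]) \<in> tuples B [n]" using PiE_mem[OF \<tau> tuplesI[OF tup1(1)[THEN iffD2, OF x]]] .
    then obtain ys where ys: "model_tup B [n] ys" and e: "\<tau> [n] (enc [x]) = enc ys" by (rule tuplesE)
    obtain y where y: "ys = [y]" using model_tup_length[OF B ys] by (cases ys) auto
    have "h n x = y" using x by (simp add: h_def e y)
    then show "h n x \<in> fob (car B) n" "\<tau> [n] (enc [x]) = enc [h n x]" using ys e y tup1 by auto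
  qed
  have \<tau>h: "\<tau> \<Theta> (enc as) = enc (map2 h \<Theta> as)" if as: "model_tup A \<Theta> as" for \<Theta> as
  proof -
    have "\<tau> \<Theta> (enc as) \<in> tuples B \<Theta>" using PiE_mem[OF \<tau> tuplesI[OF as]] .
    then obtain bs where bs: "model_tup B \<Theta> bs" and e: "\<tau> \<Theta> (enc as) = enc bs" by (rule tuplesE)
    note l = model_tup_length[OF A as] model_tup_length[OF B bs]
    have "bs ! j = h (\<Theta> ! j) (as ! j)" if j: "j < length \<Theta>" for j
    proof -
      have w: "wfs E \<Theta> [\<Theta> ! j] [gen \<Theta> j]" using wf_gen[OF j] by (simp add: wfs_def)
      have a: "as ! j \<in> fob (car A) (\<Theta> ! j)" using as j by (simp add: model_tup_iff[OF A] list_all2_conv_all_nth)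
      have g: "model_cevs M \<Theta> [\<Theta> ! j] cs [gen \<Theta> j] = [cs ! j]" if M: "e_model M" and cs: "model_tup M \<Theta> cs" for M cs
        using arg_cong[OF model_cevs_gens[OF M cs], of "\<lambda>xs. xs ! j"] j by (simp add: model_cevs_def)
      show ?thesis
        using nat[OF w as] h1(2)[OF a] by (simp add: e far_Phi[OF B w bs] g[OF A as] g[OF B bs] enc_eq_iff)
    qed
    then have "bs = map2 h \<Theta> as" using l by (intro nth_equalityI) auto
    then show ?thesis using e by simp
  qed
  interpret a: op_clone E "fob (car A)" "m_var A" "m_sub A" "m_op A" by (rule e_model_clone[OF A])
  interpret b: op_clone E "fob (car B)" "m_var B" "m_sub B" "m_op B" by (rule e_model_clone[OF B])
  have "clone_hom E (fob (car A)) (m_var A) (m_sub A) (m_op A) (fob (car B)) (m_var B) (m_sub B) (m_op B) h"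
  proof (rule clone_homI[OF a.op_clone_axioms b.op_clone_axioms h1(1)])
    fix \<Theta> n as t assume as: "a.tup \<Theta> as" and w: "wf_trm E \<Theta> n t"
    have ts: "wfs E \<Theta> [n] [t]" using w by (simp add: wfs_def)
    have as': "model_tup A \<Theta> as" using as by (simp add: model_tup_def)
    have b: "model_tup B \<Theta> (map2 h \<Theta> as)"
      using as' h1(1) by (auto simp: model_tup_iff[OF A] model_tup_iff[OF B] list_all2_conv_all_nth)
    have "\<tau> [n] (enc (model_cevs A \<Theta> [n] as [t])) = enc (model_cevs B \<Theta> [n] (map2 h \<Theta> as) [t])"
      using nat[OF ts as'] by (simp add: \<tau>h[OF as'] far_Phi[OF B ts b])
    moreover have "\<tau> [n] (enc (model_cevs A \<Theta> [n] as [t])) = enc [h n (a.cev \<Theta> n as t)]"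
      using h1(2)[OF a.cev_in[OF w as]] by (simp add: model_cevs_def model_cev_def)
    ultimately show "h n (a.cev \<Theta> n as t) = b.cev \<Theta> n (map2 h \<Theta> as) t"
      by (simp add: enc_eq_iff model_cevs_def model_cev_def)
  qed
  then have hom: "is_hom A B h"
    unfolding is_hom_def using h1(1) by (auto simp: h_def)
  moreover have "Phi_ar A h = \<tau>"
  proof
    fix \<Theta>
    show "Phi_ar A h \<Theta> = \<tau> \<Theta>"
    proof (rule PiE_eqI)
      show "Phi_ar A h \<Theta> \<in> tuples A \<Theta> \<rightarrow>\<^sub>E tuples B \<Theta>"
        using nat_trans_hom[OF nat_trans_Phi_ar[OF A B hom], of \<Theta>] by simp
      show "\<tau> \<Theta> \<in> tuples A \<Theta> \<rightarrow>\<^sub>E tuples B \<Theta>" by (rule \<tau>)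
      fix x assume "x \<in> tuples A \<Theta>"
      then show "Phi_ar A h \<Theta> x = \<tau> \<Theta> x" by (elim tuplesE) (simp add: Phi_ar_enc[OF A] \<tau>h)
    qed
  qed
  ultimately show ?thesis by blast
qed

definition Phi where
  "Phi = \<lparr>fob = (\<lambda>A\<in>obj (models E). Phi_ob A), far = (\<lambda>A B. \<lambda>h\<in>hom (models E) A B. Phi_ar A h)\<rparr>"

abbreviation "FMod \<equiv> full_subcat (fun_cat (MM E) SET) (cartesian_functor (MM E) SET) ::
  ((nat list, 'o trm set list, 'u set, 'u \<Rightarrow> 'u) ftr, nat list \<Rightarrow> 'u \<Rightarrow> 'u) cat"

lemma obj_FMod: "F \<in> obj FMod \<longleftrightarrow> cartesian_functor (MM E) SET F"
  by (auto simp: full_subcat_def fun_cat_def cartesian_functor_def)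

lemma hom_FMod: "\<tau> \<in> hom FMod F G \<longleftrightarrow>
    cartesian_functor (MM E) SET F \<and> cartesian_functor (MM E) SET G \<and> nat_trans (MM E) SET F G \<tau>"
  by (auto simp: full_subcat_def fun_cat_def cartesian_functor_def)

lemma Phi_simps:
  "A \<in> obj (models E) \<Longrightarrow> fob Phi A = Phi_ob A"
  "h \<in> hom (models E) A B \<Longrightarrow> far Phi A B h = Phi_ar A h"
  by (simp_all add: Phi_def)

lemma is_functor_Phi: "is_functor (models E) FMod Phi"
  unfolding is_functor_def
proof (intro conjI allI ballI impI)
  show "fob Phi \<in> obj (models E) \<rightarrow>\<^sub>E obj FMod"
    by (rule PiE_I) (auto simp: Phi_def obj_models obj_FMod intro: cartesian_Phi_ob)
  show "far Phi A B \<in> hom (models E) A B \<rightarrow>\<^sub>E hom FMod (fob Phi A) (fob Phi B)" for A B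
    by (rule PiE_I) (auto simp: Phi_def hom_models hom_FMod obj_models intro: cartesian_Phi_ob nat_trans_Phi_ar)
next
  fix A :: "('o, 'u) smodel" assume A': "A \<in> obj (models E)"
  then have A: "e_model A" by (simp add: obj_models)
  have id: "ident (models E) A \<in> hom (models E) A A" by (rule category_ident[OF category_models A'])
  have "Phi_ar A (ident (models E) A) \<Theta> = (\<lambda>x\<in>tuples A \<Theta>. x)" for \<Theta>
  proof
    fix x
    show "Phi_ar A (ident (models E) A) \<Theta> x = (\<lambda>x\<in>tuples A \<Theta>. x) x"
    proof (cases "x \<in> tuples A \<Theta>")
      case True
      then obtain as where as: "model_tup A \<Theta> as" and x: "x = enc as" by (rule tuplesE)
      have "map2 (\<lambda>n. \<lambda>x\<in>fob (car A) n. x) \<Theta> as = as"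
        using as by (intro nth_equalityI) (auto simp: model_tup_iff[OF A] list_all2_conv_all_nth)
      then show ?thesis using True unfolding x by (simp add: Phi_ar_enc[OF A as] ident_models)
    qed (simp add: Phi_ar_def)
  qed
  then show "far Phi A A (ident (models E) A) = ident FMod (fob Phi A)"
    by (simp add: Phi_simps(1)[OF A'] Phi_simps(2)[OF id] full_subcat_def fun_cat_def fun_eq_iff)
next
  fix A B C :: "('o, 'u) smodel" and f g assume f': "f \<in> hom (models E) A B" and g': "g \<in> hom (models E) B C"
  then have A: "e_model A" and B: "e_model B" and C: "e_model C" and f: "is_hom A B f" and g: "is_hom B C g" by (auto simp: hom_models)
  have gf: "comp (models E) A B C g f \<in> hom (models E) A C" by (rule category_comp[OF category_models f' g'])
  have "Phi_ar A (comp (models E) A B C g f) \<Theta> = compose (tuples A \<Theta>) (Phi_ar B g \<Theta>) (Phi_ar A f \<Theta>)" for \<Theta>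
  proof
    fix x
    show "Phi_ar A (comp (models E) A B C g f) \<Theta> x = compose (tuples A \<Theta>) (Phi_ar B g \<Theta>) (Phi_ar A f \<Theta>) x"
    proof (cases "x \<in> tuples A \<Theta>")
      case True
      then obtain as where as: "model_tup A \<Theta> as" and x: "x = enc as" by (rule tuplesE)
      have "map2 (\<lambda>n. compose (fob (car A) n) (g n) (f n)) \<Theta> as = map2 g \<Theta> (map2 f \<Theta> as)"
        using as by (intro nth_equalityI) (auto simp: model_tup_iff[OF A] list_all2_conv_all_nth compose_def)
      then show ?thesis
        using True unfolding x
        by (simp add: compose_def Phi_ar_enc[OF A as] Phi_ar_enc[OF B hom_cev(2)[OF f A wfs_gen as]] comp_models)
    qed (simp add: Phi_ar_def compose_def)
  qed
  then show "far Phi A C (comp (models E) A B C g f) = comp FMod (fob Phi A) (fob Phi B) (fob Phi C) (far Phi B C g) (far Phi A B f)"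
    using A B C by (simp add: Phi_simps obj_models Phi_simps(2)[OF f'] Phi_simps(2)[OF g'] Phi_simps(2)[OF gf]
        full_subcat_def fun_cat_def fun_eq_iff)
qed

lemma fully_faithful_Phi:
  assumes "A \<in> obj (models E)" "B \<in> obj (models E)"
  shows "bij_betw (far Phi A B) (hom (models E) A B) (hom FMod (fob Phi A) (fob Phi B))"
proof -
  have A: "e_model A" and B: "e_model B" using assms by (simp_all add: obj_models)
  have "inj_on (far Phi A B) (hom (models E) A B)"
    by (rule inj_onI) (auto simp: Phi_simps hom_models intro: Phi_ar_inj[OF A])
  moreover have "far Phi A B ` hom (models E) A B = hom FMod (fob Phi A) (fob Phi B)"
  proof
    show "far Phi A B ` hom (models E) A B \<subseteq> hom FMod (fob Phi A) (fob Phi B)"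
      using functor_hom[OF is_functor_Phi] by blast
    show "hom FMod (fob Phi A) (fob Phi B) \<subseteq> far Phi A B ` hom (models E) A B"
    proof
      fix \<tau> assume "\<tau> \<in> hom FMod (fob Phi A) (fob Phi B)"
      then have "nat_trans (MM E) SET (Phi_ob A) (Phi_ob B) \<tau>" by (simp add: hom_FMod Phi_simps assms)
      then obtain h where h: "is_hom A B h" "Phi_ar A h = \<tau>" using Phi_ar_surj[OF A B] by blast
      then have "h \<in> hom (models E) A B" using A B by (simp add: hom_models)
      then show "\<tau> \<in> far Phi A B ` hom (models E) A B" using h(2) Phi_simps(2) by (metis imageI)
    qed
  qed
  ultimately show ?thesis by (simp add: bij_betw_def)
qed

end

section \<open>From functorial models to models\<close>

locale functorial_model = eq_presentation E for E :: "'o pres" +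
  fixes F :: "(nat list, 'o trm set list, 'u set, 'u \<Rightarrow> 'u) ftr"
  assumes cartesian: "cartesian_functor (MM E) SET F"
begin

lemma functor_F: "is_functor (MM E) SET F"
  using cartesian by (simp add: cartesian_functor_def)

text \<open>
  A term over \<open>\<Theta>\<close> in context \<open>n\<close> is a morphism \<open>\<Theta> \<rightarrow> [n]\<close>, hence an operation \<open>F \<Theta> \<rightarrow> F [n]\<close>; \<open>el\<close> is its value at
  \<open>a \<in> F \<Theta>\<close>.
\<close>

definition el :: "nat list \<Rightarrow> 'u \<Rightarrow> nat \<Rightarrow> 'o trm \<Rightarrow> 'u" where
  "el \<Theta> a n t = far F \<Theta> [n] (mor \<Theta> [n] [t]) a"

definition els :: "nat list \<Rightarrow> 'u \<Rightarrow> nat list \<Rightarrow> 'o trm list \<Rightarrow> 'u list" where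
  "els \<Theta> a ns ts = map2 (el \<Theta> a) ns ts"

lemma wfs_single: "wf_trm E \<Theta> n t \<Longrightarrow> wfs E \<Theta> [n] [t]"
  by (simp add: wfs_def)

lemma far_F_in: "wfs E \<Theta> ns ts \<Longrightarrow> a \<in> fob F \<Theta> \<Longrightarrow> far F \<Theta> ns (mor \<Theta> ns ts) a \<in> fob F ns"
  using functor_hom[OF functor_F mor_hom] by (auto simp: PiE_def Pi_def)

lemma el_in: "wf_trm E \<Theta> n t \<Longrightarrow> a \<in> fob F \<Theta> \<Longrightarrow> el \<Theta> a n t \<in> fob F [n]"
  unfolding el_def by (rule far_F_in[OF wfs_single])

lemma el_derivable: "derivable E \<Theta> n t t' \<Longrightarrow> el \<Theta> a n t = el \<Theta> a n t'"
  unfolding el_def using derivable_wf[of \<Theta> n t t'] by (subst mor_eqI[OF wfs_single wfs_single, of \<Theta> n t t']) auto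

lemma far_far_F:
  assumes "wfs E \<Theta> ns ts" "wfs E ns ms us" "a \<in> fob F \<Theta>"
  shows "far F ns ms (mor ns ms us) (far F \<Theta> ns (mor \<Theta> ns ts) a) = far F \<Theta> ms (mor \<Theta> ms (map2 (\<lambda>m. csub m ts) ms us)) a"
  using functor_comp[OF functor_F mor_hom[OF assms(1)] mor_hom[OF assms(2)]] assms(3)
  by (simp add: comp_mor[OF assms(2,1)] compose_def)

lemma el_far:
  assumes "wfs E \<Theta> ns ts" "wf_trm E ns n u" "a \<in> fob F \<Theta>"
  shows "el ns (far F \<Theta> ns (mor \<Theta> ns ts) a) n u = el \<Theta> a n (csub n ts u)"
  using far_far_F[OF assms(1) wfs_single[OF assms(2)] assms(3)] by (simp add: el_def)

text \<open>
  \<open>\<Theta>\<close> is the product of the objects \<open>[m\<^sub>j]\<close>, with projections given by \<open>gen\<close>, and \<open>F\<close> preserves it.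
\<close>

lemma ex1_tuple:
  assumes xs: "list_all2 (\<lambda>m x. x \<in> fob F [m]) \<Theta> xs"
  shows "\<exists>!a. a \<in> fob F \<Theta> \<and> (\<forall>j<length \<Theta>. el \<Theta> a (\<Theta> ! j) (gen \<Theta> j) = xs ! j)"
proof -
  let ?as = "map (\<lambda>m. [m]) \<Theta>"
  have cc: "concat ?as = \<Theta>" by (induction \<Theta>) auto
  have sp: "split_by (map (\<lambda>m. [m]) as) ys = map (\<lambda>y. [y]) ys" if "length ys = length as" for as :: "nat list" and ys :: "'o trm set list"
    using that by (induction ys as rule: list_induct2) auto
  have idl: "length (ident (MM E) \<Theta>) = length \<Theta>" by (simp add: ident_MM)
  let ?ps = "split_by ?as (ident (MM E) \<Theta>)"
  have ps: "?ps ! j = mor \<Theta> [\<Theta> ! j] [gen \<Theta> j]" if "j < length \<Theta>" for j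
    using that unfolding sp[OF idl] by (simp add: ident_MM mor_def)
  have "is_product SET (map (fob F) ?as) (fob F \<Theta>) (map2 (far F \<Theta>) ?as ?ps)"
    using product_MM[of ?as] cartesian unfolding cc cartesian_functor_def by blast
  then have "\<exists>!a. a \<in> fob F \<Theta> \<and> (\<forall>j<length (map (fob F) ?as). (map2 (far F \<Theta>) ?as ?ps ! j) a = xs ! j)"
    unfolding is_product_SET_iff using xs by (auto simp: list_all2_conv_all_nth)
  then show ?thesis by (simp add: el_def ps cong: conj_cong)
qed

definition tpl :: "nat list \<Rightarrow> 'u list \<Rightarrow> 'u" where
  "tpl \<Theta> xs = (THE a. a \<in> fob F \<Theta> \<and> (\<forall>j<length \<Theta>. el \<Theta> a (\<Theta> ! j) (gen \<Theta> j) = xs ! j))"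

definition fam :: "nat list \<Rightarrow> 'u list \<Rightarrow> bool" where
  "fam \<Theta> xs \<longleftrightarrow> list_all2 (\<lambda>m x. x \<in> fob F [m]) \<Theta> xs"

lemma tpl:
  assumes "fam \<Theta> xs"
  shows tpl_in: "tpl \<Theta> xs \<in> fob F \<Theta>"
    and el_tpl: "j < length \<Theta> \<Longrightarrow> el \<Theta> (tpl \<Theta> xs) (\<Theta> ! j) (gen \<Theta> j) = xs ! j"
  using theI'[OF ex1_tuple[OF assms[unfolded fam_def]]] unfolding tpl_def by blast+

lemma tpl_eqI:
  assumes "fam \<Theta> xs" "a \<in> fob F \<Theta>" "\<And>j. j < length \<Theta> \<Longrightarrow> el \<Theta> a (\<Theta> ! j) (gen \<Theta> j) = xs ! j"
  shows "tpl \<Theta> xs = a"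
  using ex1_tuple[OF assms(1)[unfolded fam_def]] tpl[OF assms(1)] assms(2,3) by blast

lemma length_els [simp]: "length ts = length ns \<Longrightarrow> length (els \<Theta> a ns ts) = length ns"
  by (simp add: els_def)

lemma nth_els [simp]: "length ts = length ns \<Longrightarrow> i < length ns \<Longrightarrow> els \<Theta> a ns ts ! i = el \<Theta> a (ns ! i) (ts ! i)"
  by (simp add: els_def)

lemma fam_els: "wfs E \<Theta> ns ts \<Longrightarrow> a \<in> fob F \<Theta> \<Longrightarrow> fam ns (els \<Theta> a ns ts)"
  by (auto simp: fam_def list_all2_conv_all_nth wfs_length wfs_nth intro!: el_in)

lemma far_F_eq_tpl:
  assumes "wfs E \<Theta> ns ts" "a \<in> fob F \<Theta>"
  shows "far F \<Theta> ns (mor \<Theta> ns ts) a = tpl ns (els \<Theta> a ns ts)"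
  by (rule tpl_eqI[symmetric])
     (use assms in \<open>auto simp: fam_els far_F_in el_far[OF assms(1) wf_gen assms(2)] csub_gen wfs_length\<close>)

lemma el_tpl_els:
  assumes "wfs E \<Theta> ns ts" "wf_trm E ns n u" "a \<in> fob F \<Theta>"
  shows "el ns (tpl ns (els \<Theta> a ns ts)) n u = el \<Theta> a n (csub n ts u)"
  using el_far[OF assms] far_F_eq_tpl[OF assms(1,3)] by simp

lemma els_gens: "fam \<Theta> xs \<Longrightarrow> els \<Theta> (tpl \<Theta> xs) \<Theta> (map (gen \<Theta>) [0..<length \<Theta>]) = xs"
  by (rule nth_equalityI) (auto simp: el_tpl fam_def list_all2_lengthD)

text \<open>
  Finitely many elements of the sets \<open>F [n]\<close> are always the values of terms at one common element of
  some \<open>F \<Theta>\<close>, namely of projections at their tuple.  Thus identities between elements follow from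
  identities between terms.
\<close>

lemma fam_terms:
  assumes "fam ns xs" "fam ps ys" "fam qs zs"
  obtains \<Theta> a ts us vs where "a \<in> fob F \<Theta>" "wfs E \<Theta> ns ts" "xs = els \<Theta> a ns ts"
    "wfs E \<Theta> ps us" "ys = els \<Theta> a ps us" "wfs E \<Theta> qs vs" "zs = els \<Theta> a qs vs"
proof -
  let ?\<Theta> = "ns @ ps @ qs" and ?xs = "xs @ ys @ zs"
  have f: "fam ?\<Theta> ?xs" using assms by (auto simp: fam_def intro!: list_all2_appendI)
  have "wfs E ?\<Theta> ?\<Theta> (map (gen ?\<Theta>) [0..<length ?\<Theta>])" by (rule wfs_gen)
  then obtain ts us vs where g: "map (gen ?\<Theta>) [0..<length ?\<Theta>] = ts @ us @ vs" and
    w: "wfs E ?\<Theta> ns ts" "wfs E ?\<Theta> ps us" "wfs E ?\<Theta> qs vs"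
    unfolding wfs_def list_all2_append1 by blast
  have "els ?\<Theta> (tpl ?\<Theta> ?xs) ?\<Theta> (ts @ us @ vs) = ?xs" using els_gens[OF f] unfolding g .
  then have "els ?\<Theta> (tpl ?\<Theta> ?xs) ns ts @ els ?\<Theta> (tpl ?\<Theta> ?xs) ps us @ els ?\<Theta> (tpl ?\<Theta> ?xs) qs vs = ?xs"
    using w by (simp add: els_def wfs_length)
  then have "xs = els ?\<Theta> (tpl ?\<Theta> ?xs) ns ts" "ys = els ?\<Theta> (tpl ?\<Theta> ?xs) ps us" "zs = els ?\<Theta> (tpl ?\<Theta> ?xs) qs vs"
    using assms w by (auto simp: fam_def wfs_length list_all2_lengthD append_eq_append_conv)
  then show ?thesis using that[OF tpl_in[OF f] w(1) _ w(2) _ w(3)] by blast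
qed

lemma fam_terms1:
  assumes "fam ns xs"
  obtains \<Theta> a ts where "a \<in> fob F \<Theta>" "wfs E \<Theta> ns ts" "xs = els \<Theta> a ns ts"
  using that[OF tpl_in[OF assms] wfs_gen els_gens[OF assms, symmetric]] .

lemma fam_Nil: "fam [] []"
  by (simp add: fam_def)

lemma fam_replicate: "fam (replicate m n) b \<longleftrightarrow> length b = m \<and> set b \<subseteq> fob F [n]"
  by (auto simp: fam_def list_all2_conv_all_nth subset_eq all_set_conv_all_nth)

lemma fam_single: "fam [n] [x] \<longleftrightarrow> x \<in> fob F [n]"
  by (simp add: fam_def)

lemma els_replicate: "length ts = m \<Longrightarrow> els \<Theta> a (replicate m n) ts = map (el \<Theta> a n) ts"
  by (auto simp: els_def intro!: nth_equalityI)

lemma wfs_replicate: "wfs E \<Theta> (replicate m n) ts \<longleftrightarrow> length ts = m \<and> (\<forall>t\<in>set ts. wf_trm E \<Theta> n t)"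
  by (auto simp: wfs_def list_all2_conv_all_nth all_set_conv_all_nth)

text \<open>
  The clone with carriers \<open>F [n]\<close>.  Its structure consists of the operations defined by the terms that express
  the structure of a clone.
\<close>

definition F_var :: "nat \<Rightarrow> nat \<Rightarrow> 'u" where
  "F_var n i = el [] (tpl [] []) n (Var i)"

definition F_sub :: "nat \<Rightarrow> nat \<Rightarrow> 'u \<Rightarrow> 'u list \<Rightarrow> 'u" where
  "F_sub m n a b = el (sub_ctx m n) (tpl (sub_ctx m n) (a # b)) n (sub_trm m n)"

definition F_op :: "nat \<Rightarrow> 'o \<Rightarrow> 'u list \<Rightarrow> 'u" where
  "F_op n w as = el (op_ctx n w) (tpl (op_ctx n w) as) n (op_trm n w)"

lemma F_var_el: "a \<in> fob F \<Theta> \<Longrightarrow> i < n \<Longrightarrow> F_var n i = el \<Theta> a n (Var i)"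
  using el_tpl_els[of \<Theta> "[]" "[]" n "Var i" a] by (simp add: F_var_def els_def wfs_def wf_Var)

text \<open>
  On values of terms, the operation \<open>F_sub\<close> is substitution of terms: both sides are values of a composite in the
  classifying category, and metasubstituting \<open>t\<close> and \<open>us\<close> into \<open>sub_trm\<close> gives \<open>sub n us t\<close>.
\<close>

lemma F_sub_el:
  assumes a: "a \<in> fob F \<Theta>" and t: "wf_trm E \<Theta> m t" and us: "length us = m" "\<And>u. u \<in> set us \<Longrightarrow> wf_trm E \<Theta> n u"
  shows "F_sub m n (el \<Theta> a m t) (map (el \<Theta> a n) us) = el \<Theta> a n (sub n us t)"
proof -
  have w: "wfs E \<Theta> (sub_ctx m n) (t # us)" using t us by (simp add: wfs_sub_ctx wfs_replicate)
  have e: "els \<Theta> a (sub_ctx m n) (t # us) = el \<Theta> a m t # map (el \<Theta> a n) us"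
    using els_replicate[OF us(1)] by (simp add: els_def sub_ctx_def)
  have "map (csub n (t # us)) (map (\<lambda>i. gen (sub_ctx m n) (Suc i)) [0..<m]) = us" (is "?lhs = ?rhs")
  proof (rule nth_equalityI)
    fix i assume "i < length ?lhs"
    then show "?lhs ! i = ?rhs ! i"
      using csub_gen[OF w, of "Suc i"] by (simp add: sub_ctx_def)
  qed (simp add: us)
  then show ?thesis
    unfolding F_sub_def e[symmetric] el_tpl_els[OF w wf_sub_trm a] by (simp add: sub_trm_def del: map_map)
qed

lemma F_op_el:
  assumes a: "a \<in> fob F \<Theta>" and w: "w \<in> ops E" and ts: "wfs E \<Theta> (op_ctx n w) ts"
  shows "F_op n w (els \<Theta> a (op_ctx n w) ts) = el \<Theta> a n (Op w (zip (arity E w) ts))"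
proof -
  have "map (\<lambda>i. (arity E w ! i, csub (n + arity E w ! i) ts (gen (op_ctx n w) i))) [0..<length (arity E w)] = zip (arity E w) ts" (is "?lhs = ?rhs")
  proof (rule nth_equalityI)
    fix i assume "i < length ?lhs"
    then show "?lhs ! i = ?rhs ! i"
      using csub_gen[OF ts, of i] wfs_length[OF ts] by (simp add: op_ctx_def)
  qed (use wfs_length[OF ts] in \<open>simp add: op_ctx_def\<close>)
  then show ?thesis
    unfolding F_op_def el_tpl_els[OF ts wf_op_trm[OF w] a] by (simp add: op_trm_def o_def)
qed

lemma lift_env_el:
  assumes a: "a \<in> fob F \<Theta>" and us: "\<And>u. u \<in> set us \<Longrightarrow> wf_trm E \<Theta> n u"
  shows "lift_env F_var F_sub n p (map (el \<Theta> a n) us) = map (el \<Theta> a (n + p)) (lift_sub n p us)"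
proof -
  have "F_sub n (n + p) (el \<Theta> a n u) (map (F_var (n + p)) [0..<n]) = el \<Theta> a (n + p) (ren n (n + p) id u)" if u: "u \<in> set us" for u
  proof -
    have e: "map (F_var (n + p)) [0..<n] = map (el \<Theta> a (n + p)) (map (\<lambda>i. Var (id i)) [0..<n])"
      using F_var_el[OF a] by simp
    have "F_sub n (n + p) (el \<Theta> a n u) (map (F_var (n + p)) [0..<n]) = el \<Theta> a (n + p) (sub (n + p) (map (\<lambda>i. Var (id i)) [0..<n]) u)"
      unfolding e by (rule F_sub_el[OF a us[OF u]]) (auto intro: wf_Var)
    then show ?thesis using ren_eq_sub[OF us[OF u], of id "n + p"] by simp
  qed
  moreover have "map (F_var (n + p)) [n..<n + p] = map (el \<Theta> a (n + p)) (map Var [n..<n + p])"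
    using F_var_el[OF a] by simp
  ultimately show ?thesis by (simp add: lift_env_def lift_sub_def)
qed

lemma fam_op_ctx: "fam (op_ctx n w) as \<longleftrightarrow> list_all2 (\<lambda>p a. a \<in> fob F [n + p]) (arity E w) as"
  by (simp add: fam_def op_ctx_def list_all2_map1)

lemma wfs_op_ctx_zip: "wfs E \<Theta> (op_ctx n w) ts \<Longrightarrow> w \<in> ops E \<Longrightarrow> wf_trm E \<Theta> n (Op w (zip (arity E w) ts))"
  by (rule wf_Op) (auto simp: op_ctx_def wfs_def list_all2_conv_all_nth set_zip)

text \<open>
  All elements in a clone law are the values of terms at a common element.  There the law reduces to a
  law of substitution for terms: for instance, \<open>s_s\<close> reduces to \<open>sub_sub\<close>.
\<close>

lemma op_clone_F: "op_clone E (\<lambda>n. fob F [n]) F_var F_sub F_op"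
proof
  show "F_var n i \<in> fob F [n]" if "i < n" for i n
    unfolding F_var_def by (rule el_in[OF wf_Var[OF that] tpl_in[OF fam_Nil]])
  show "F_sub m n a b \<in> fob F [n]" if "a \<in> fob F [m]" "length b = m" "set b \<subseteq> fob F [n]" for a m b n
    unfolding F_sub_def
    by (rule el_in[OF wf_sub_trm tpl_in]) (use that fam_replicate in \<open>auto simp: sub_ctx_def fam_def\<close>)
  show "F_op n w as \<in> fob F [n]" if "w \<in> ops E" "list_all2 (\<lambda>p a. a \<in> fob F [n + p]) (arity E w) as" for w n as
    unfolding F_op_def by (rule el_in[OF wf_op_trm[OF that(1)] tpl_in]) (use that in \<open>simp add: fam_op_ctx\<close>)
  show "F_sub m n (F_var m i) b = b ! i" if asm: "length b = m" "set b \<subseteq> fob F [n]" "i < m" for b m n i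
  proof -
    obtain \<Theta> x us where x: "x \<in> fob F \<Theta>" and us: "wfs E \<Theta> (replicate m n) us" and b: "b = els \<Theta> x (replicate m n) us"
      by (rule fam_terms1[of "replicate m n" b]) (use asm in \<open>auto simp: fam_replicate\<close>)
    have u: "length us = m" "\<And>u. u \<in> set us \<Longrightarrow> wf_trm E \<Theta> n u" using us by (auto simp: wfs_replicate)
    show ?thesis
      using F_sub_el[OF x wf_Var[OF that(3)] u] that(3) u(1)
      by (simp add: b els_replicate F_var_el[OF x])
  qed
  show "F_sub n n a (map (F_var n) [0..<n]) = a" if asm: "a \<in> fob F [n]" for a n
  proof -
    obtain \<Theta> x ts where x: "x \<in> fob F \<Theta>" and ts: "wfs E \<Theta> [n] ts" and a: "[a] = els \<Theta> x [n] ts"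
      by (rule fam_terms1[of "[n]" "[a]"]) (use asm in \<open>auto simp: fam_single\<close>)
    then obtain t where t: "wf_trm E \<Theta> n t" and a: "a = el \<Theta> x n t"
      by (auto simp: wfs_def list_all2_Cons1 els_def)
    have e: "map (F_var n) [0..<n] = map (el \<Theta> x n) (map Var [0..<n])" using F_var_el[OF x] by simp
    have "F_sub n n (el \<Theta> x n t) (map (F_var n) [0..<n]) = el \<Theta> x n (sub n (map Var [0..<n]) t)"
      unfolding e by (rule F_sub_el[OF x t]) (auto intro: wf_Var)
    then show ?thesis by (simp add: a sub_Var[OF t])
  qed
  show "F_sub m n (F_sub k m a b) c = F_sub k n a (map (\<lambda>x. F_sub m n x c) b)"
    if asm: "a \<in> fob F [k]" "length b = k" "set b \<subseteq> fob F [m]" "length c = m" "set c \<subseteq> fob F [n]" for a k b m c n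
  proof -
    obtain \<Theta> x ts us vs where x: "x \<in> fob F \<Theta>" and ts: "wfs E \<Theta> [k] ts" "[a] = els \<Theta> x [k] ts"
      and us: "wfs E \<Theta> (replicate k m) us" "b = els \<Theta> x (replicate k m) us"
      and vs: "wfs E \<Theta> (replicate m n) vs" "c = els \<Theta> x (replicate m n) vs"
      by (rule fam_terms[of "[k]" "[a]" "replicate k m" b "replicate m n" c])
         (use asm in \<open>auto simp: fam_single fam_replicate\<close>)
    then obtain t where t: "wf_trm E \<Theta> k t" and a: "a = el \<Theta> x k t"
      by (auto simp: wfs_def list_all2_Cons1 els_def)
    have u: "length us = k" "\<And>u. u \<in> set us \<Longrightarrow> wf_trm E \<Theta> m u" and b: "b = map (el \<Theta> x m) us"
      using us by (auto simp: wfs_replicate els_replicate)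
    have v: "length vs = m" "\<And>u. u \<in> set vs \<Longrightarrow> wf_trm E \<Theta> n u" and c: "c = map (el \<Theta> x n) vs"
      using vs by (auto simp: wfs_replicate els_replicate)
    have e: "map (\<lambda>x. F_sub m n x c) b = map (el \<Theta> x n) (map (sub n vs) us)"
      using F_sub_el[OF x u(2) v] by (simp add: b c)
    have ab: "F_sub k m a b = el \<Theta> x m (sub m us t)"
      unfolding a b by (rule F_sub_el[OF x t u])
    have "F_sub k n a (map (\<lambda>x. F_sub m n x c) b) = el \<Theta> x n (sub n (map (sub n vs) us) t)"
      unfolding e a by (rule F_sub_el[OF x t]) (use u(1) wf_sub[OF u(2) v] in auto)
    moreover have "F_sub m n (F_sub k m a b) c = el \<Theta> x n (sub n vs (sub m us t))"
      unfolding ab c by (rule F_sub_el[OF x wf_sub[OF t u] v])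
    ultimately show ?thesis using sub_sub[OF t u v] by simp
  qed
  show "F_sub m n (F_op m w as) b = F_op n w (map2 (\<lambda>p a. F_sub (m + p) (n + p) a (lift_env F_var F_sub n p b)) (arity E w) as)"
    if w: "w \<in> ops E" and as: "list_all2 (\<lambda>p a. a \<in> fob F [m + p]) (arity E w) as" and b: "length b = m" "set b \<subseteq> fob F [n]" for w m as b n
  proof -
    obtain \<Theta> x ts us where x: "x \<in> fob F \<Theta>" and ts: "wfs E \<Theta> (op_ctx m w) ts" "as = els \<Theta> x (op_ctx m w) ts"
      and us: "wfs E \<Theta> (replicate m n) us" "b = els \<Theta> x (replicate m n) us"
      by (rule fam_terms[of "op_ctx m w" as "replicate m n" b, OF _ _ fam_Nil])
         (use as b in \<open>auto simp: fam_op_ctx fam_replicate\<close>)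
    have u: "length us = m" "\<And>u. u \<in> set us \<Longrightarrow> wf_trm E \<Theta> n u" and b: "b = map (el \<Theta> x n) us"
      using us by (auto simp: wfs_replicate els_replicate)
    have lt: "length ts = length (arity E w)" using wfs_length[OF ts(1)] by (simp add: op_ctx_def)
    define rs where "rs = map2 (\<lambda>p t. sub (n + p) (lift_sub n p us) t) (arity E w) ts"
    have rsl: "length rs = length (arity E w)" using lt by (simp add: rs_def)
    have tj: "wf_trm E \<Theta> (m + arity E w ! j) (ts ! j)" if "j < length (arity E w)" for j
      using wfs_nth[OF ts(1), of j] that by (simp add: op_ctx_def)
    have lw: "length (lift_sub n p us) = m + p" "\<And>u. u \<in> set (lift_sub n p us) \<Longrightarrow> wf_trm E \<Theta> (n + p) u" for p
      using u wf_lift_sub[of us E \<Theta> n] by auto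
    have rs: "wfs E \<Theta> (op_ctx n w) rs"
    proof (rule wfsI)
      fix j assume "j < length (op_ctx n w)"
      then have j: "j < length (arity E w)" by (simp add: op_ctx_def)
      then show "wf_trm E \<Theta> (op_ctx n w ! j) (rs ! j)"
        using wf_sub[OF tj[OF j] lw] lt by (simp add: op_ctx_def rs_def)
    qed (simp add: rsl op_ctx_def)
    have l: "lift_env F_var F_sub n p b = map (el \<Theta> x (n + p)) (lift_sub n p us)" for p
      unfolding b by (rule lift_env_el[OF x u(2)])
    have m2: "map2 (\<lambda>p a. F_sub (m + p) (n + p) a (lift_env F_var F_sub n p b)) (arity E w) as = els \<Theta> x (op_ctx n w) rs" (is "?lhs = ?rhs")
    proof (rule nth_equalityI)
      fix j assume "j < length ?lhs"
      then have j: "j < length (arity E w)" by simp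
      show "?lhs ! j = ?rhs ! j"
        using F_sub_el[OF x tj[OF j] lw] j lt rsl by (simp add: ts(2) l op_ctx_def rs_def els_def)
    qed (simp add: ts(2) lt rsl op_ctx_def els_def)
    have so: "sub n us (Op w (zip (arity E w) ts)) = Op w (zip (arity E w) rs)"
      unfolding sub_Op by (auto simp: rs_def intro!: nth_equalityI)
    have "F_sub m n (F_op m w as) b = el \<Theta> x n (Op w (zip (arity E w) rs))"
      unfolding so[symmetric] ts(2) F_op_el[OF x w ts(1)] b
      by (rule F_sub_el[OF x wfs_op_ctx_zip[OF ts(1) w] u])
    then show ?thesis
      unfolding m2 F_op_el[OF x w rs] .
  qed
qed

sublocale op_clone E "\<lambda>n. fob F [n]" F_var F_sub F_op
  by (rule op_clone_F)

lemma vars_el: "a \<in> fob F \<Theta> \<Longrightarrow> n \<le> m \<Longrightarrow> vars n m = map (el \<Theta> a m) (map Var [0..<n])"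
  using F_var_el by (simp add: vars_def)

text \<open>
  Weakenings of an interpretation of metavariables are renamings of the representing terms.  The map
  \<open>f\<close> is an inclusion below; for interpretations at stage 0 it is empty, and for \<open>new_vars\<close> it is \<open>\<lambda>i. n + i\<close>.
\<close>

lemma shift_el:
  assumes a: "a \<in> fob F \<Xi>" and t: "wf_trm E \<Xi> (k + m) t" and b: "length b = k" "\<And>i. i < k \<Longrightarrow> b ! i = F_var l (f i) \<and> f i < l"
  shows "F_sub (k + m) (l + m) (el \<Xi> a (k + m) t) (lft l m b) = el \<Xi> a (l + m) (ren (k + m) (l + m) (\<lambda>i. if i < k then f i else l + (i - k)) t)"
proof -
  let ?g = "\<lambda>i. if i < k then f i else l + (i - k)"
  have g: "?g i < l + m" if "i < k + m" for i using that b(2)[of i] by auto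
  have e: "lft l m b = map (el \<Xi> a (l + m)) (map (\<lambda>i. Var (?g i)) [0..<k + m])" (is "?lhs = ?rhs")
  proof (rule nth_equalityI)
    fix i assume "i < length ?lhs"
    then have i: "i < k + m" using b(1) by simp
    have "?lhs ! i = F_var (l + m) (?g i)"
      using i b(1) b(2)[of i] s_vars[OF env_vars[of l "l + m"]] by (auto simp: nth_lft)
    then show "?lhs ! i = ?rhs ! i"
      using F_var_el[OF a g[OF i]] i by simp
  qed (simp add: b)
  have "F_sub (k + m) (l + m) (el \<Xi> a (k + m) t) (lft l m b) = el \<Xi> a (l + m) (sub (l + m) (map (\<lambda>i. Var (?g i)) [0..<k + m]) t)"
    unfolding e by (rule F_sub_el[OF a t]) (use g in \<open>auto intro!: wf_Var\<close>)
  then show ?thesis using ren_eq_sub[OF t g] by simp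
qed

definition tctx :: "nat \<Rightarrow> nat list \<Rightarrow> nat list" where
  "tctx n \<Theta> = map (\<lambda>m. n + m) \<Theta>"

lemma menv_els: "wfs E \<Xi> (tctx n \<Theta>) ss \<Longrightarrow> a \<in> fob F \<Xi> \<Longrightarrow> menv \<Theta> n (els \<Xi> a (tctx n \<Theta>) ss)"
  using fam_els[of \<Xi> "tctx n \<Theta>" ss a] by (auto simp: menv_def fam_def tctx_def list_all2_conv_all_nth)

text \<open>
  Evaluation in the clone of \<open>F\<close> follows the recursion of \<open>msub\<close>, if the metavariables are interpreted by values
  of terms and the environment consists of all variables.
\<close>

lemma ev_eq_el_msub:
  assumes "wf_trm E \<Theta> n t" "wfs E \<Xi> (tctx n \<Theta>) ss" "a \<in> fob F \<Xi>"
  shows "ev \<Theta> n (els \<Xi> a (tctx n \<Theta>) ss) (vars n n) t = el \<Xi> a n (msub n (zip \<Theta> ss) t)"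
  using assms
proof (induction arbitrary: ss rule: wf_trm.induct)
  case (wf_Var i n)
  then show ?case by (simp add: F_var_el[of a \<Xi>])
next
  case (wf_MVar j ts n)
  note a = wf_MVar.prems(2)
  have ls: "length ss = length \<Theta>" using wfs_length[OF wf_MVar.prems(1)] by (simp add: tctx_def)
  have sj: "wf_trm E \<Xi> (n + \<Theta> ! j) (ss ! j)"
    using wfs_nth[OF wf_MVar.prems(1), of j] wf_MVar.hyps(1) by (simp add: tctx_def)
  have z: "length (zip \<Theta> ss) = length \<Theta>" "i < length \<Theta> \<Longrightarrow> fst (zip \<Theta> ss ! i) = \<Theta> ! i \<and> wf_trm E \<Xi> (n + \<Theta> ! i) (snd (zip \<Theta> ss ! i))" for i
    using wfs_nth[OF wf_MVar.prems(1), of i] ls by (simp_all add: tctx_def)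
  let ?b = "map Var [0..<n] @ map (msub n (zip \<Theta> ss)) ts"
  have b: "wf_trm E \<Xi> n u" if "u \<in> set ?b" for u
    using that wf_msub[OF wf_MVar.hyps(3) z] by (auto intro: wf_Var)
  have "vars n n @ map (ev \<Theta> n (els \<Xi> a (tctx n \<Theta>) ss) (vars n n)) ts = map (el \<Xi> a n) ?b"
    using wf_MVar.IH[OF _ wf_MVar.prems] vars_el[OF a order_refl, of n] by simp
  then show ?case
    using F_sub_el[OF a sj, of ?b n] b wf_MVar.hyps ls by (auto simp: tctx_def els_def simp del: map_append)
next
  case (wf_Op w as n)
  note a = wf_Op.prems(2) and ss = wf_Op.prems(1)
  have ls: "length ss = length \<Theta>" using wfs_length[OF ss] by (simp add: tctx_def)
  define rs where "rs p = map2 (\<lambda>m s. ren (n + m) (n + p + m) (\<lambda>i. if i < n then i else i + p) s) \<Theta> ss" for p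
  have sj: "wf_trm E \<Xi> (n + \<Theta> ! j) (ss ! j)" if "j < length \<Theta>" for j
    using wfs_nth[OF ss, of j] that by (simp add: tctx_def)
  have lrs: "length (rs p) = length \<Theta>" for p using ls by (simp add: rs_def)
  have rs: "wfs E \<Xi> (tctx (n + p) \<Theta>) (rs p)" for p
  proof (rule wfsI)
    fix j assume "j < length (tctx (n + p) \<Theta>)"
    then have j: "j < length \<Theta>" by (simp add: tctx_def)
    have "wf_trm E \<Xi> (n + p + \<Theta> ! j) (ren (n + \<Theta> ! j) (n + p + \<Theta> ! j) (\<lambda>i. if i < n then i else i + p) (ss ! j))"
      by (rule wf_ren[OF sj[OF j]]) auto
    then show "wf_trm E \<Xi> (tctx (n + p) \<Theta> ! j) (rs p ! j)" using j ls by (simp add: tctx_def rs_def)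
  qed (simp add: lrs tctx_def)
  have z: "map (\<lambda>(m, s). (m, ren (n + m) (n + p + m) (\<lambda>i. if i < n then i else i + p) s)) (zip \<Theta> ss) = zip \<Theta> (rs p)" for p
    by (rule nth_equalityI) (use ls in \<open>auto simp: rs_def\<close>)
  note me = menv_els[OF ss a]
  have mw: "mwk \<Theta> n p (els \<Xi> a (tctx n \<Theta>) ss) = els \<Xi> a (tctx (n + p) \<Theta>) (rs p)" (is "?lhs = ?rhs") for p
  proof (rule nth_equalityI)
    show "length ?lhs = length ?rhs"
      unfolding mwk_def length_msb[OF me] by (simp add: lrs els_def tctx_def)
    fix j assume "j < length ?lhs"
    then have j: "j < length \<Theta>" unfolding mwk_def length_msb[OF me] .
    have "ren (n + \<Theta> ! j) (n + p + \<Theta> ! j) (\<lambda>i. if i < n then i else n + p + (i - n)) (ss ! j) = rs p ! j"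
      using j ls ren_cong[OF sj[OF j], of "\<lambda>i. if i < n then i else n + p + (i - n)" "\<lambda>i. if i < n then i else i + p"]
      by (simp add: rs_def)
    then show "?lhs ! j = ?rhs ! j"
      using shift_el[OF a sj[OF j], of "vars n (n + p)" "n + p" "\<lambda>i. i"] j ls
      unfolding mwk_def nth_msb[OF me j] by (simp add: els_def tctx_def rs_def)
  qed
  define us where "us = map (\<lambda>(p, t). msub (n + p) (zip \<Theta> (rs p)) t) as"
  have IH: "ev \<Theta> (n + p) (mwk \<Theta> n p (els \<Xi> a (tctx n \<Theta>) ss)) (lft n p (vars n n)) t = el \<Xi> a (n + p) (msub (n + p) (zip \<Theta> (rs p)) t)"
    if "(p, t) \<in> set as" for p t
    unfolding mw lft_vars by (rule wf_Op.IH[OF that rs a])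
  have las: "length as = length (arity E w)" using wf_Op.hyps(2) by (metis length_map)
  have zip_us: "zip (arity E w) us = map (\<lambda>(p, t). (p, msub (n + p) (zip \<Theta> (rs p)) t)) as"
    unfolding wf_Op.hyps(2)[symmetric] us_def by (induction as) auto
  have wop: "wf_trm E \<Xi> n (Op w (zip (arity E w) us))"
  proof -
    have "wf_trm E \<Xi> n (msub n (zip \<Theta> ss) (Op w as))"
      by (rule wf_msub[OF wf_trm.wf_Op[OF wf_Op.hyps]]) (use ls sj in auto)
    then show ?thesis by (simp add: z zip_us)
  qed
  then have wu: "wf_trm E \<Xi> (n + p) u" if "(p, u) \<in> set (zip (arity E w) us)" for p u
    using that by (auto elim: wf_trm.cases)
  have lus: "length us = length (arity E w)" by (simp add: us_def las)
  have us: "wfs E \<Xi> (op_ctx n w) us"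
    by (rule wfsI) (use lus in \<open>auto simp: op_ctx_def set_zip intro!: wu\<close>)
  have "map (\<lambda>(p, t). ev \<Theta> (n + p) (mwk \<Theta> n p (els \<Xi> a (tctx n \<Theta>) ss)) (lft n p (vars n n)) t) as = els \<Xi> a (op_ctx n w) us" (is "?lhs = ?rhs")
  proof (rule nth_equalityI)
    fix i assume "i < length ?lhs"
    then have i: "i < length as" by simp
    obtain p t where pt: "as ! i = (p, t)" by (cases "as ! i")
    have "(p, t) \<in> set as" using pt i by (metis nth_mem)
    moreover have "arity E w ! i = p" using pt i by (simp add: wf_Op.hyps(2)[symmetric])
    ultimately show "?lhs ! i = ?rhs ! i"
      using i pt las IH by (simp add: els_def op_ctx_def us_def)
  qed (simp add: els_def op_ctx_def us_def las)
  then show ?case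
    unfolding ev.simps msub.simps z using F_op_el[OF a wf_Op.hyps(1) us] by (simp add: zip_us)
qed

lemma fam_eq_tup: "fam \<Theta> as \<longleftrightarrow> tup \<Theta> as"
  by (simp add: fam_def tup_def)

text \<open>
  The operation that a term defines in the clone of \<open>F\<close> is the one given by \<open>F\<close>: represent \<open>as\<close> by the
  projections at the tuple of \<open>as\<close>, whose metasubstitution into \<open>t\<close> is \<open>t\<close>.
\<close>

lemma cev_eq_el:
  assumes t: "wf_trm E \<Theta> n t" and as: "fam \<Theta> as"
  shows "cev \<Theta> n as t = el \<Theta> (tpl \<Theta> as) n t"
proof -
  note a = tpl_in[OF as]
  define gs :: "'o trm list" where "gs = map (gen \<Theta>) [0..<length \<Theta>]"
  define ss where "ss = map2 (\<lambda>m s. ren m (n + m) (\<lambda>i. n + i) s) \<Theta> gs"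
  have gj: "wf_trm E \<Theta> (\<Theta> ! j) (gs ! j)" if "j < length \<Theta>" for j using that by (simp add: gs_def wf_gen)
  have ss: "wfs E \<Theta> (tctx n \<Theta>) ss"
    using gj by (intro wfsI) (auto simp: ss_def tctx_def gs_def intro!: wf_ren)
  have me: "menv \<Theta> 0 as" using as by (simp add: fam_eq_tup tup_menv)
  have "mwk \<Theta> 0 n as = els \<Theta> (tpl \<Theta> as) (tctx n \<Theta>) ss" (is "?lhs = ?rhs")
  proof (rule nth_equalityI)
    show "length ?lhs = length ?rhs"
      unfolding mwk_def length_msb[OF me] by (simp add: ss_def els_def tctx_def gs_def)
    fix j assume "j < length ?lhs"
    then have j: "j < length \<Theta>" unfolding mwk_def length_msb[OF me] .
    show "?lhs ! j = ?rhs ! j"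
      using shift_el[OF a, of 0 "\<Theta> ! j" "gs ! j" "[]" n "\<lambda>i. i"] gj[OF j] j el_tpl[OF as j] nth_msb[OF me j, of n "[]"]
      by (simp add: mwk_def ss_def els_def tctx_def gs_def)
  qed
  then have "cev \<Theta> n as t = el \<Theta> (tpl \<Theta> as) n (msub n (zip \<Theta> ss) t)"
    unfolding cev_def using ev_eq_el_msub[OF t ss a] by simp
  also have "zip \<Theta> ss = weaken_all n \<Theta> gs"
    by (rule nth_equalityI) (auto simp: ss_def weaken_all_def gs_def)
  also have "msub n (weaken_all n \<Theta> gs) t = t"
    using msub_weaken_all[OF t, of \<Theta> gs] wfs_gen[of E \<Theta>] csub_gens[OF t] by (simp add: gs_def)
  finally show ?thesis .
qed

text \<open>
  An interpretation of the metavariables at stage \<open>k\<close> is represented by terms \<open>s\<^sub>j\<close> in contexts \<open>k + m\<^sub>j\<close>.  By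
  \<open>validI_vars\<close> it suffices to compare the values of the instances \<open>emsub n k (zip \<Theta> ss)\<close>, and these are
  derivably equal by the extended metasubstitution rule with \<open>k\<close> additional variables.
\<close>

lemma F_valid:
  assumes d: "derivable E \<Theta> n t t'"
  shows "valid \<Theta> n t t'"
proof (rule validI_vars)
  show w: "wf_trm E \<Theta> n t" "wf_trm E \<Theta> n t'" using derivable_wf[OF d] by auto
  fix k \<theta> assume m: "menv \<Theta> k \<theta>"
  then have f: "fam (tctx k \<Theta>) \<theta>" by (auto simp: menv_def fam_def tctx_def list_all2_conv_all_nth)
  obtain \<Xi> a ss where a: "a \<in> fob F \<Xi>" and ss: "wfs E \<Xi> (tctx k \<Theta>) ss" and \<theta>: "\<theta> = els \<Xi> a (tctx k \<Theta>) ss"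
    by (rule fam_terms1[OF f])
  have ls: "length ss = length \<Theta>" using wfs_length[OF ss] by (simp add: tctx_def)
  have sj: "wf_trm E \<Xi> (k + \<Theta> ! j) (ss ! j)" if "j < length \<Theta>" for j
    using wfs_nth[OF ss, of j] that by (simp add: tctx_def)
  define rs where "rs = map2 (\<lambda>m s. ren (k + m) (n + k + m) (\<lambda>i. n + i) s) \<Theta> ss"
  have lrs: "length rs = length \<Theta>" using ls by (simp add: rs_def)
  have rs: "wfs E \<Xi> (tctx (n + k) \<Theta>) rs"
    using sj ls by (intro wfsI) (auto simp: rs_def tctx_def intro!: wf_ren)
  have th: "msb \<Theta> k (n + k) (new_vars n k) \<theta> = els \<Xi> a (tctx (n + k) \<Theta>) rs" (is "?lhs = ?rhs")
  proof (rule nth_equalityI)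
    show "length ?lhs = length ?rhs"
      unfolding length_msb[OF m] by (simp add: els_def tctx_def lrs)
    fix j assume "j < length ?lhs"
    then have j: "j < length \<Theta>" unfolding length_msb[OF m] .
    have "ren (k + \<Theta> ! j) (n + k + \<Theta> ! j) (\<lambda>i. if i < k then n + i else n + k + (i - k)) (ss ! j) = rs ! j"
      using j ls ren_cong[OF sj[OF j], of "\<lambda>i. if i < k then n + i else n + k + (i - k)" "\<lambda>i. n + i"]
      by (simp add: rs_def)
    then show "?lhs ! j = ?rhs ! j"
      using shift_el[OF a sj[OF j], of "new_vars n k" "n + k" "\<lambda>i. n + i"] j ls lrs
      unfolding nth_msb[OF m j] by (simp add: els_def tctx_def \<theta> new_vars_def)
  qed
  have "ev \<Theta> (n + k) (els \<Xi> a (tctx (n + k) \<Theta>) rs) (vars n (n + k)) u = el \<Xi> a (n + k) (emsub n k (zip \<Theta> ss) u)"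
    if u: "wf_trm E \<Theta> n u" for u
  proof -
    have wu: "wf_trm E \<Theta> (n + k) (ren n (n + k) id u)" by (rule wf_ren[OF u]) auto
    have "ev \<Theta> (n + k) (els \<Xi> a (tctx (n + k) \<Theta>) rs) (vars (n + k) (n + k)) (ren n (n + k) id u) =
      ev \<Theta> (n + k) (els \<Xi> a (tctx (n + k) \<Theta>) rs) (map (\<lambda>i. vars (n + k) (n + k) ! id i) [0..<n]) u"
      by (rule ev_ren[OF u menv_els[OF rs a] env_vars_refl]) auto
    also have "map (\<lambda>i. vars (n + k) (n + k) ! id i) [0..<n] = vars n (n + k)"
      by (rule nth_equalityI) auto
    finally have "ev \<Theta> (n + k) (els \<Xi> a (tctx (n + k) \<Theta>) rs) (vars n (n + k)) u = el \<Xi> a (n + k) (msub (n + k) (zip \<Theta> rs) (ren n (n + k) id u))"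
      using ev_eq_el_msub[OF wu rs a] by (simp add: id_def)
    also have "zip \<Theta> rs = map (\<lambda>(m, s). (m, ren (k + m) (n + k + m) (\<lambda>i. n + i) s)) (zip \<Theta> ss)"
      by (rule nth_equalityI) (use ls in \<open>auto simp: rs_def\<close>)
    finally show ?thesis by (simp add: emsub_def id_def)
  qed
  moreover have "derivable E \<Xi> (n + k) (emsub n k (zip \<Theta> ss) t) (emsub n k (zip \<Theta> ss) t')"
    by (rule d_msub[OF d ls ls]) (rule d_refl[OF sj])
  ultimately show "ev \<Theta> (n + k) (msb \<Theta> k (n + k) (new_vars n k) \<theta>) (vars n (n + k)) t =
      ev \<Theta> (n + k) (msb \<Theta> k (n + k) (new_vars n k) \<theta>) (vars n (n + k)) t'"
    using w el_derivable unfolding th by simp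
qed

lemma e_model_F: "e_model clone_model"
  unfolding e_model_def
proof (intro conjI ballI)
  show "sig_model E clone_model" by (rule sig_model_clone_model)
  fix e assume "e \<in> eqns E"
  then obtain \<Theta> n t t' where e: "e = (\<Theta>, n, t, t')" "(\<Theta>, n, t, t') \<in> eqns E" by (cases e) auto
  have d: "derivable E \<Theta> n t t'" by (rule d_eqn[OF e(2)])
  show "satisfies clone_model e"
    unfolding e(1) using satisfies_clone_model F_valid[OF d] derivable_wf[OF d] by blast
qed

lemma model_tup_F: "model_tup clone_model \<Theta> as \<longleftrightarrow> fam \<Theta> as"
proof -
  interpret M: op_clone E "fob (car clone_model)" "m_var clone_model" "m_sub clone_model" "m_op clone_model"
    by (rule e_model_clone[OF e_model_F])
  show ?thesis unfolding model_tup_def M.tup_def by (simp add: fam_def)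
qed

lemma model_cev_F:
  assumes "wf_trm E \<Theta> n t" "fam \<Theta> as"
  shows "model_cev clone_model \<Theta> n as t = el \<Theta> (tpl \<Theta> as) n t"
proof -
  interpret h: clone_hom E "\<lambda>n. fob F [n]" F_var F_sub F_op "\<lambda>n. fob F [n]" "m_var clone_model" "m_sub clone_model" "m_op clone_model" "\<lambda>_ x. x"
    by (rule clone_model_hom_id)
  have "map2 (\<lambda>_ x. x) \<Theta> as = as"
    using assms(2) by (intro nth_equalityI) (auto simp: fam_def list_all2_conv_all_nth)
  then have "h.D.cev \<Theta> n as t = cev \<Theta> n as t"
    using h.h_cev[OF assms(1) assms(2)[unfolded fam_eq_tup]] by simp
  then show ?thesis unfolding model_cev_def using cev_eq_el[OF assms] by simp
qed

end

section \<open>The equivalence\<close>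

context coded_presentation
begin

text \<open>
  The isomorphism sends the code of a tuple to the corresponding element of the product \<open>F \<Theta>\<close>.  It is
  natural, because terms define the same operations in \<open>F\<close> and in its clone (\<open>cev_eq_el\<close>).
\<close>

lemma essentially_surjective_Phi:
  assumes F: "cartesian_functor (MM E) SET F"
  shows "\<exists>A\<in>obj (models E). \<exists>\<tau>. is_iso FMod (fob Phi A) F \<tau>"
proof -
  interpret F: functorial_model E F by unfold_locales (rule F)
  let ?A = "F.clone_model"
  note A = F.e_model_F
  define \<tau> where "\<tau> = (\<lambda>\<Theta>. \<lambda>x\<in>tuples ?A \<Theta>. F.tpl \<Theta> (dec (length \<Theta>) x))"
  have len: "F.fam \<Theta> as \<Longrightarrow> length as = length \<Theta>" for \<Theta> as by (simp add: F.fam_def list_all2_lengthD)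
  have \<tau>: "\<tau> \<Theta> (enc as) = F.tpl \<Theta> as" if "F.fam \<Theta> as" for \<Theta> as
    using that tuplesI[of ?A \<Theta> as] len[OF that] by (simp add: \<tau>_def F.model_tup_F)
  have bij: "bij_betw (\<tau> \<Theta>) (tuples ?A \<Theta>) (fob F \<Theta>)" for \<Theta>
    unfolding bij_betw_def
  proof
    show "inj_on (\<tau> \<Theta>) (tuples ?A \<Theta>)"
    proof (rule inj_onI)
      fix x y assume "x \<in> tuples ?A \<Theta>" "y \<in> tuples ?A \<Theta>" and e: "\<tau> \<Theta> x = \<tau> \<Theta> y"
      obtain as where x: "x = enc as" "F.fam \<Theta> as"
        using \<open>x \<in> tuples ?A \<Theta>\<close> by (rule tuplesE) (simp add: F.model_tup_F)
      obtain bs where y: "y = enc bs" "F.fam \<Theta> bs"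
        using \<open>y \<in> tuples ?A \<Theta>\<close> by (rule tuplesE) (simp add: F.model_tup_F)
      have t: "F.tpl \<Theta> as = F.tpl \<Theta> bs"
        using e unfolding x(1) y(1) \<tau>[OF x(2)] \<tau>[OF y(2)] .
      have "as = bs"
        by (rule trans[OF F.els_gens[OF x(2), symmetric]]) (unfold t, rule F.els_gens[OF y(2)])
      then show "x = y" unfolding x(1) y(1) by simp
    qed
    show "\<tau> \<Theta> ` tuples ?A \<Theta> = fob F \<Theta>"
    proof (intro equalityI subsetI)
      fix y assume "y \<in> \<tau> \<Theta> ` tuples ?A \<Theta>"
      then show "y \<in> fob F \<Theta>" by (auto simp: F.model_tup_F \<tau> F.tpl_in elim!: tuplesE)
    next
      fix y assume y: "y \<in> fob F \<Theta>"
      let ?as = "F.els \<Theta> y \<Theta> (map (gen \<Theta>) [0..<length \<Theta>])"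
      have f: "F.fam \<Theta> ?as" by (rule F.fam_els[OF wfs_gen y])
      have "F.tpl \<Theta> ?as = y" by (rule F.tpl_eqI[OF f y]) simp
      then show "y \<in> \<tau> \<Theta> ` tuples ?A \<Theta>"
        using \<tau>[OF f] tuplesI[of ?A \<Theta> ?as] f by (metis F.model_tup_F imageI)
    qed
  qed
  have nt: "nat_trans (MM E) SET (Phi_ob ?A) F \<tau>"
    unfolding nat_trans_def
  proof (intro conjI allI impI)
    show "\<tau> \<in> (\<Pi>\<^sub>E \<Theta>\<in>obj (MM E). hom SET (fob (Phi_ob ?A) \<Theta>) (fob F \<Theta>))"
      using bij_betwE[OF bij] by (intro PiE_I) (auto simp: \<tau>_def)
    fix a b f assume "f \<in> hom (MM E) a b"
    then obtain ts where ts: "wfs E a b ts" and f: "f = mor a b ts" by (auto simp: hom_MM)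
    have "\<tau> b (far (Phi_ob ?A) a b f x) = far F a b f (\<tau> a x)" if xa: "x \<in> tuples ?A a" for x
    proof -
      obtain as where as: "F.fam a as" and x: "x = enc as"
        using xa by (rule tuplesE) (simp add: F.model_tup_F)
      have m: "model_tup ?A a as" using as by (simp add: F.model_tup_F)
      have "model_cevs ?A a b as ts = F.els a (F.tpl a as) b ts"
        using F.model_cev_F[OF wfs_nth[OF ts] as] wfs_length[OF ts]
        by (intro nth_equalityI) (auto simp: model_cevs_def F.els_def)
      moreover have "F.fam b (F.els a (F.tpl a as) b ts)" by (rule F.fam_els[OF ts F.tpl_in[OF as]])
      ultimately show ?thesis
        unfolding x f far_Phi[OF A ts m] \<tau>[OF as] F.far_F_eq_tpl[OF ts F.tpl_in[OF as]] by (simp add: \<tau>)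
    qed
    then show "comp SET (fob (Phi_ob ?A) a) (fob (Phi_ob ?A) b) (fob F b) (\<tau> b) (far (Phi_ob ?A) a b f) =
       comp SET (fob (Phi_ob ?A) a) (fob F a) (fob F b) (far F a b f) (\<tau> a)"
      by (auto simp: compose_def fun_eq_iff)
  qed
  have "is_iso (fun_cat (MM E) SET) (Phi_ob ?A) F \<tau>"
    by (rule is_iso_fun_cat_SET[OF is_functor_Phi_ob[OF A] F.functor_F nt category_MM]) (simp add: bij)
  then have "is_iso FMod (Phi_ob ?A) F \<tau>"
    using F cartesian_Phi_ob[OF A] by (auto simp: is_iso_def full_subcat_def)
  moreover have "?A \<in> obj (models E)" using A by (simp add: obj_models)
  ultimately show ?thesis using Phi_simps(1) by metis
qed

lemma equivalence: "equivalent_categories (models E :: (('o, 'u) smodel, nat \<Rightarrow> 'u \<Rightarrow> 'u) cat) FMod"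
proof (rule fully_faithful_essentially_surjective_equivalence[OF category_models _ is_functor_Phi])
  show "category FMod"
    by (rule category_full_subcat[OF category_fun_cat[OF category_MM category_SET]])
  show "bij_betw (far Phi A B) (hom (models E) A B) (hom FMod (fob Phi A) (fob Phi B))"
    if "A \<in> obj (models E)" "B \<in> obj (models E)" for A B
    by (rule fully_faithful_Phi[OF that])
  show "\<exists>A\<in>obj (models E). \<exists>f. is_iso FMod (fob Phi A) F f" if "F \<in> obj FMod" for F
    using essentially_surjective_Phi that by (simp add: obj_FMod)
qed

end

theorem theorem7p6:
  fixes E :: "'o pres"
  assumes "presentation E"
    and "infinite (UNIV :: 'u set)"
  shows "equivalent_categories
    (models E :: (('o, 'u) smodel, nat \<Rightarrow> 'u \<Rightarrow> 'u) cat)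
    (functorial_models (theory_of E) ::
      ((nat list, 'o trm set list, 'u set, 'u \<Rightarrow> 'u) ftr, nat list \<Rightarrow> 'u \<Rightarrow> 'u) cat)"
proof -
  obtain enc :: "'u list \<Rightarrow> 'u" where enc: "\<forall>xs ys. length xs = length ys \<longrightarrow> enc xs = enc ys \<longrightarrow> xs = ys"
    using exists_tuple_coding[OF assms(2)] by blast
  interpret coded_presentation E enc
    by unfold_locales (use assms(1) enc in auto)
  show ?thesis
    using equivalence by (simp add: functorial_models_def theory_of_def)
qed

end
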